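(* Let $q>1$, let $\Pi_n\sim\mathrm{Mallows}(n,q)$, and for $i\ge1$ let $\mu_{2i}$ be the centering constants of the Gaussian limit for even cycle counts, i.e. the (unique) constants such that $n^{-1/2}(C_2(\Pi_n)-\mu_2n,\dots,C_{2\ell}(\Pi_n)-\mu_{2\ell}n)$ converges in distribution to a centered multivariate normal for every $\ell$; equivalently $\mu_{2i}=\lim_{n\to\infty}\mathbb{E}\,C_{2i}(\Pi_n)/n$. Let $\Sigma,\Sigma'\sim\mathrm{Mallows}(\mathbb{Z},1/q)$ be independent. Then: (1) For $i=1,2,\dots$, $\mu_{2i}=\frac{1}{2i}\,\mathbb{P}(0\text{ is in an }i\text{-cycle of }\Sigma'\circ\Sigma)$; in particular $\mu_2=\frac12\sum_{i\in\mathbb{Z}}\mathbb{P}(\Sigma(0)=i)^2$. (2) $\sum_{i=1}^\infty 2i\,\mu_{2i}=1$. (3) $(\mu_2,\mu_4,\mu_6,\dots)\to(0,0,0,\dots)$ as $q\downarrow1$ and $(\mu_2,\mu_4,\mu_6,\dots)\to(1/2,0,0,\dots)$ as $q\to\infty$, with convergence in the $\ell_1$-norm.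
   Context: For a finite set $A\subseteq\mathbb{Z}$ and a bijection $\pi:A\to A$, $\mathrm{inv}(\pi)$ is the number of pairs $i<j$ in $A$ with $\pi(i)>\pi(j)$, and $\Pi_A\sim\mathrm{Mallows}(A,q)$ means $\mathbb{P}(\Pi_A=\pi)\propto q^{\mathrm{inv}(\pi)}$ over bijections $\pi$ of $A$; $\mathrm{Mallows}(n,q):=\mathrm{Mallows}([n],q)$ with $[n]=\{1,\dots,n\}$. For a bijection $\sigma$ of a set $B\subseteq\mathbb{Z}$ and finite $A\subseteq B$, the pattern $\sigma_A:A\to A$ is defined by $\sigma_A(a)=a_{(i)}$ when $\sigma(a)$ is the $i$-th smallest element of $\sigma[A]$, where $a_{(i)}$ is the $i$-th smallest element of $A$. For $0<q<1$, $\mathrm{Mallows}(\mathbb{Z},q)$ is Gnedin and Olshanski's bi-infinite Mallows measure: the law of a random bijection $\Sigma$ of $\mathbb{Z}$ such that $\Sigma_I\sim\mathrm{Mallows}(I,q)$ for every finite interval of integers $I$, and, with $I_n=\{-n,\dots,n\}$, almost surely for every $i\in\mathbb{Z}$ one has $\Sigma_{I_n}(i)=\Sigma(i)$ for all sufficiently large $n$. $C_i(\pi)$ denotes the number of cycles of length $i$ of a permutation $\pi$. *)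

theory Defs
  imports "HOL-Probability.Probability" "HOL-Combinatorics.Permutations"
begin

definition inv_count :: "int set \<Rightarrow> (int \<Rightarrow> int) \<Rightarrow> nat" where
  "inv_count A p = card {(i, j). i \<in> A \<and> j \<in> A \<and> i < j \<and> p i > p j}"

definition mallows_prob :: "real \<Rightarrow> int set \<Rightarrow> (int \<Rightarrow> int) \<Rightarrow> real" where
  "mallows_prob q A p =
     q ^ inv_count A p / (\<Sum>s\<in>{s. s permutes A}. q ^ inv_count A s)"

definition pattern :: "(int \<Rightarrow> int) \<Rightarrow> int set \<Rightarrow> int \<Rightarrow> int" where
  "pattern s A a = (if a \<in> A then sorted_list_of_set A ! card {b \<in> s ` A. b < s a} else a)"

text \<open>Forward orbit of x under f (for a bijection: the cycle of x if finite).\<close>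
definition fwd_orbit :: "(int \<Rightarrow> int) \<Rightarrow> int \<Rightarrow> int set" where
  "fwd_orbit f x = range (\<lambda>k. (f ^^ k) x)"

definition cycle_count :: "nat \<Rightarrow> (int \<Rightarrow> int) \<Rightarrow> int set \<Rightarrow> nat" where
  "cycle_count k p A = card {fwd_orbit p x | x. x \<in> A \<and> card (fwd_orbit p x) = k}"

definition exp_cycle_count :: "real \<Rightarrow> nat \<Rightarrow> nat \<Rightarrow> real" where
  "exp_cycle_count q k n =
     (\<Sum>p\<in>{p. p permutes {1..int n}}. mallows_prob q {1..int n} p * real (cycle_count k p {1..int n}))"

definition mu :: "real \<Rightarrow> nat \<Rightarrow> real" where
  "mu q i = lim (\<lambda>n. exp_cycle_count q (2 * i) n / real n)"

abbreviation perm_space :: "(int \<Rightarrow> int) measure" where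
  "perm_space \<equiv> PiM UNIV (\<lambda>_. count_space UNIV)"

definition mallows_Z :: "'a measure \<Rightarrow> real \<Rightarrow> ('a \<Rightarrow> int \<Rightarrow> int) \<Rightarrow> bool" where
  "mallows_Z M r S \<longleftrightarrow>
     prob_space M \<and> S \<in> measurable M perm_space \<and>
     (\<forall>\<omega>\<in>space M. bij (S \<omega>)) \<and>
     (\<forall>a b p. p permutes {a..b} \<longrightarrow>
        measure M {\<omega> \<in> space M. pattern (S \<omega>) {a..b} = p} = mallows_prob r {a..b} p) \<and>
     (AE \<omega> in M. \<forall>i. eventually (\<lambda>n. pattern (S \<omega>) {- int n..int n} i = S \<omega> i) sequentially)"

end

theory Submission
  imports Defs "HOL-Real_Asymp.Real_Asymp"
begin

text \<open>
  Reversing the values turns the law with parameter \<open>q > 1\<close> into the one with parameter \<open>p = 1/q < 1\<close>,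
  so that \<open>\<Pi> = r \<circ> \<sigma>\<close> with \<open>r z = n + 1 - z\<close>. Rearranging the positions inside an interval multiplies the weight
  by a factor that depends on the pattern there only; hence patterns on disjoint intervals are independent and
  again Mallows. Long inversions are exponentially unlikely, so \<open>\<sigma>\<close> is determined near a point, up to a small error,
  by its pattern on a window around that point. Away from the centre \<open>\<Pi>\<close> alternates between a window at
  \<open>x\<close> and its mirror image, so that \<open>\<Pi>\<^sup>2\<close> looks locally like \<open>\<Sigma>' \<circ> \<Sigma>\<close>; this gives the limit and its
  identification. Common cuts of \<open>\<Sigma>\<close> and \<open>\<Sigma>'\<close> have positive density by independence of distant windows, hence
  all cycles of \<open>\<Sigma>' \<circ> \<Sigma>\<close> are finite and no mass is lost. As \<open>q \<down> 1\<close>, merging a \<open>k\<close>-cycle with a nearby cycle by a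
  transposition costs almost nothing and can be done in many ways, so short cycles disappear; as \<open>q \<rightarrow> \<infinity>\<close>, \<open>\<Sigma>\<close>
  fixes \<open>0\<close> with probability tending to 1.
\<close>

section \<open>Patterns and resampling\<close>

text \<open>Mallows(\<int>, 1/q) enters only as a hypothesis, while the convergence of the
  densities, the total mass and the limits in \<open>q\<close> must hold without it. Everything
  therefore passes through one finite quantity, \<open>local_cycle_prob p i L\<close>, built from
  two independent permutations of \<open>{-L..L}\<close>; both the cycle densities and the
  bi-infinite probability are identified by its limit in \<open>L\<close>. The decay ratio is
  \<open>sqrt p\<close> and not \<open>p\<close> because an inversion at distance \<open>d\<close>
  can share the displacement between its two ends, each moving only about \<open>d / 2\<close>.
  Locality is lost near both ends of \<open>{1..n}\<close>, where a window does not fit, and near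
  the centre, where a window overlaps its mirror image and independence breaks down. These O(L)
  positions disappear after division by \<open>n\<close>. Convergence in l1 needs no estimate
  uniform in the cycle length: since the numbers \<open>2 * i * mu q i\<close> sum to 1, the tail of
  \<open>mu q i\<close> beyond \<open>K\<close> is at most \<open>1 / (2 * (K + 1))\<close>.\<close>

lemma card_sorted_nth_interval:
  fixes a b :: int
  assumes "k < card {a..b}"
  shows "sorted_list_of_set {a..b} ! k = a + int k"
  using assms by (simp add: sorted_list_of_set_greaterThanAtMost nth_upto)

lemma card_below_lt:
  fixes s :: "int \<Rightarrow> int"
  assumes "x \<in> {a..b}"
  shows "card {c \<in> {a..b}. s c < s x} < card {a..b}"
proof (rule psubset_card_mono)
  have "x \<notin> {c \<in> {a..b}. s c < s x}" by simp
  then show "{c \<in> {a..b}. s c < s x} \<subset> {a..b}" using assms by blast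
qed simp

text \<open>Injectivity lets the smaller values be counted by their positions, which turns the
  sorted list into an arithmetic expression.\<close>

lemma pattern_interval:
  assumes inj: "inj_on s {a..b}" and x: "x \<in> {a..b}"
  shows "pattern s {a..b} x = a + int (card {c \<in> {a..b}. s c < s x})"
proof -
  have im: "{v \<in> s ` {a..b}. v < s x} = s ` {c \<in> {a..b}. s c < s x}" by auto
  have "card {v \<in> s ` {a..b}. v < s x} = card {c \<in> {a..b}. s c < s x}"
    unfolding im by (rule card_image[OF inj_on_subset[OF inj]]) auto
  moreover have "card {c \<in> {a..b}. s c < s x} < card {a..b}"
    by (rule card_below_lt[OF x])
  ultimately show ?thesis
    using x card_sorted_nth_interval[of "card {c \<in> {a..b}. s c < s x}" a b]
    by (simp add: pattern_def)
qed

lemma pattern_outside: "x \<notin> A \<Longrightarrow> pattern s A x = x"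
  by (simp add: pattern_def)

lemma pattern_less_iff:
  assumes inj: "inj_on s {a..b}" and x: "x \<in> {a..b}" and y: "y \<in> {a..b}"
  shows "pattern s {a..b} x < pattern s {a..b} y \<longleftrightarrow> s x < s y"
proof -
  have less: "card {c \<in> {a..b}. s c < s u} < card {c \<in> {a..b}. s c < s v}"
    if "s u < s v" "u \<in> {a..b}" for u v
  proof (rule psubset_card_mono)
    show "finite {c \<in> {a..b}. s c < s v}" by (rule finite_Collect_conjI) simp
    have "u \<in> {c \<in> {a..b}. s c < s v}" "u \<notin> {c \<in> {a..b}. s c < s u}" using that by auto
    then show "{c \<in> {a..b}. s c < s u} \<subset> {c \<in> {a..b}. s c < s v}" using that(1) by force
  qed
  consider "s x < s y" | "s y < s x" | "x = y"
    using inj x y by (metis inj_onD linorder_neqE)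
  then show ?thesis
    using less[of x y] less[of y x] x y
    by cases (auto simp: pattern_interval[OF inj x] pattern_interval[OF inj y])
qed

lemma pattern_permutes:
  assumes inj: "inj_on s {a..b}"
  shows "pattern s {a..b} permutes {a..b}"
proof -
  have into: "pattern s {a..b} ` {a..b} \<subseteq> {a..b}"
  proof
    fix y assume "y \<in> pattern s {a..b} ` {a..b}"
    then obtain x where x: "x \<in> {a..b}" "y = pattern s {a..b} x" by auto
    have "card {c \<in> {a..b}. s c < s x} < card {a..b}"
      by (rule card_below_lt[OF x(1)])
    with x show "y \<in> {a..b}" by (auto simp: pattern_interval[OF inj])
  qed
  have "inj_on (pattern s {a..b}) {a..b}"
  proof (rule inj_onI)
    fix x y assume xy: "x \<in> {a..b}" "y \<in> {a..b}" "pattern s {a..b} x = pattern s {a..b} y"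
    then have "\<not> s x < s y" "\<not> s y < s x"
      using pattern_less_iff[OF inj xy(1,2)] pattern_less_iff[OF inj xy(2,1)] by auto
    then have "s x = s y" by simp
    then show "x = y" using inj xy by (simp add: inj_on_def)
  qed
  then have "bij_betw (pattern s {a..b}) {a..b} {a..b}"
    using into by (simp add: bij_betw_def endo_inj_surj)
  then show ?thesis
    by (rule bij_imp_permutes) (rule pattern_outside)
qed

lemma pattern_cong_order:
  assumes "inj_on s {a..b}" "inj_on t {a..b}"
    and "\<And>x y. x \<in> {a..b} \<Longrightarrow> y \<in> {a..b} \<Longrightarrow> s x < s y \<longleftrightarrow> t x < t y"
  shows "pattern s {a..b} = pattern t {a..b}"
proof
  fix x
  show "pattern s {a..b} x = pattern t {a..b} x"
  proof (cases "x \<in> {a..b}")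
    case True
    then have "{c \<in> {a..b}. s c < s x} = {c \<in> {a..b}. t c < t x}" using assms(3) by blast
    then show ?thesis using True assms(1,2) by (simp add: pattern_interval)
  qed (simp add: pattern_outside)
qed

text \<open>The values below \<open>t x\<close> fill \<open>{a..<t x}\<close>, so the rank of a
  value is the value itself.\<close>

lemma pattern_id_on_permutes:
  assumes t: "t permutes {a..b}"
  shows "pattern t {a..b} = t"
proof
  fix x
  show "pattern t {a..b} x = t x"
  proof (cases "x \<in> {a..b}")
    case True
    have tx: "t x \<in> {a..b}" using True by (simp only: permutes_in_image[OF t])
    have "t ` {c \<in> {a..b}. t c < t x} = {a..<t x}"
    proof -
      have "t ` {c \<in> {a..b}. t c < t x} = {v \<in> t ` {a..b}. v < t x}" by auto
      also have "\<dots> = {a..<t x}" using tx by (auto simp: permutes_image[OF t])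
      finally show ?thesis .
    qed
    then have "card {c \<in> {a..b}. t c < t x} = card {a..<t x}"
      by (metis (no_types, lifting) card_image inj_on_subset permutes_inj_on[OF t])
    then show ?thesis
      using True tx by (simp add: pattern_interval permutes_inj_on[OF t])
  qed (use t in \<open>simp add: pattern_outside permutes_not_in\<close>)
qed

lemma pattern_eqI:
  assumes "inj_on s {a..b}" "t permutes {a..b}"
    and "\<And>x y. x \<in> {a..b} \<Longrightarrow> y \<in> {a..b} \<Longrightarrow> s x < s y \<longleftrightarrow> t x < t y"
  shows "pattern s {a..b} = t"
  using pattern_cong_order[OF assms(1) permutes_inj_on[OF assms(2)] assms(3)]
    pattern_id_on_permutes[OF assms(2)] by simp

text \<open>Provides the invariance that \<open>mexp_resample\<close> asks for when a function looks
  only at the pattern on \<open>J\<close>; independence of patterns on disjoint intervals rests on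
  it.\<close>

lemma pattern_comp_disjoint:
  assumes "t permutes I" "I \<inter> J = {}"
  shows "pattern (s \<circ> t) J = pattern s J"
proof -
  have t: "t c = c" if "c \<in> J" for c using assms that by (meson disjoint_iff permutes_not_in)
  then have "(s \<circ> t) ` J = s ` J" by force
  then show ?thesis using t by (intro ext) (simp add: pattern_def)
qed

text \<open>Only inversions with both positions in the interval \<open>{a..b}\<close> are affected by a rearrangement of
  the positions in \<open>{a..b}\<close>.\<close>

lemma inv_count_comp_interval:
  assumes A: "finite A" and sub: "{a..b} \<subseteq> A" and t: "t permutes {a..b}"
  shows "inv_count A (s \<circ> t) + inv_count {a..b} s = inv_count A s + inv_count {a..b} (s \<circ> t)"
proof -
  define Out where "Out s = {(i, j). i \<in> A \<and> j \<in> A \<and> \<not> (i \<in> {a..b} \<and> j \<in> {a..b}) \<and> i < j \<and> s i > s j}"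
    for s :: "int \<Rightarrow> int"
  define Inn where "Inn s = {(i, j). i \<in> {a..b} \<and> j \<in> {a..b} \<and> i < j \<and> s i > s j}"
    for s :: "int \<Rightarrow> int"
  have fin: "finite (Out s)" "finite (Inn s)" for s
    by (rule finite_subset[of _ "A \<times> A"], use A sub in \<open>auto simp: Out_def Inn_def\<close>)+
  have split: "inv_count A s = card (Out s) + inv_count {a..b} s" for s
  proof -
    have "{(i, j). i \<in> A \<and> j \<in> A \<and> i < j \<and> s i > s j} = Out s \<union> Inn s"
      using sub by (auto simp: Out_def Inn_def)
    moreover have "Out s \<inter> Inn s = {}" by (auto simp: Out_def Inn_def)
    ultimately show ?thesis
      unfolding inv_count_def Inn_def[symmetric] using fin by (simp add: card_Un_disjoint)
  qed
  have tin: "t i \<in> {a..b} \<longleftrightarrow> i \<in> {a..b}" for i by (simp only: permutes_in_image[OF t])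
  have tout: "i \<notin> {a..b} \<Longrightarrow> t i = i" for i using t by (simp add: permutes_not_in)
  \<comment> \<open>A point outside the interval lies on the same side of all points of the
    interval, so moving the other point within it keeps the order.\<close>
  have ord: "t i < t j \<longleftrightarrow> i < j" if "\<not> (i \<in> {a..b} \<and> j \<in> {a..b})" for i j
    using that tin[of i] tin[of j] tout[of i] tout[of j] by (cases "i \<in> {a..b}"; cases "j \<in> {a..b}") auto
  have inA: "t i \<in> A \<longleftrightarrow> i \<in> A" for i using tin[of i] tout[of i] sub by (cases "i \<in> {a..b}") auto
  have "bij_betw (\<lambda>(i, j). (t i, t j)) (Out (s \<circ> t)) (Out s)"
  proof (rule bij_betw_byWitness[where f' = "\<lambda>(i, j). (inv t i, inv t j)"])
    show "(\<lambda>(i, j). (t i, t j)) ` Out (s \<circ> t) \<subseteq> Out s"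
      using ord inA tin by (auto simp: Out_def)
    show "(\<lambda>(i, j). (inv t i, inv t j)) ` Out s \<subseteq> Out (s \<circ> t)"
    proof clarify
      fix i j assume ij: "(i, j) \<in> Out s"
      have "t (inv t i) = i" "t (inv t j) = j" using t by (auto simp: permutes_inverses)
      then show "(inv t i, inv t j) \<in> Out (s \<circ> t)"
        using ij ord[of "inv t i" "inv t j"] inA[of "inv t i"] inA[of "inv t j"] tin[of "inv t i"] tin[of "inv t j"]
        unfolding Out_def by auto
    qed
  qed (use t in \<open>auto simp: permutes_inverses\<close>)
  then have "card (Out (s \<circ> t)) = card (Out s)" by (rule bij_betw_same_card)
  then show ?thesis using split[of s] split[of "s \<circ> t"] by simp
qed

lemma inv_count_pattern:
  assumes inj: "inj_on s {a..b}"
  shows "inv_count {a..b} (pattern s {a..b}) = inv_count {a..b} s"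
  unfolding inv_count_def
  by (rule arg_cong[where f = card]) (use pattern_less_iff[OF inj] in auto)

lemma inv_count_le: "finite A \<Longrightarrow> inv_count A s \<le> (card A)\<^sup>2"
  unfolding inv_count_def power2_eq_square card_cartesian_product[symmetric]
  by (rule card_mono) auto

text \<open>As a finite sum, expectation over two independent permutations is just a nested
  \<open>mexp\<close>, and no measurability question arises before the bi-infinite law
  enters.\<close>

definition mexp :: "real \<Rightarrow> int set \<Rightarrow> ((int \<Rightarrow> int) \<Rightarrow> real) \<Rightarrow> real" where
  "mexp p A g = (\<Sum>s\<in>{s. s permutes A}. mallows_prob p A s * g s)"

lemma mallows_partition_pos:
  fixes p :: real
  assumes "0 < p" "finite A"
  shows "0 < (\<Sum>s\<in>{s. s permutes A}. p ^ inv_count A s)"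
proof -
  have "{s. s permutes A} \<noteq> {}" using permutes_id by blast
  then show ?thesis using assms by (intro sum_pos) (auto simp: finite_permutations)
qed

lemma mallows_prob_pos: "0 < p \<Longrightarrow> finite A \<Longrightarrow> 0 < mallows_prob p A s"
  by (simp add: mallows_prob_def mallows_partition_pos)

lemma sum_mallows_prob:
  assumes "0 < p" "finite A"
  shows "(\<Sum>s\<in>{s. s permutes A}. mallows_prob p A s) = 1"
  using mallows_partition_pos[OF assms]
  by (simp add: mallows_prob_def sum_divide_distrib[symmetric])

lemma mexp_cong:
  "(\<And>s. s permutes A \<Longrightarrow> g s = h s) \<Longrightarrow> mexp p A g = mexp p A h"
  unfolding mexp_def by (intro sum.cong) auto

lemma mexp_const: "0 < p \<Longrightarrow> finite A \<Longrightarrow> mexp p A (\<lambda>_. c) = c"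
  by (simp add: mexp_def sum_distrib_right[symmetric] sum_mallows_prob)

lemma mexp_mono:
  assumes "0 < p" "finite A" "\<And>s. s permutes A \<Longrightarrow> g s \<le> h s"
  shows "mexp p A g \<le> mexp p A h"
  unfolding mexp_def
  by (intro sum_mono mult_left_mono) (use assms mallows_prob_pos[OF assms(1,2)] in \<open>auto intro: less_imp_le\<close>)

lemma mexp_le_const:
  assumes "0 < p" "finite A" "\<And>s. s permutes A \<Longrightarrow> g s \<le> c"
  shows "mexp p A g \<le> c"
  using mexp_mono[OF assms(1,2), of g "\<lambda>_. c"] assms by (simp add: mexp_const)

lemma mexp_ge_const:
  assumes "0 < p" "finite A" "\<And>s. s permutes A \<Longrightarrow> c \<le> g s"
  shows "c \<le> mexp p A g"
  using mexp_mono[OF assms(1,2), of "\<lambda>_. c" g] assms by (simp add: mexp_const)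

lemma mexp_add: "mexp p A (\<lambda>s. g s + h s) = mexp p A g + mexp p A h"
  by (simp add: mexp_def distrib_left sum.distrib)

lemma mexp_diff: "mexp p A (\<lambda>s. g s - h s) = mexp p A g - mexp p A h"
  by (simp add: mexp_def right_diff_distrib sum_subtractf)

lemma mexp_cmult: "mexp p A (\<lambda>s. c * g s) = c * mexp p A g"
  by (simp add: mexp_def sum_distrib_left mult.left_commute)

lemma mexp_cmult_right: "mexp p A (\<lambda>s. g s * c) = mexp p A g * c"
  using mexp_cmult[of p A c g] by (simp add: mult.commute)

lemma mexp_sum: "mexp p A (\<lambda>s. \<Sum>x\<in>X. g x s) = (\<Sum>x\<in>X. mexp p A (g x))"
  unfolding mexp_def sum_distrib_left by (rule sum.swap)

lemma mexp_swap: "mexp p A (\<lambda>s. mexp p' B (g s)) = mexp p' B (\<lambda>t. mexp p A (\<lambda>s. g s t))"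
  unfolding mexp_def sum_distrib_left
  by (subst sum.swap) (simp add: mult.left_commute)

lemma mexp_of_bool_le_sum:
  assumes "0 < p" "finite A" "finite X" "\<And>s. s permutes A \<Longrightarrow> P s \<Longrightarrow> \<exists>x\<in>X. Q x s"
  shows "mexp p A (\<lambda>s. of_bool (P s)) \<le> (\<Sum>x\<in>X. mexp p A (\<lambda>s. of_bool (Q x s)))"
  unfolding mexp_sum[symmetric]
proof (rule mexp_mono[OF assms(1,2)])
  fix s assume s: "s permutes A"
  show "(of_bool (P s) :: real) \<le> (\<Sum>x\<in>X. of_bool (Q x s))"
  proof (cases "P s")
    case True
    then obtain x where "x \<in> X" "Q x s" using assms(4) s by blast
    then show ?thesis
      using True member_le_sum[of x X "\<lambda>x. of_bool (Q x s) :: real"] assms(3) by simp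
  qed (simp add: sum_nonneg)
qed

text \<open>Exchanging the pattern of \<open>s\<close> with an independent \<open>t\<close> is a weight preserving involution of
  the set of pairs \<open>(s, t)\<close>.\<close>

lemma mexp_resample:
  assumes p: "0 < p" and A: "finite A" and sub: "{a..b} \<subseteq> A"
    and F: "\<And>t s t'. s permutes A \<Longrightarrow> t permutes {a..b} \<Longrightarrow> t' permutes {a..b} \<Longrightarrow> F t (s \<circ> t') = F t s"
  shows "mexp p A (\<lambda>s. F (pattern s {a..b}) s) = mexp p A (\<lambda>s. mexp p {a..b} (\<lambda>t. F t s))"
proof -
  let ?I = "{a..b}"
  let ?SA = "{s. s permutes A}" and ?SI = "{t. t permutes ?I}"
  define w where "w s = p ^ inv_count A s" for s
  define v where "v t = p ^ inv_count ?I t" for t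
  \<comment> \<open>\<open>s \<circ> inv (pattern s ?I)\<close> is increasing on the interval, so
    composing it with \<open>t\<close> gives it the pattern \<open>t\<close>. The old pattern is
    kept in the second component, which makes \<open>X\<close> its own inverse.\<close>
  define X :: "(int \<Rightarrow> int) \<times> (int \<Rightarrow> int) \<Rightarrow> _" where "X = (\<lambda>(s, t). (s \<circ> inv (pattern s ?I) \<circ> t, pattern s ?I))"
  have key: "fst (X (s, t)) permutes A \<and> pattern s ?I permutes ?I \<and> pattern (fst (X (s, t))) ?I = t \<and>
       w (fst (X (s, t))) * v (pattern s ?I) = w s * v t \<and> X (X (s, t)) = (s, t)
       \<and> F t s = F t (fst (X (s, t)))"
    if s: "s permutes A" and t: "t permutes ?I" for s t
  proof -
    define r where "r = pattern s ?I"
    have inj: "inj_on s ?I" using s by (rule permutes_inj_on)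
    have r: "r permutes ?I" unfolding r_def by (rule pattern_permutes[OF inj])
    define t' where "t' = inv r \<circ> t"
    have t': "t' permutes ?I" unfolding t'_def by (intro permutes_compose permutes_inv r t)
    have fst: "fst (X (s, t)) = s \<circ> t'" by (simp add: X_def t'_def r_def o_assoc)
    have perm: "s \<circ> t' permutes A"
      by (rule permutes_compose[OF permutes_subset[OF t' sub] s])
    have tin: "t' x \<in> ?I" if "x \<in> ?I" for x using that by (simp only: permutes_in_image[OF t'])
    have rt: "r (t' x) = t x" for x
      using r by (simp add: t'_def permutes_inverses)
    have pat: "pattern (s \<circ> t') ?I = t"
    proof (rule pattern_eqI[OF permutes_inj_on[OF perm] t])
      fix x y assume xy: "x \<in> ?I" "y \<in> ?I"
      show "(s \<circ> t') x < (s \<circ> t') y \<longleftrightarrow> t x < t y"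
        using pattern_less_iff[OF inj tin[OF xy(1)] tin[OF xy(2)]] by (simp add: r_def[symmetric] rt)
    qed
    have "inv_count A (s \<circ> t') + inv_count ?I r = inv_count A s + inv_count ?I t"
      using inv_count_comp_interval[OF A sub t', of s] inv_count_pattern[OF inj]
        inv_count_pattern[OF permutes_inj_on[OF perm], of a b] by (simp add: r_def pat)
    then have wt: "w (s \<circ> t') * v r = w s * v t"
      unfolding w_def v_def by (metis power_add)
    have XX: "X (X (s, t)) = (s, t)"
    proof -
      have "X (s, t) = (s \<circ> t', r)" using fst by (simp add: X_def r_def)
      moreover have "X (s \<circ> t', r) = (s \<circ> t' \<circ> inv t \<circ> r, t)" by (simp add: X_def pat)
      ultimately have "X (X (s, t)) = (s \<circ> t' \<circ> inv t \<circ> r, t)" by simp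
      also have "s \<circ> t' \<circ> inv t \<circ> r = s"
        unfolding t'_def using r t
        by (metis (no_types, lifting) comp_assoc comp_id permutes_inv_o)
      finally show ?thesis .
    qed
    show ?thesis using perm r pat wt XX fst F[OF s t t'] by (simp add: r_def)
  qed
  have fX: "X (s, t) = (fst (X (s, t)), pattern s ?I)" for s t by (simp add: X_def)
  have "(\<Sum>(s, t)\<in>?SA \<times> ?SI. w s * v t * F t s)
      = (\<Sum>(s, t)\<in>?SA \<times> ?SI. w s * v t * F (pattern s ?I) s)"
  proof (rule sum.reindex_bij_witness[where i = X and j = X])
    fix z assume "z \<in> ?SA \<times> ?SI"
    then obtain s t where z: "z = (s, t)" and s: "s permutes A" and t: "t permutes ?I" by auto
    show "X (X z) = z" "X (X z) = z" using key[OF s t] z by auto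
    show "X z \<in> ?SA \<times> ?SI" "X z \<in> ?SA \<times> ?SI"
      unfolding z using key[OF s t] by (subst fX; simp)+
    show "(case X z of (s, t) \<Rightarrow> w s * v t * F (pattern s ?I) s) = (case z of (s, t) \<Rightarrow> w s * v t * F t s)"
      unfolding z using key[OF s t] by (subst fX) simp
  qed
  then have eq: "(\<Sum>s\<in>?SA. \<Sum>t\<in>?SI. w s * v t * F t s)
      = (\<Sum>s\<in>?SA. w s * F (pattern s ?I) s) * (\<Sum>t\<in>?SI. v t)"
    by (simp add: sum.cartesian_product[symmetric] sum_distrib_right sum_distrib_left mult_ac)
  have posI: "(\<Sum>t\<in>?SI. v t) > 0" unfolding v_def by (rule mallows_partition_pos[OF p]) simp
  have l: "mexp p A g = (\<Sum>s\<in>?SA. w s * g s) / (\<Sum>s\<in>?SA. w s)" for g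
    by (simp add: mexp_def mallows_prob_def w_def sum_divide_distrib)
  have r: "mexp p ?I g = (\<Sum>s\<in>?SI. v s * g s) / (\<Sum>s\<in>?SI. v s)" for g
    by (simp add: mexp_def mallows_prob_def v_def sum_divide_distrib)
  have "(\<Sum>s\<in>?SA. w s * mexp p ?I (\<lambda>t. F t s)) = (\<Sum>s\<in>?SA. w s * F (pattern s ?I) s)"
  proof -
    have "(\<Sum>s\<in>?SA. w s * mexp p ?I (\<lambda>t. F t s))
        = (\<Sum>s\<in>?SA. \<Sum>t\<in>?SI. w s * v t * F t s) / (\<Sum>t\<in>?SI. v t)"
      by (simp add: r sum_distrib_left sum_divide_distrib mult.assoc)
    then show ?thesis unfolding eq using posI by simp
  qed
  then show ?thesis unfolding l by simp
qed

text \<open>Resampling with an \<open>F\<close> that ignores \<open>s\<close> leaves only the inner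
  expectation: patterns are again Mallows, whatever the ambient set.\<close>

lemma mexp_pattern:
  assumes "0 < p" "finite A" "{a..b} \<subseteq> A"
  shows "mexp p A (\<lambda>s. g (pattern s {a..b})) = mexp p {a..b} g"
  using mexp_resample[OF assms, of "\<lambda>t s. g t"] assms by (simp add: mexp_const)

text \<open>Resampling on \<open>{a..b}\<close> does not disturb the pattern on
  \<open>{c..d}\<close>; a second use of consistency then gives independence.\<close>

lemma mexp_two_patterns:
  assumes "0 < p" "finite A" "{a..b} \<subseteq> A" "{c..d} \<subseteq> A" "{a..b} \<inter> {c..d} = {}"
  shows "mexp p A (\<lambda>s. g (pattern s {a..b}) (pattern s {c..d}))
       = mexp p {a..b} (\<lambda>t. mexp p {c..d} (g t))"
proof -
  have "mexp p A (\<lambda>s. g (pattern s {a..b}) (pattern s {c..d}))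
      = mexp p A (\<lambda>s. mexp p {a..b} (\<lambda>t. g t (pattern s {c..d})))"
    using mexp_resample[OF assms(1-3), of "\<lambda>t s. g t (pattern s {c..d})"]
      pattern_comp_disjoint[OF _ assms(5)] by simp
  also have "\<dots> = mexp p {c..d} (\<lambda>r. mexp p {a..b} (\<lambda>t. g t r))"
    by (rule mexp_pattern[OF assms(1,2,4)])
  also have "\<dots> = mexp p {a..b} (\<lambda>t. mexp p {c..d} (g t))" by (rule mexp_swap)
  finally show ?thesis .
qed

section \<open>Symmetries and long inversions\<close>

text \<open>A factor common to all weights cancels in the normalisation. It is 1 for conjugation and
  inversion, and a power of \<open>q\<close> for reversal of the values.\<close>

lemma mexp_transport:
  assumes bij: "bij_betw \<Phi> {s. s permutes A} {s. s permutes B}"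
    and w: "\<And>s. s permutes A \<Longrightarrow> p ^ inv_count B (\<Phi> s) = c * p' ^ inv_count A s"
    and c: "c \<noteq> 0"
  shows "mexp p B g = mexp p' A (\<lambda>s. g (\<Phi> s))"
proof -
  have sum: "(\<Sum>s\<in>{s. s permutes B}. p ^ inv_count B s * h s)
      = c * (\<Sum>s\<in>{s. s permutes A}. p' ^ inv_count A s * h (\<Phi> s))" for h
    unfolding sum.reindex_bij_betw[OF bij, symmetric] sum_distrib_left
    by (rule sum.cong) (auto simp: w)
  have "mexp p B g = (\<Sum>s\<in>{s. s permutes B}. p ^ inv_count B s * g s) /
      (\<Sum>s\<in>{s. s permutes B}. p ^ inv_count B s * 1)"
    by (simp add: mexp_def mallows_prob_def sum_divide_distrib)
  also have "\<dots> = mexp p' A (\<lambda>s. g (\<Phi> s))"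
    unfolding sum using c by (simp add: mexp_def mallows_prob_def sum_divide_distrib)
  finally show ?thesis .
qed

lemma permutes_conj:
  assumes "bij h" "s permutes A"
  shows "h \<circ> s \<circ> inv h permutes h ` A"
proof -
  have "bij (h \<circ> s \<circ> inv h)"
    using assms by (intro bij_comp bij_imp_bij_inv permutes_bij)
  moreover have "(h \<circ> s \<circ> inv h) x = x" if "x \<notin> h ` A" for x
  proof -
    have "inv h x \<notin> A" using that assms(1) by (metis bij_inv_eq_iff imageI)
    then show ?thesis using assms by (simp add: permutes_not_in bij_is_surj surj_f_inv_f)
  qed
  ultimately show ?thesis unfolding permutes_def bij_iff by blast
qed

text \<open>A decreasing \<open>h\<close> reverses positions and values at once, so an inversion
  survives with its two positions exchanged. Reflections are thus allowed along with shifts.\<close>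

lemma inv_count_conj:
  assumes h: "bij h" and m: "strict_mono h \<or> (\<forall>x y. x < y \<longleftrightarrow> h y < h x)"
  shows "inv_count (h ` A) (h \<circ> s \<circ> inv h) = inv_count A s"
proof -
  let ?Inv = "\<lambda>A s. {(i, j). i \<in> A \<and> j \<in> A \<and> i < j \<and> s i > s j}"
  have inv[simp]: "inv h (h x) = x" "h (inv h x) = x" for x
    using h by (simp_all add: bij_is_inj bij_is_surj surj_f_inv_f)
  have inA: "inv h x \<in> A \<longleftrightarrow> x \<in> h ` A" for x by (metis h bij_inv_eq_iff imageE imageI)
  from m have "\<exists>f. bij_betw f (?Inv A s) (?Inv (h ` A) (h \<circ> s \<circ> inv h))"
  proof
    assume m: "strict_mono h"
    have l: "h x < h y \<longleftrightarrow> x < y" for x y using m by (rule strict_mono_less)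
    have li: "inv h x < inv h y \<longleftrightarrow> x < y" for x y using l[of "inv h x" "inv h y"] by simp
    have "bij_betw (\<lambda>(i, j). (h i, h j)) (?Inv A s) (?Inv (h ` A) (h \<circ> s \<circ> inv h))"
      by (rule bij_betw_byWitness[where f' = "\<lambda>(i, j). (inv h i, inv h j)"]) (auto simp: l li inA)
    then show ?thesis by blast
  next
    assume l: "\<forall>x y. x < y \<longleftrightarrow> h y < h x"
    have li: "inv h x < inv h y \<longleftrightarrow> y < x" for x y using l[rule_format, of "inv h x" "inv h y"] by simp
    have "bij_betw (\<lambda>(i, j). (h j, h i)) (?Inv A s) (?Inv (h ` A) (h \<circ> s \<circ> inv h))"
      by (rule bij_betw_byWitness[where f' = "\<lambda>(i, j). (inv h j, inv h i)"])
        (auto simp: l[rule_format, symmetric] li inA)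
    then show ?thesis by blast
  qed
  then show ?thesis unfolding inv_count_def using bij_betw_same_card by fastforce
qed

lemma mexp_conj:
  assumes h: "bij h" and m: "strict_mono h \<or> (\<forall>x y. x < y \<longleftrightarrow> h y < h x)"
  shows "mexp p (h ` A) g = mexp p A (\<lambda>s. g (h \<circ> s \<circ> inv h))"
proof (rule mexp_transport[where c = 1])
  have inv: "inv h \<circ> h = id" "h \<circ> inv h = id" using h
    by (simp_all add: bij_is_inj bij_is_surj surj_iff[symmetric])
  have hi: "bij (inv h)" "inv (inv h) = h" using h by (simp_all add: bij_imp_bij_inv inv_inv_eq)
  show "bij_betw (\<lambda>s. h \<circ> s \<circ> inv h) {s. s permutes A} {s. s permutes h ` A}"
  proof (rule bij_betw_byWitness[where f' = "\<lambda>s. inv h \<circ> s \<circ> h"])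
    show "\<forall>s\<in>{s. s permutes A}. inv h \<circ> (h \<circ> s \<circ> inv h) \<circ> h = s"
      "\<forall>s\<in>{s. s permutes h ` A}. h \<circ> (inv h \<circ> s \<circ> h) \<circ> inv h = s"
      by (metis (no_types, lifting) inv comp_assoc comp_id id_comp)+
    show "(\<lambda>s. h \<circ> s \<circ> inv h) ` {s. s permutes A} \<subseteq> {s. s permutes h ` A}"
      using permutes_conj[OF h] by auto
    have "inv h ` h ` A = A" by (simp add: image_comp inv(1))
    then show "(\<lambda>s. inv h \<circ> s \<circ> h) ` {s. s permutes h ` A} \<subseteq> {s. s permutes A}"
      using permutes_conj[OF hi(1), of _ "h ` A"] hi(2) by auto
  qed
qed (simp_all add: inv_count_conj[OF h m])

lemma bij_reflect: "bij (\<lambda>z::int. c - z)" "inv (\<lambda>z::int. c - z) = (\<lambda>z. c - z)"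
proof -
  have "(\<lambda>z::int. c - z) \<circ> (\<lambda>z. c - z) = id" by auto
  then show "bij (\<lambda>z::int. c - z)" "inv (\<lambda>z::int. c - z) = (\<lambda>z. c - z)"
    by (auto intro: o_bij inv_unique_comp)
qed

lemma bij_shift: "bij (\<lambda>z::int. z - c)" "inv (\<lambda>z::int. z - c) = (\<lambda>z. z + c)"
proof -
  have "(\<lambda>z::int. z - c) \<circ> (\<lambda>z. z + c) = id" "(\<lambda>z::int. z + c) \<circ> (\<lambda>z. z - c) = id" by auto
  then show "bij (\<lambda>z::int. z - c)" "inv (\<lambda>z::int. z - c) = (\<lambda>z. z + c)"
    by (auto intro: o_bij inv_unique_comp)
qed

lemma mexp_reflect:
  "mexp p {c - b..c - a} g = mexp p {a..b} (\<lambda>s. g (\<lambda>z. c - s (c - z)))"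
proof -
  have "(\<lambda>z. c - z) ` {a..b} = {c - b..c - a}" by (rule image_diff_atLeastAtMost)
  then show ?thesis
    using mexp_conj[OF bij_reflect(1)[of c], of p "{a..b}" g] by (simp add: bij_reflect(2) o_def)
qed

lemma mexp_shift:
  "mexp p {a - c..b - c} g = mexp p {a..b} (\<lambda>s. g (\<lambda>z. s (z + c) - c))"
proof -
  have "(\<lambda>z. z - c) ` {a..b} = {a - c..b - c}"
    using image_add_atLeastAtMost[of "- c" a b] by simp
  moreover have "strict_mono (\<lambda>z::int. z - c)" by (simp add: strict_mono_def)
  ultimately show ?thesis
    using mexp_conj[OF bij_shift(1)[of c], of p "{a..b}" g] by (simp add: bij_shift(2) o_def)
qed

lemma inv_count_inv:
  assumes s: "s permutes A"
  shows "inv_count A (inv s) = inv_count A s"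
proof -
  let ?Inv = "\<lambda>s. {(i, j). i \<in> A \<and> j \<in> A \<and> i < j \<and> s i > s j}"
  have [simp]: "s (inv s x) = x" "inv s (s x) = x" for x
    using s by (simp_all add: permutes_inverses)
  have [simp]: "s x \<in> A \<longleftrightarrow> x \<in> A" "inv s x \<in> A \<longleftrightarrow> x \<in> A" for x
    using permutes_in_image[OF s] permutes_in_image[OF permutes_inv[OF s]] by auto
  have "bij_betw (\<lambda>(i, j). (s j, s i)) (?Inv s) (?Inv (inv s))"
    by (rule bij_betw_byWitness[where f' = "\<lambda>(i, j). (inv s j, inv s i)"]) auto
  then show ?thesis unfolding inv_count_def by (rule bij_betw_same_card[symmetric])
qed

lemma mexp_inv: "mexp p A g = mexp p A (\<lambda>s. g (inv s))"
proof (rule mexp_transport[where c = 1])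
  show "bij_betw inv {s. s permutes A} {s. s permutes A}"
    by (rule bij_betw_byWitness[where f' = inv])
      (auto simp: permutes_inv_inv permutes_inv)
qed (simp_all add: inv_count_inv)

text \<open>Each pair of positions is an inversion of exactly one of \<open>s\<close> and
  \<open>r \<circ> s\<close>. Hence the weights for \<open>q\<close> and \<open>1 / q\<close> agree
  up to a constant after reversal.\<close>

lemma inv_count_reverse:
  assumes A: "finite A" and s: "inj_on s A" and r: "\<And>x. x \<in> A \<Longrightarrow> s x \<in> A \<Longrightarrow> r (s x) = c - s x"
    and sA: "s ` A \<subseteq> A"
  shows "inv_count A (r \<circ> s) + inv_count A s = card {(i, j). i \<in> A \<and> j \<in> A \<and> i < j}"
proof -
  let ?Inv = "\<lambda>s. {(i, j). i \<in> A \<and> j \<in> A \<and> i < j \<and> s i > s j}"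
  have fin: "finite (?Inv t)" for t :: "int \<Rightarrow> int"
    by (rule finite_subset[of _ "A \<times> A"]) (use A in auto)
  have rs: "(r \<circ> s) x = c - s x" if "x \<in> A" for x using r that sA by auto
  have "{(i, j). i \<in> A \<and> j \<in> A \<and> i < j} = ?Inv (r \<circ> s) \<union> ?Inv s"
  proof (intro set_eqI iffI)
    fix z assume "z \<in> {(i, j). i \<in> A \<and> j \<in> A \<and> i < j}"
    then obtain i j where z: "z = (i, j)" "i \<in> A" "j \<in> A" "i < j" by auto
    then have "s i \<noteq> s j" using s by (auto simp: inj_on_def)
    then show "z \<in> ?Inv (r \<circ> s) \<union> ?Inv s" using z rs by auto
  qed auto
  moreover have "?Inv (r \<circ> s) \<inter> ?Inv s = {}" using rs by auto
  ultimately show ?thesis unfolding inv_count_def using fin by (simp add: card_Un_disjoint)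
qed

definition rev_interval :: "int \<Rightarrow> int \<Rightarrow> int" where
  "rev_interval n z = (if z \<in> {1..n} then n + 1 - z else z)"

lemma rev_interval_permutes: "rev_interval n permutes {1..n}"
proof (rule bij_imp_permutes)
  show "bij_betw (rev_interval n) {1..n} {1..n}"
    by (rule bij_betw_byWitness[where f' = "rev_interval n"]) (auto simp: rev_interval_def)
next
  fix x assume "x \<notin> {1..n}"
  then show "rev_interval n x = x" by (simp only: rev_interval_def if_False)
qed

lemma mexp_reverse:
  assumes q: "0 < q"
  shows "mexp q {1..n} g = mexp (1 / q) {1..n} (\<lambda>s. g (rev_interval n \<circ> s))"
proof (rule mexp_transport)
  have rr: "rev_interval n \<circ> rev_interval n = id" by (auto simp: rev_interval_def fun_eq_iff)
  show "bij_betw ((\<circ>) (rev_interval n)) {s. s permutes {1..n}} {s. s permutes {1..n}}"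
    by (rule bij_betw_byWitness[where f' = "(\<circ>) (rev_interval n)"])
      (auto simp: o_assoc rr intro: permutes_compose[OF _ rev_interval_permutes])
  let ?N = "card {(i, j). i \<in> {1..n} \<and> j \<in> {1..n} \<and> i < j}"
  fix s assume s: "s permutes {1..n}"
  have "inv_count {1..n} (rev_interval n \<circ> s) + inv_count {1..n} s = ?N"
    by (rule inv_count_reverse[where c = "n + 1"])
      (use s in \<open>auto simp: permutes_inj_on permutes_image rev_interval_def\<close>)
  then have "q ^ inv_count {1..n} (rev_interval n \<circ> s) * q ^ inv_count {1..n} s = q ^ ?N"
    by (metis power_add)
  then show "q ^ inv_count {1..n} (rev_interval n \<circ> s) = q ^ ?N * (1 / q) ^ inv_count {1..n} s"
    using q by (simp add: field_simps)
qed (use q in simp)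

text \<open>As \<open>x\<close> is the first position, the value \<open>v - 1\<close> sits to its
  right and forms an inversion with it, which the swap of the two values removes.\<close>

lemma inv_count_adjacent_values:
  assumes s: "s permutes {x..y}" and v: "s x = v" "x < v"
  shows "inv_count {x..y} (Transposition.transpose (v - 1) v \<circ> s) + 1 \<le> inv_count {x..y} s"
proof -
  let ?t = "Transposition.transpose (v - 1) v"
  let ?Inv = "\<lambda>s. {(i, j). i \<in> {x..y} \<and> j \<in> {x..y} \<and> i < j \<and> s i > s j}"
  have fin: "finite (?Inv u)" for u :: "int \<Rightarrow> int"
    by (rule finite_subset[of _ "{x..y} \<times> {x..y}"]) auto
  have x: "x \<in> {x..y}" using s v by (metis less_irrefl permutes_not_in)
  have vI: "v \<in> {x..y}" using permutes_in_image[OF s, of x] x v by simp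
  define j where "j = inv s (v - 1)"
  have sj: "s j = v - 1" using s by (simp add: j_def permutes_inverses)
  have "v - 1 \<in> {x..y}" using vI v by auto
  then have j: "j \<in> {x..y}" using permutes_in_image[OF s, of j] sj by simp
  have "j \<noteq> x" using sj v by auto
  then have xj: "x < j" using j by auto
  \<comment> \<open>A new inversion would need \<open>v - 1\<close> to the left of \<open>v\<close>,
    but \<open>v\<close> sits at the first position.\<close>
  have sub: "?Inv (?t \<circ> s) \<subseteq> ?Inv s"
  proof clarify
    fix i k assume ik: "i \<in> {x..y}" "k \<in> {x..y}" "i < k" "(?t \<circ> s) k < (?t \<circ> s) i"
    show "s k < s i"
    proof (rule ccontr)
      assume "\<not> s k < s i"
      moreover have "s i \<noteq> s k" using ik s by (metis less_irrefl permutes_inj injD)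
      ultimately have "s i < s k" by simp
      then have "s k = v" using ik(4) by (auto simp: Transposition.transpose_def split: if_splits)
      then have "k = x" using v s by (metis permutes_inj injD)
      then show False using ik by auto
    qed
  qed
  have "(x, j) \<in> ?Inv s" "(x, j) \<notin> ?Inv (?t \<circ> s)"
    using x j xj sj v by (auto simp: Transposition.transpose_def)
  then have "card (?Inv (?t \<circ> s)) < card (?Inv s)"
    using sub by (intro psubset_card_mono fin) blast
  then show ?thesis by (simp add: inv_count_def)
qed

text \<open>Swapping the values \<open>v - 1\<close> and \<open>v\<close> matches the permutations
  with \<open>s x = v\<close> to those with \<open>s x = v - 1\<close> and saves an inversion, so
  each further step of displacement costs a factor \<open>p\<close>.\<close>

lemma mexp_first_eq:
  assumes p: "0 < p" "p < 1"
  shows "mexp p {x..y} (\<lambda>s. of_bool (s x = x + int k)) \<le> p ^ k"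
proof (induction k)
  case 0
  show ?case using p by (auto intro!: mexp_le_const)
next
  case (Suc k)
  let ?I = "{x..y}"
  define v where "v = x + int (Suc k)"
  let ?t = "Transposition.transpose (v - 1) v"
  let ?S = "\<lambda>v. {s. s permutes ?I \<and> s x = v}"
  have fin: "finite {s. s permutes ?I}" by (simp add: finite_permutations)
  have ind: "mexp p ?I (\<lambda>s. of_bool (s x = v)) = (\<Sum>s\<in>?S v. mallows_prob p ?I s)" for v
    unfolding mexp_def using fin by (intro sum.mono_neutral_cong_right) auto
  show ?case
  proof (cases "v \<in> ?I")
    case False
    have "s x \<noteq> v" if "s permutes ?I" for s
      using permutes_in_image[OF that, of x] permutes_not_in[OF that, of x] False v_def
      by (cases "x \<in> ?I") auto
    then have "mexp p ?I (\<lambda>s. of_bool (s x = v)) \<le> 0"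
      using p by (intro mexp_le_const) auto
    then show ?thesis using p unfolding v_def by (meson order_trans zero_le_power less_imp_le)
  next
    case True
    have t: "?t permutes ?I" using True by (intro permutes_swap_id) (auto simp: v_def)
    have tt: "?t \<circ> ?t = id" by simp
    have "(\<Sum>s\<in>?S v. mallows_prob p ?I s) \<le> (\<Sum>s\<in>?S v. p * mallows_prob p ?I (?t \<circ> s))"
    proof (rule sum_mono)
      fix s assume s: "s \<in> ?S v"
      have "inv_count ?I (?t \<circ> s) + 1 \<le> inv_count ?I s"
        by (rule inv_count_adjacent_values) (use s v_def in auto)
      then have "p ^ inv_count ?I s \<le> p ^ (inv_count ?I (?t \<circ> s) + 1)"
        using p by (intro power_decreasing) auto
      then show "mallows_prob p ?I s \<le> p * mallows_prob p ?I (?t \<circ> s)"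
        unfolding mallows_prob_def using mallows_partition_pos[of p ?I] p
        by (simp add: divide_right_mono)
    qed
    also have "\<dots> = p * (\<Sum>s\<in>?S (v - 1). mallows_prob p ?I s)"
      unfolding sum_distrib_left
      by (rule sum.reindex_bij_witness[where i = "(\<circ>) ?t" and j = "(\<circ>) ?t"])
        (use permutes_compose[OF _ t] in \<open>auto simp: o_assoc tt\<close>)
    also have "\<dots> \<le> p * p ^ k"
      unfolding ind[symmetric] using Suc p by (intro mult_left_mono) (auto simp: v_def)
    finally show ?thesis unfolding ind v_def by simp
  qed
qed

section \<open>Exponential decay of inversions with the distance\<close>

lemma sum_power_le:
  fixes r :: real
  assumes "0 \<le> r" "r < 1"
  shows "(\<Sum>d=m..n. r ^ d) \<le> r ^ m / (1 - r)"
  using assms by (auto simp: sum_gp intro!: divide_right_mono)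

lemma mexp_first_ge:
  assumes p: "0 < p" "p < 1"
  shows "mexp p {x..y} (\<lambda>s. of_bool (x + int k \<le> s x)) \<le> p ^ k / (1 - p)"
proof -
  have "mexp p {x..y} (\<lambda>s. of_bool (x + int k \<le> s x))
      \<le> (\<Sum>d=k..k + nat (y - x). mexp p {x..y} (\<lambda>s. of_bool (s x = x + int d)))"
  proof (rule mexp_of_bool_le_sum)
    fix s assume s: "s permutes {x..y}" "x + int k \<le> s x"
    show "\<exists>d\<in>{k..k + nat (y - x)}. s x = x + int d"
    proof (cases "x \<in> {x..y}")
      case True
      then have "s x \<in> {x..y}" by (simp only: permutes_in_image[OF s(1)])
      then show ?thesis using s(2) by (intro bexI[of _ "nat (s x - x)"]) auto
    next
      case False
      then have "s x = x" using s(1) by (simp add: permutes_not_in)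
      then show ?thesis using s(2) by (intro bexI[of _ 0]) auto
    qed
  qed (use p in auto)
  also have "\<dots> \<le> (\<Sum>d=k..k + nat (y - x). p ^ d)"
    by (intro sum_mono mexp_first_eq p)
  also have "\<dots> \<le> p ^ k / (1 - p)" by (rule sum_power_le) (use p in auto)
  finally show ?thesis .
qed

lemma mexp_last_le:
  assumes p: "0 < p" "p < 1"
  shows "mexp p {x..y} (\<lambda>s. of_bool (s y \<le> y - int k)) \<le> p ^ k / (1 - p)"
proof -
  have "mexp p {x..y} (\<lambda>s. of_bool (x + int k \<le> s x))
     = mexp p {x..y} (\<lambda>s. of_bool (s y \<le> y - int k))"
    using mexp_reflect[of p "x + y" y x "\<lambda>s. of_bool (x + int k \<le> s x)"]
    by (simp add: algebra_simps)
  then show ?thesis using mexp_first_ge[OF p, of x y k] by simp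
qed

text \<open>The inversion is visible in the pattern on \<open>{x..y}\<close>, where \<open>x\<close>
  is the first and \<open>y\<close> the last position, so the geometric bounds for the ends of an
  interval apply.\<close>

lemma mexp_inversion:
  assumes p: "0 < p" "p < 1" and A: "finite A" "{x..y} \<subseteq> A" and xy: "x < y"
  shows "mexp p A (\<lambda>s. of_bool (s y < s x)) \<le> 2 * sqrt p ^ nat (y - x) / (1 - p)"
proof -
  define d where "d = nat (y - x)"
  \<comment> \<open>If neither end is displaced past the middle, then
    \<open>s x \<le> x + k < s y\<close>. Both exponents \<open>k + 1\<close> and
    \<open>d - k\<close> are at least half of \<open>d\<close>, which turns \<open>p\<close> into
    \<open>sqrt p\<close>.\<close>
  define k where "k = d div 2"
  have y: "y = x + int d" using xy by (simp add: d_def)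
  have sq: "p ^ m \<le> sqrt p ^ d" if "d \<le> 2 * m" for m
  proof -
    have "p ^ m = sqrt p ^ (2 * m)" using p by (simp add: power_mult)
    also have "\<dots> \<le> sqrt p ^ d" using that p by (intro power_decreasing) auto
    finally show ?thesis .
  qed
  have "mexp p A (\<lambda>s. of_bool (s y < s x)) = mexp p A (\<lambda>s. of_bool (pattern s {x..y} y < pattern s {x..y} x))"
    by (rule mexp_cong) (use pattern_less_iff xy in \<open>auto simp: permutes_inj_on\<close>)
  also have "\<dots> = mexp p {x..y} (\<lambda>s. of_bool (s y < s x))"
    by (rule mexp_pattern[OF p(1) A])
  also have "\<dots> \<le> mexp p {x..y} (\<lambda>s. of_bool (x + int (k + 1) \<le> s x) + of_bool (s y \<le> y - int (d - k)))"
    by (rule mexp_mono) (use p xy in \<open>auto simp: y k_def\<close>)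
  also have "\<dots> \<le> p ^ (k + 1) / (1 - p) + p ^ (d - k) / (1 - p)"
    unfolding mexp_add by (intro add_mono mexp_first_ge mexp_last_le p)
  also have "\<dots> \<le> sqrt p ^ d / (1 - p) + sqrt p ^ d / (1 - p)"
    using p by (intro add_mono divide_right_mono sq) (auto simp: k_def)
  finally show ?thesis by (simp add: d_def)
qed

text \<open>The obstacle to locality at \<open>x\<close>: without it, \<open>s x\<close> can be read
  off from any window inside the interval that reaches \<open>l\<close> to both sides, and
  \<open>x\<close> moves by at most \<open>l\<close>.\<close>

definition far_inversion :: "int set \<Rightarrow> (int \<Rightarrow> int) \<Rightarrow> int \<Rightarrow> int \<Rightarrow> bool" where
  "far_inversion A s x l \<longleftrightarrow>
     (\<exists>y\<in>A. l < \<bar>y - x\<bar> \<and> ((x < y \<and> s y < s x) \<or> (y < x \<and> s x < s y)))"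

text \<open>Two sides, each with the bound \<open>2 * sqrt p ^ d / (1 - p)\<close> for an inversion
  at distance \<open>d\<close>, summed over \<open>d > l\<close>.\<close>

definition far_bound :: "real \<Rightarrow> nat \<Rightarrow> real" where
  "far_bound p l = 4 / ((1 - p) * (1 - sqrt p)) * sqrt p ^ (l + 1)"

lemma far_bound_nonneg: "0 < p \<Longrightarrow> p < 1 \<Longrightarrow> 0 \<le> far_bound p l"
  by (simp add: far_bound_def)

lemma mexp_far_inversion:
  assumes p: "0 < p" "p < 1" and x: "x \<in> {a..b}"
  shows "mexp p {a..b} (\<lambda>s. of_bool (far_inversion {a..b} s x (int l))) \<le> far_bound p l"
proof -
  let ?A = "{a..b}"
  define E where "E d s \<longleftrightarrow> (x + int d \<in> ?A \<and> s (x + int d) < s x) \<or> (x - int d \<in> ?A \<and> s x < s (x - int d))"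
    for d and s :: "int \<Rightarrow> int"
  have b: "mexp p ?A (\<lambda>s. of_bool (E d s)) \<le> 4 * sqrt p ^ d / (1 - p)" if d: "l + 1 \<le> d" for d
  proof -
    have one: "mexp p ?A (\<lambda>s. of_bool (u \<in> ?A \<and> v \<in> ?A \<and> s v < s u)) \<le> 2 * sqrt p ^ d / (1 - p)"
      if "v = u + int d" for u v
    proof (cases "u \<in> ?A \<and> v \<in> ?A")
      case True
      then show ?thesis using mexp_inversion[OF p, of ?A u v] that d by simp
    next
      case False
      then show ?thesis using p by (intro mexp_le_const) auto
    qed
    have "mexp p ?A (\<lambda>s. of_bool (E d s)) \<le>
        mexp p ?A (\<lambda>s. of_bool (x \<in> ?A \<and> x + int d \<in> ?A \<and> s (x + int d) < s x)
          + of_bool (x - int d \<in> ?A \<and> x \<in> ?A \<and> s x < s (x - int d)))"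
      by (rule mexp_mono) (use p x in \<open>auto simp: E_def\<close>)
    also have "\<dots> \<le> 2 * sqrt p ^ d / (1 - p) + 2 * sqrt p ^ d / (1 - p)"
      unfolding mexp_add by (intro add_mono one) auto
    finally show ?thesis by simp
  qed
  have "mexp p ?A (\<lambda>s. of_bool (far_inversion ?A s x (int l)))
     \<le> (\<Sum>d=l + 1..nat (b - a). mexp p ?A (\<lambda>s. of_bool (E d s)))"
  proof (rule mexp_of_bool_le_sum)
    fix s assume "far_inversion ?A s x (int l)"
    then obtain y where y: "y \<in> ?A" "int l < \<bar>y - x\<bar>" "(x < y \<and> s y < s x) \<or> (y < x \<and> s x < s y)"
      unfolding far_inversion_def by blast
    show "\<exists>d\<in>{l + 1..nat (b - a)}. E d s"
      by (rule bexI[of _ "nat \<bar>y - x\<bar>"]) (use y x in \<open>auto simp: E_def\<close>)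
  qed (use p in auto)
  also have "\<dots> \<le> (\<Sum>d=l + 1..nat (b - a). 4 / (1 - p) * sqrt p ^ d)"
    by (intro sum_mono) (use b in auto)
  also have "\<dots> \<le> 4 / (1 - p) * (sqrt p ^ (l + 1) / (1 - sqrt p))"
    unfolding sum_distrib_left[symmetric]
    by (intro mult_left_mono sum_power_le) (use p in auto)
  finally show ?thesis by (simp add: far_bound_def)
qed

lemma permutes_value_card:
  assumes "s permutes {a..b}" "x \<in> {a..b}"
  shows "s x = a + int (card {u \<in> {a..b}. s u < s x})"
  using pattern_interval[OF permutes_inj_on[OF assms(1)] assms(2)] pattern_id_on_permutes[OF assms(1)]
  by simp

text \<open>All positions left of the window have smaller values and all positions right of it
  larger ones, so the rank within the window differs from the full rank exactly by the shift from
  \<open>a\<close> to \<open>c\<close>.\<close>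

lemma not_far_inversion_pattern:
  assumes s: "s permutes {a..b}" and sub: "a \<le> c" "c \<le> x - l" "x + l \<le> d" "d \<le> b" "0 \<le> l"
    and nf: "\<not> far_inversion {a..b} s x l"
  shows "pattern s {c..d} x = s x"
proof -
  have "x \<in> {c..d}" "x \<in> {a..b}" using sub by auto
  have lo: "s u < s x" if "a \<le> u" "u < c" for u
  proof -
    have "\<not> s x < s u" using nf that sub unfolding far_inversion_def by force
    moreover have "s u \<noteq> s x" using that sub s by (metis permutes_inj injD less_irrefl less_le_trans diff_le_eq le_add_same_cancel1 order_trans)
    ultimately show ?thesis by simp
  qed
  have hi: "\<not> s u < s x" if "d < u" "u \<le> b" for u
    using nf that sub unfolding far_inversion_def by force
  have eq: "{u \<in> {a..b}. s u < s x} = {a..<c} \<union> {u \<in> {c..d}. s u < s x}"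
    using lo hi sub by force
  have "card {u \<in> {a..b}. s u < s x} = card {a..<c} + card {u \<in> {c..d}. s u < s x}"
    unfolding eq
  proof (rule card_Un_disjoint)
    show "finite {u \<in> {c..d}. s u < s x}" by (rule finite_Collect_conjI) simp
  qed auto
  then show ?thesis
    using permutes_value_card[OF s \<open>x \<in> {a..b}\<close>] pattern_interval[OF permutes_inj_on[OF s] \<open>x \<in> {c..d}\<close>] sub
    by simp
qed

text \<open>The positions with smaller values include everything left of \<open>x - l\<close> and
  nothing right of \<open>x + l\<close>; counting them locates \<open>s x\<close>.\<close>

lemma not_far_inversion_displacement:
  assumes s: "s permutes {a..b}" and x: "x \<in> {a..b}" and l: "0 \<le> l"
    and nf: "\<not> far_inversion {a..b} s x l"
  shows "\<bar>s x - x\<bar> \<le> l"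
proof -
  let ?B = "{u \<in> {a..b}. s u < s x}"
  \<comment> \<open>Removing \<open>x\<close> itself makes the bound exactly \<open>l\<close>. With
    \<open>l = 0\<close> it yields a fixed point, which the limit of large \<open>q\<close> relies
    on.\<close>
  have "?B \<subseteq> {a..x + l} - {x}" using nf l unfolding far_inversion_def by force
  then have "card ?B \<le> card ({a..x + l} - {x})" by (intro card_mono) auto
  also have "\<dots> = nat (x + l - a)" using x l by (simp add: card_Diff_singleton)
  finally have "int (card ?B) \<le> x + l - a" using x l by (simp only: atLeastAtMost_iff) linarith
  then have "s x \<le> x + l" using permutes_value_card[OF s x] by linarith
  have "{a..<x - l} \<subseteq> ?B"
  proof
    fix u assume u: "u \<in> {a..<x - l}"
    then have "u \<in> {a..b}" "u < x" using x l by auto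
    moreover have "\<not> s x < s u" using nf u calculation unfolding far_inversion_def by force
    moreover have "s u \<noteq> s x" using s \<open>u < x\<close> by (metis permutes_inj injD less_irrefl)
    ultimately show "u \<in> ?B" by simp
  qed
  moreover have "finite ?B" by (rule finite_Collect_conjI) simp
  ultimately have "card {a..<x - l} \<le> card ?B" by (intro card_mono)
  then have "x - l \<le> s x" using permutes_value_card[OF s x] by simp
  then show ?thesis using \<open>s x \<le> x + l\<close> by simp
qed

section \<open>Locality of the even cycle counts\<close>

lemma funpow_funpow: "(f ^^ a) ((f ^^ b) x) = (f ^^ (a + b)) x"
  by (simp add: funpow_add)

lemma fwd_orbit_card_cases:
  assumes f: "inj f" and i: "0 < i" and per: "(f ^^ i) x = x"
    and min: "\<And>j. 0 < j \<Longrightarrow> j < i \<Longrightarrow> (f ^^ j) x \<noteq> x"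
  shows "card (fwd_orbit f x) = i"
proof -
  have "fwd_orbit f x = (\<lambda>k. (f ^^ k) x) ` {..<i}"
  proof -
    have "(f ^^ k) x \<in> (\<lambda>k. (f ^^ k) x) ` {..<i}" for k
    proof (rule image_eqI)
      show "(f ^^ k) x = (f ^^ (k mod i)) x" using funpow_mod_eq[OF per] by simp
    qed (use i in simp)
    then show ?thesis by (auto simp: fwd_orbit_def)
  qed
  moreover have "inj_on (\<lambda>k. (f ^^ k) x) {..<i}"
  proof (rule linorder_inj_onI)
    fix a b assume ab: "a < b" "a \<in> {..<i}" "b \<in> {..<i}"
    have "(f ^^ b) x = (f ^^ a) ((f ^^ (b - a)) x)"
      using ab by (simp add: funpow_funpow)
    moreover have "(f ^^ (b - a)) x \<noteq> x" using min[of "b - a"] ab by simp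
    ultimately show "(f ^^ a) x \<noteq> (f ^^ b) x" using inj_eq[OF inj_fn[OF f, of a]] by metis
  qed auto
  ultimately show ?thesis by (simp add: card_image)
qed

text \<open>Only the first \<open>i\<close> iterates matter, which makes the cycle event measurable
  and stable under changes far from the orbit. The condition \<open>0 < i\<close> excludes infinite
  orbits, whose \<open>card\<close> is 0.\<close>

lemma card_fwd_orbit_iff:
  assumes f: "inj f" and i: "0 < i"
  shows "card (fwd_orbit f x) = i \<longleftrightarrow> (f ^^ i) x = x \<and> (\<forall>j. 0 < j \<and> j < i \<longrightarrow> (f ^^ j) x \<noteq> x)"
proof
  assume card: "card (fwd_orbit f x) = i"
  then have "finite (fwd_orbit f x)" using i by (metis card.infinite less_irrefl)
  then have "\<not> inj (\<lambda>k. (f ^^ k) x)"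
    unfolding fwd_orbit_def using finite_imageD infinite_UNIV_nat by blast
  then obtain a b where ab: "a < b" "(f ^^ a) x = (f ^^ b) x"
    unfolding inj_def by (metis linorder_neqE_nat)
  have "(f ^^ b) x = (f ^^ a) ((f ^^ (b - a)) x)"
    using ab by (simp add: funpow_funpow)
  then have "(f ^^ (b - a)) x = x"
    using ab inj_fn[OF f, of a] by (metis injD)
  then have ex: "\<exists>m. 0 < m \<and> (f ^^ m) x = x" using ab by (intro exI[of _ "b - a"]) simp
  define m where "m = (LEAST m. 0 < m \<and> (f ^^ m) x = x)"
  have m: "0 < m" "(f ^^ m) x = x" using LeastI_ex[OF ex] unfolding m_def by auto
  have min: "(f ^^ j) x \<noteq> x" if "0 < j" "j < m" for j
    using not_less_Least[of j "\<lambda>m. 0 < m \<and> (f ^^ m) x = x"] that unfolding m_def by auto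
  have "card (fwd_orbit f x) = m" by (rule fwd_orbit_card_cases[OF f m min])
  then show "(f ^^ i) x = x \<and> (\<forall>j. 0 < j \<and> j < i \<longrightarrow> (f ^^ j) x \<noteq> x)"
    using card m min by auto
qed (use fwd_orbit_card_cases[OF f i] in blast)

text \<open>By injectivity the orbit of a later point has as many elements as the orbit containing
  it, and in a finite set this forces equality.\<close>

lemma fwd_orbit_eq:
  assumes f: "inj f" and fin: "finite (fwd_orbit f x)" and y: "y \<in> fwd_orbit f x"
  shows "fwd_orbit f y = fwd_orbit f x"
proof -
  obtain a where a: "y = (f ^^ a) x" using y by (auto simp: fwd_orbit_def)
  have "(f ^^ k) y = (f ^^ a) ((f ^^ k) x)" "(f ^^ k) y = (f ^^ (k + a)) x" for k
    unfolding a by (simp_all add: funpow_funpow add.commute)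
  note iter = this
  have im: "fwd_orbit f y = (f ^^ a) ` fwd_orbit f x"
    unfolding fwd_orbit_def image_image by (simp only: iter(1))
  have sub: "fwd_orbit f y \<subseteq> fwd_orbit f x"
    unfolding fwd_orbit_def iter(2) by blast
  have "card (fwd_orbit f y) = card (fwd_orbit f x)"
    unfolding im by (rule card_image) (meson f inj_fn inj_on_subset subset_UNIV)
  then show ?thesis using card_subset_eq[OF fin sub] by simp
qed

lemma self_in_fwd_orbit: "x \<in> fwd_orbit f x"
  unfolding fwd_orbit_def by (rule range_eqI[of _ _ 0]) simp

lemma fwd_orbit_subset:
  assumes "f ` A \<subseteq> A" "x \<in> A"
  shows "fwd_orbit f x \<subseteq> A"
proof -
  have "(f ^^ k) x \<in> A" for k using assms by (induction k) auto
  then show ?thesis by (auto simp: fwd_orbit_def)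
qed

text \<open>The \<open>k\<close>-cycles partition the points lying on them. Counting points instead
  of cycles gives a sum over positions, to which locality applies.\<close>

lemma cycle_count_mult:
  assumes s: "s permutes A" and A: "finite A" and k: "0 < k"
  shows "k * cycle_count k s A = card {x \<in> A. card (fwd_orbit s x) = k}"
proof -
  define U where "U = {x \<in> A. card (fwd_orbit s x) = k}"
  define C where "C = fwd_orbit s ` U"
  have inj: "inj s" using s by (rule permutes_inj)
  have fin: "finite (fwd_orbit s x)" if "x \<in> U" for x
    using that k U_def by (metis (mono_tags, lifting) card.infinite less_irrefl mem_Collect_eq)
  have eq: "fwd_orbit s y = fwd_orbit s x" if "x \<in> U" "y \<in> fwd_orbit s x" for x y
    using fwd_orbit_eq[OF inj fin] that by blast
  have sub: "fwd_orbit s x \<subseteq> A" if "x \<in> U" for x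
    using that s by (intro fwd_orbit_subset) (auto simp: U_def permutes_image)
  have Un: "\<Union> C = U"
  proof
    show "\<Union> C \<subseteq> U" unfolding C_def
    proof clarify
      fix x y assume x: "x \<in> U" and y: "y \<in> fwd_orbit s x"
      have "y \<in> A" using sub[OF x] y by blast
      moreover have "card (fwd_orbit s y) = k" using x unfolding eq[OF x y] U_def by blast
      ultimately show "y \<in> U" by (simp add: U_def)
    qed
    show "U \<subseteq> \<Union> C" using self_in_fwd_orbit by (auto simp: C_def)
  qed
  have finU: "finite U" using A by (simp add: U_def)
  have "k * card C = card (\<Union> C)"
  proof (rule card_partition)
    show "finite C" using finU by (simp add: C_def)
    show "finite (\<Union> C)" using finU Un by simp
    show "\<And>c. c \<in> C \<Longrightarrow> card c = k" by (auto simp: C_def U_def)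
    show "\<And>c1 c2. c1 \<in> C \<Longrightarrow> c2 \<in> C \<Longrightarrow> c1 \<noteq> c2 \<Longrightarrow> c1 \<inter> c2 = {}"
    proof -
      fix c1 c2 assume "c1 \<in> C" "c2 \<in> C" and ne: "c1 \<noteq> c2"
      then obtain x y where xy: "x \<in> U" "y \<in> U" "c1 = fwd_orbit s x" "c2 = fwd_orbit s y"
        by (auto simp: C_def)
      show "c1 \<inter> c2 = {}"
        using eq[OF xy(1)] eq[OF xy(2)] ne unfolding xy(3,4) by blast
    qed
  qed
  moreover have "cycle_count k s A = card C"
    unfolding cycle_count_def C_def U_def by (rule arg_cong[where f = card]) auto
  ultimately show ?thesis by (simp add: Un U_def)
qed

lemma exp_cycle_count_mult:
  assumes k: "0 < k"
  shows "real k * exp_cycle_count q k n =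
    (\<Sum>x\<in>{1..int n}. mexp q {1..int n} (\<lambda>s. of_bool (card (fwd_orbit s x) = k)))"
proof -
  have "real k * exp_cycle_count q k n = mexp q {1..int n} (\<lambda>s. real (k * cycle_count k s {1..int n}))"
    by (simp add: exp_cycle_count_def mexp_def sum_distrib_left mult.left_commute)
  also have "\<dots> = mexp q {1..int n} (\<lambda>s. \<Sum>x\<in>{1..int n}. of_bool (card (fwd_orbit s x) = k))"
  proof (rule mexp_cong)
    fix s assume "s permutes {1..int n}"
    then have "k * cycle_count k s {1..int n} = card {x \<in> {1..int n}. card (fwd_orbit s x) = k}"
      using k by (intro cycle_count_mult) auto
    moreover have "{1..int n} \<inter> {x. card (fwd_orbit s x) = k} = {x \<in> {1..int n}. card (fwd_orbit s x) = k}"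
      by blast
    ultimately show "real (k * cycle_count k s {1..int n})
        = (\<Sum>x\<in>{1..int n}. of_bool (card (fwd_orbit s x) = k))"
      by (simp add: of_bool_def sum.If_cases del: of_nat_mult)
  qed
  finally show ?thesis unfolding mexp_sum .
qed

text \<open>Near a point \<open>x\<close> far from the centre, two steps of \<open>rev_interval n \<circ> s\<close> are one step of
  \<open>t \<circ> s\<close>, where \<open>t\<close> is the reflection of \<open>s\<close> near the mirror point \<open>n + 1 - x\<close>.\<close>

lemma fwd_orbit_reverse_local:
  fixes n x :: int and l i L :: nat
  assumes s: "s permutes {1..n}" and i: "0 < i"
    and L: "(2 * i + 1) * l \<le> L" and I: "1 \<le> x - int L" "x + int L \<le> n"
    and disj: "{x - int L..x + int L} \<inter> {n + 1 - x - int L..n + 1 - x + int L} = {}"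
    and nf: "\<And>y. \<bar>y - x\<bar> \<le> int (2 * i * l) \<or> \<bar>y - (n + 1 - x)\<bar> \<le> int (2 * i * l)
        \<Longrightarrow> \<not> far_inversion {1..n} s y (int l)"
  shows "card (fwd_orbit (rev_interval n \<circ> s) x) = 2 * i \<longleftrightarrow>
     card (fwd_orbit ((\<lambda>z. n + 1 - pattern s {n + 1 - x - int L..n + 1 - x + int L} (n + 1 - z))
                 \<circ> pattern s {x - int L..x + int L}) x) = i"
proof -
  define \<sigma> where "\<sigma> = pattern s {x - int L..x + int L}"
  define \<tau> where "\<tau> = pattern s {n + 1 - x - int L..n + 1 - x + int L}"
  define h where "h = rev_interval n \<circ> s"
  define g where "g = (\<lambda>z. n + 1 - \<tau> (n + 1 - z)) \<circ> \<sigma>"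
  have inj_h: "inj h" unfolding h_def
    by (intro inj_compose permutes_inj[OF s] permutes_inj[OF rev_interval_permutes])
  have "\<sigma> permutes {x - int L..x + int L}"
    "\<tau> permutes {n + 1 - x - int L..n + 1 - x + int L}"
    unfolding \<sigma>_def \<tau>_def by (intro pattern_permutes permutes_inj_on[OF s])+
  then have inj: "inj \<sigma>" "inj \<tau>" by (simp_all only: permutes_inj)
  have "inj (\<lambda>z. n + 1 - \<tau> (n + 1 - z))"
  proof (rule injI)
    fix y z assume "n + 1 - \<tau> (n + 1 - y) = n + 1 - \<tau> (n + 1 - z)"
    then have "\<tau> (n + 1 - y) = \<tau> (n + 1 - z)" by linarith
    from injD[OF inj(2) this] show "y = z" by linarith
  qed
  then have inj_g: "inj g" unfolding g_def using inj(1) by (rule inj_compose)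
  \<comment> \<open>The orbit is followed for \<open>2 * i\<close> steps, each drifting by at most
    \<open>l\<close>. The further \<open>l\<close> is the room around the current point that reading
    off its value requires.\<close>
  have "2 * i * l + l \<le> L" using L by simp
  then have Ll: "int (2 * i * l) + int l \<le> int L" by (simp only: of_nat_add[symmetric] of_nat_le_iff)
  have step: "h u = n + 1 - \<sigma> u \<and> \<bar>h u - (n + 1 - x)\<bar> \<le> int d + int l"
    if d: "\<bar>u - x\<bar> \<le> int d" "d \<le> 2 * i * l" for u d
  proof -
    have d2: "int d \<le> int (2 * i * l)" using d(2) by linarith
    have nfu: "\<not> far_inversion {1..n} s u (int l)" using d d2 by (intro nf) linarith
    have uA: "u \<in> {1..n}" using d(1) d2 I Ll by (simp only: atLeastAtMost_iff) linarith
    have "\<sigma> u = s u" unfolding \<sigma>_def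
      using d(1) d2 I Ll by (intro not_far_inversion_pattern[OF s _ _ _ _ _ nfu]) linarith+
    moreover have "\<bar>s u - u\<bar> \<le> int l"
      using not_far_inversion_displacement[OF s uA _ nfu] by simp
    moreover have "s u \<in> {1..n}" using uA by (simp only: permutes_in_image[OF s])
    ultimately show ?thesis using d(1) unfolding h_def comp_apply rev_interval_def by simp
  qed
  have step': "h v = n + 1 - \<tau> v \<and> \<bar>h v - x\<bar> \<le> int d + int l"
    if d: "\<bar>v - (n + 1 - x)\<bar> \<le> int d" "d \<le> 2 * i * l" for v d
  proof -
    have d2: "int d \<le> int (2 * i * l)" using d(2) by linarith
    have nfv: "\<not> far_inversion {1..n} s v (int l)" using d d2 by (intro nf) linarith
    have vA: "v \<in> {1..n}" using d(1) d2 I Ll by (simp only: atLeastAtMost_iff) linarith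
    have "\<tau> v = s v" unfolding \<tau>_def
      using d(1) d2 I Ll by (intro not_far_inversion_pattern[OF s _ _ _ _ _ nfv]) linarith+
    moreover have "\<bar>s v - v\<bar> \<le> int l"
      using not_far_inversion_displacement[OF s vA _ nfv] by simp
    moreover have "s v \<in> {1..n}" using vA by (simp only: permutes_in_image[OF s])
    ultimately show ?thesis using d(1) unfolding h_def comp_apply rev_interval_def by simp
  qed
  have bd: "2 * j * l + l \<le> 2 * i * l" if "j < i" for j
  proof -
    have "2 * j * l + l \<le> (2 * j + 2) * l" by (simp add: algebra_simps)
    also have "\<dots> \<le> 2 * i * l" using that by (intro mult_right_mono) auto
    finally show ?thesis .
  qed
  have even: "j \<le> i \<Longrightarrow> (h ^^ (2 * j)) x = (g ^^ j) x \<and> \<bar>(g ^^ j) x - x\<bar> \<le> int (2 * j * l)" for j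
  proof (induction j)
    case (Suc j)
    define u where "u = (g ^^ j) x"
    have u: "(h ^^ (2 * j)) x = u" "\<bar>u - x\<bar> \<le> int (2 * j * l)" using Suc by (auto simp: u_def)
    have j: "2 * j * l + l \<le> 2 * i * l" using Suc by (intro bd) simp
    then have j': "2 * j * l \<le> 2 * i * l" by linarith
    have 1: "h u = n + 1 - \<sigma> u" "\<bar>h u - (n + 1 - x)\<bar> \<le> int (2 * j * l + l)"
      using step[OF u(2) j'] unfolding of_nat_add by blast+
    have 2: "h (h u) = n + 1 - \<tau> (h u)" "\<bar>h (h u) - x\<bar> \<le> int (2 * j * l + l) + int l"
      using step'[OF 1(2) j] by auto
    have "h (h u) = g u" using 1(1) 2(1) by (simp add: g_def)
    moreover have "int (2 * j * l + l) + int l = int (2 * Suc j * l)" by (simp add: algebra_simps)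
    ultimately show ?case using 2(2) u(1) by (simp add: u_def[symmetric])
  qed simp
  \<comment> \<open>After an odd number of steps the point is in the mirror window, which is
    disjoint from the window of \<open>x\<close>; so no odd period occurs.\<close>
  have odd: "(h ^^ (2 * j + 1)) x \<noteq> x" if j: "j < i" for j
  proof -
    define u where "u = (g ^^ j) x"
    have u: "(h ^^ (2 * j)) x = u" "\<bar>u - x\<bar> \<le> int (2 * j * l)" using even[of j] j by (auto simp: u_def)
    have le: "2 * j * l + l \<le> 2 * i * l" by (rule bd[OF j])
    then have "2 * j * l \<le> 2 * i * l" by linarith
    then have "\<bar>h u - (n + 1 - x)\<bar> \<le> int (2 * j * l + l)"
      using step[OF u(2)] unfolding of_nat_add by blast
    moreover have "int (2 * j * l + l) \<le> int (2 * i * l)" using le by (simp only: of_nat_le_iff)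
    then have "int (2 * j * l + l) \<le> int L" using Ll by linarith
    ultimately have "\<bar>h u - (n + 1 - x)\<bar> \<le> int L" by linarith
    then have "h u \<in> {n + 1 - x - int L..n + 1 - x + int L}" by (simp only: atLeastAtMost_iff) linarith
    moreover have "x \<in> {x - int L..x + int L}" by simp
    ultimately have "h u \<noteq> x" using disj by blast
    then show ?thesis using u(1) by simp
  qed
  have "card (fwd_orbit h x) = 2 * i \<longleftrightarrow> card (fwd_orbit g x) = i"
  proof -
    have "(\<forall>m. 0 < m \<and> m < 2 * i \<longrightarrow> (h ^^ m) x \<noteq> x) \<longleftrightarrow> (\<forall>j. 0 < j \<and> j < i \<longrightarrow> (g ^^ j) x \<noteq> x)"
    proof (intro iffI allI impI)
      fix j assume *: "\<forall>m. 0 < m \<and> m < 2 * i \<longrightarrow> (h ^^ m) x \<noteq> x" "0 < j \<and> j < i"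
      then show "(g ^^ j) x \<noteq> x" using even[of j] *(1)[rule_format, of "2 * j"] by simp
    next
      fix m assume *: "\<forall>j. 0 < j \<and> j < i \<longrightarrow> (g ^^ j) x \<noteq> x" "0 < m \<and> m < 2 * i"
      show "(h ^^ m) x \<noteq> x"
      proof (cases "even m")
        case True
        then obtain j where "m = 2 * j" by blast
        then show ?thesis using * even[of j] by simp
      next
        case False
        then obtain j where "m = 2 * j + 1" by (rule oddE)
        then show ?thesis using * odd[of j] by simp
      qed
    qed
    then show ?thesis
      using card_fwd_orbit_iff[OF inj_h, of "2 * i" x] card_fwd_orbit_iff[OF inj_g i, of x] i even[of i]
      by simp
  qed
  then show ?thesis by (simp add: h_def g_def \<sigma>_def \<tau>_def)
qed

section \<open>Comparison with two independent windows\<close>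

lemma mexp_of_bool_diff:
  assumes p: "0 < p" and A: "finite A" and B: "\<And>s. s permutes A \<Longrightarrow> \<not> B s \<Longrightarrow> P s \<longleftrightarrow> Q s"
  shows "\<bar>mexp p A (\<lambda>s. of_bool (P s)) - mexp p A (\<lambda>s. of_bool (Q s))\<bar> \<le> mexp p A (\<lambda>s. of_bool (B s))"
proof -
  have "mexp p A (\<lambda>s. of_bool (P s)) \<le> mexp p A (\<lambda>s. of_bool (Q s) + of_bool (B s))"
    "mexp p A (\<lambda>s. of_bool (Q s)) \<le> mexp p A (\<lambda>s. of_bool (P s) + of_bool (B s))"
    by (rule mexp_mono[OF p A]; use B in auto)+
  then show ?thesis unfolding mexp_add by linarith
qed

text \<open>Finite-window version of the probability that 0 lies in an \<open>i\<close>-cycle of the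
  composition of two independent copies.\<close>

definition local_cycle_prob :: "real \<Rightarrow> nat \<Rightarrow> nat \<Rightarrow> real" where
  "local_cycle_prob p i L = mexp p {- int L..int L} (\<lambda>s. mexp p {- int L..int L}
     (\<lambda>t. of_bool (card (fwd_orbit (t \<circ> s) 0) = i)))"

lemma card_fwd_orbit_shift: "card (fwd_orbit (\<lambda>z. h (z + x) - x) 0) = card (fwd_orbit h x)"
proof -
  have "((\<lambda>z. h (z + x) - x) ^^ k) 0 = (h ^^ k) x - x" for k by (induction k) auto
  then have "fwd_orbit (\<lambda>z. h (z + x) - x) 0 = (\<lambda>z. z - x) ` fwd_orbit h x"
    by (simp add: fwd_orbit_def image_image)
  then show ?thesis by (simp add: card_image inj_on_def)
qed

text \<open>A shift carries the window at \<open>x\<close> to the one at 0, and a reflection carries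
  the mirror window there; both preserve the Mallows law, so the value is the same for every
  \<open>x\<close>.\<close>

lemma local_cycle_prob_windows:
  "mexp p {x - int L..x + int L} (\<lambda>s. mexp p {c - x - int L..c - x + int L}
     (\<lambda>t. of_bool (card (fwd_orbit ((\<lambda>z. c - t (c - z)) \<circ> s) x) = i))) = local_cycle_prob p i L"
proof -
  let ?I = "{x - int L..x + int L}" and ?J = "{c - x - int L..c - x + int L}" and ?L = "{- int L..int L}"
  have s: "mexp p ?L g = mexp p ?I (\<lambda>s. g (\<lambda>z. s (z + x) - x))" for g
    using mexp_shift[of p "x - int L" x "x + int L" g] by simp
  have r: "mexp p ?L g = mexp p ?J (\<lambda>t. g (\<lambda>z. c - x - t (c - x - z)))" for g
    using mexp_reflect[of p "c - x" "c - x + int L" "c - x - int L" g] by simp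
  have eq: "card (fwd_orbit ((\<lambda>z. c - x - t (c - x - z)) \<circ> (\<lambda>z. s (z + x) - x)) 0)
      = card (fwd_orbit ((\<lambda>z. c - t (c - z)) \<circ> s) x)" for s t
    using card_fwd_orbit_shift[of "(\<lambda>z. c - t (c - z)) \<circ> s" x] by (simp add: o_def algebra_simps)
  show ?thesis unfolding local_cycle_prob_def
    by (subst s, rule mexp_cong, subst r) (simp only: eq)
qed

text \<open>Union bound over the two intervals of radius \<open>2 * i * l\<close> around a point and
  its mirror image, with \<open>4 * i * l + 1\<close> positions each.\<close>

definition local_error :: "real \<Rightarrow> nat \<Rightarrow> nat \<Rightarrow> real" where
  "local_error p i l = real (2 * (4 * i * l + 1)) * far_bound p l"

lemma cycle_prob_local:
  fixes n x :: int
  assumes p: "0 < p" "p < 1" and i: "0 < i"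
    and L: "(2 * i + 1) * l \<le> L" and I: "1 \<le> x - int L" "x + int L \<le> n"
    and disj: "{x - int L..x + int L} \<inter> {n + 1 - x - int L..n + 1 - x + int L} = {}"
  shows "\<bar>mexp p {1..n} (\<lambda>s. of_bool (card (fwd_orbit (rev_interval n \<circ> s) x) = 2 * i))
     - local_cycle_prob p i L\<bar> \<le> local_error p i l"
proof -
  let ?K = "int (2 * i * l)"
  define X where "X = {x - ?K..x + ?K} \<union> {n + 1 - x - ?K..n + 1 - x + ?K}"
  let ?I = "{x - int L..x + int L}" and ?J = "{n + 1 - x - int L..n + 1 - x + int L}"
  let ?B = "\<lambda>s. \<exists>y\<in>X. far_inversion {1..n} s y (int l)"
  have "2 * i * l \<le> L" using L by simp
  then have KL: "?K \<le> int L" by (simp only: of_nat_le_iff)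
  have X1: "X \<subseteq> {1..n}" using KL I by (auto simp: X_def)
  have "card X \<le> card {x - ?K..x + ?K} + card {n + 1 - x - ?K..n + 1 - x + ?K}"
    unfolding X_def by (rule card_Un_le)
  also have "\<dots> = 2 * (4 * i * l + 1)" by (simp add: nat_add_distrib nat_mult_distrib)
  finally have cX: "card X \<le> 2 * (4 * i * l + 1)" .
  have "mexp p {1..n} (\<lambda>s. of_bool (card (fwd_orbit ((\<lambda>z. n + 1 - pattern s ?J (n + 1 - z)) \<circ> pattern s ?I) x) = i))
    = mexp p ?I (\<lambda>s. mexp p ?J (\<lambda>t. of_bool (card (fwd_orbit ((\<lambda>z. n + 1 - t (n + 1 - z)) \<circ> s) x) = i)))"
    by (rule mexp_two_patterns[OF p(1) _ _ _ disj]) (use I in auto)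
  also have "\<dots> = local_cycle_prob p i L" by (rule local_cycle_prob_windows)
  finally have eq: "mexp p {1..n} (\<lambda>s. of_bool (card (fwd_orbit ((\<lambda>z. n + 1 - pattern s ?J (n + 1 - z)) \<circ> pattern s ?I) x) = i))
    = local_cycle_prob p i L" .
  have "\<bar>mexp p {1..n} (\<lambda>s. of_bool (card (fwd_orbit (rev_interval n \<circ> s) x) = 2 * i))
     - local_cycle_prob p i L\<bar> \<le> mexp p {1..n} (\<lambda>s. of_bool (?B s))"
    unfolding eq[symmetric]
  proof (rule mexp_of_bool_diff[OF p(1)])
    fix s assume s: "s permutes {1..n}" and B: "\<not> ?B s"
    have "\<not> far_inversion {1..n} s y (int l)"
      if "\<bar>y - x\<bar> \<le> ?K \<or> \<bar>y - (n + 1 - x)\<bar> \<le> ?K" for y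
    proof -
      have "y \<in> X" using that unfolding X_def by (simp only: Un_iff atLeastAtMost_iff) linarith
      then show ?thesis using B by blast
    qed
    then show "card (fwd_orbit (rev_interval n \<circ> s) x) = 2 * i \<longleftrightarrow>
        card (fwd_orbit ((\<lambda>z. n + 1 - pattern s ?J (n + 1 - z)) \<circ> pattern s ?I) x) = i"
      by (rule fwd_orbit_reverse_local[OF s i L I disj])
  qed simp
  also have "\<dots> \<le> (\<Sum>y\<in>X. mexp p {1..n} (\<lambda>s. of_bool (far_inversion {1..n} s y (int l))))"
    by (rule mexp_of_bool_le_sum) (use p in \<open>auto simp: X_def\<close>)
  also have "\<dots> \<le> (\<Sum>y\<in>X. far_bound p l)"
    by (intro sum_mono mexp_far_inversion p) (use X1 in auto)
  also have "\<dots> \<le> local_error p i l"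
    using cX far_bound_nonneg[OF p, of l] unfolding local_error_def
    by (simp add: mult_right_mono del: of_nat_mult of_nat_add)
  finally show ?thesis .
qed

lemma mexp_of_bool_01:
  assumes "0 < p" "finite A"
  shows "0 \<le> mexp p A (\<lambda>s. of_bool (P s))" "mexp p A (\<lambda>s. of_bool (P s)) \<le> 1"
  using assms by (auto intro!: mexp_ge_const mexp_le_const)

lemma local_cycle_prob_01:
  assumes "0 < p"
  shows "0 \<le> local_cycle_prob p i L" "local_cycle_prob p i L \<le> 1"
  unfolding local_cycle_prob_def using assms mexp_of_bool_01[OF assms]
  by (auto intro!: mexp_ge_const mexp_le_const)

lemma exp_cycle_count_local:
  assumes q: "1 < q" and i: "0 < i" and L: "(2 * i + 1) * l \<le> L" and n: "0 < n"
  shows "\<bar>real (2 * i) * exp_cycle_count q (2 * i) n / real n - local_cycle_prob (1 / q) i L\<bar>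
     \<le> local_error (1 / q) i l + real (4 * L + 2) / real n"
proof -
  define p where "p = 1 / q"
  have p: "0 < p" "p < 1" using q by (auto simp: p_def)
  let ?A = "{1..int n}"
  define P where "P x = mexp p ?A (\<lambda>s. of_bool (card (fwd_orbit (rev_interval (int n) \<circ> s) x) = 2 * i))" for x
  define f where "f = local_cycle_prob p i L"
  \<comment> \<open>Positions whose window leaves \<open>{1..n}\<close> or meets its mirror image.
    The two ends contribute \<open>L\<close> each and the centre at most
    \<open>2 * L + 2\<close>.\<close>
  define Bad where "Bad = {1..int L} \<union> {int n - int L + 1..int n} \<union> {x. \<bar>2 * x - (int n + 1)\<bar> \<le> 2 * int L}"
  have Badc: "{x. \<bar>2 * x - (int n + 1)\<bar> \<le> 2 * int L} \<subseteq> {(int n + 1) div 2 - int L..(int n + 1) div 2 + int L + 1}"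
    by auto
  have finB: "finite Bad" unfolding Bad_def using finite_subset[OF Badc] by simp
  have "card Bad \<le> card {1..int L} + card {int n - int L + 1..int n} + card {(int n + 1) div 2 - int L..(int n + 1) div 2 + int L + 1}"
    unfolding Bad_def
    by (intro order_trans[OF card_Un_le] add_mono order_refl card_mono[OF _ Badc]) auto
  also have "\<dots> = 4 * L + 2" by simp
  finally have cB: "card Bad \<le> 4 * L + 2" .
  have err0: "0 \<le> local_error p i l" unfolding local_error_def using far_bound_nonneg[OF p] by simp
  have P01: "0 \<le> P x" "P x \<le> 1" for x unfolding P_def using mexp_of_bool_01[OF p(1)] by auto
  have f01: "0 \<le> f" "f \<le> 1" unfolding f_def using local_cycle_prob_01[OF p(1)] by auto
  have b: "\<bar>P x - f\<bar> \<le> local_error p i l + of_bool (x \<in> Bad)" if x: "x \<in> ?A" for x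
  proof (cases "x \<in> Bad")
    case True
    then show ?thesis using P01[of x] f01 err0 by (simp add: abs_le_iff)
  next
    case False
    then have "int L < x" "x \<le> int n - int L" and c: "\<not> \<bar>2 * x - (int n + 1)\<bar> \<le> 2 * int L"
      using x by (auto simp: Bad_def)
    then have "\<bar>P x - f\<bar> \<le> local_error p i l"
      unfolding P_def f_def by (intro cycle_prob_local p i L) auto
    then show ?thesis using False by simp
  qed
  have "real (2 * i) * exp_cycle_count q (2 * i) n = (\<Sum>x\<in>?A. P x)"
    using exp_cycle_count_mult[of "2 * i" q n] i q
    by (simp add: P_def p_def mexp_reverse[of q "int n"])
  then have "\<bar>real (2 * i) * exp_cycle_count q (2 * i) n - real n * f\<bar> = \<bar>\<Sum>x\<in>?A. P x - f\<bar>"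
    by (simp add: sum_subtractf)
  also have "\<dots> \<le> (\<Sum>x\<in>?A. local_error p i l + of_bool (x \<in> Bad))"
    by (intro order_trans[OF sum_abs] sum_mono b)
  also have "\<dots> = real n * local_error p i l + real (card (?A \<inter> Bad))"
    by (simp add: sum.distrib of_bool_def sum.If_cases)
  also have "\<dots> \<le> real n * local_error p i l + real (4 * L + 2)"
    using cB card_mono[OF finB, of "?A \<inter> Bad"] by (intro add_left_mono) auto
  finally have fin: "\<bar>real (2 * i) * exp_cycle_count q (2 * i) n - real n * f\<bar>
     \<le> real n * local_error p i l + real (4 * L + 2)" .
  have "real (2 * i) * exp_cycle_count q (2 * i) n / real n - f
     = (real (2 * i) * exp_cycle_count q (2 * i) n - real n * f) / real n"
    using n by (simp add: diff_divide_distrib)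
  then have "\<bar>real (2 * i) * exp_cycle_count q (2 * i) n / real n - f\<bar>
     = \<bar>real (2 * i) * exp_cycle_count q (2 * i) n - real n * f\<bar> / real n"
    by (simp only: abs_divide abs_of_nat)
  also have "\<dots> \<le> (real n * local_error p i l + real (4 * L + 2)) / real n"
    by (intro divide_right_mono fin) simp
  also have "\<dots> = local_error p i l + real (4 * L + 2) / real n" using n by (simp add: field_simps)
  finally show ?thesis by (simp add: f_def p_def)
qed

text \<open>Neither limit is known beforehand. Letting \<open>n\<close> grow with \<open>l\<close>
  fixed compares two values of \<open>f\<close> and makes \<open>f\<close> Cauchy; then
  \<open>e n\<close> is held close to its limit by choosing \<open>l\<close>, then \<open>L\<close>,
  then \<open>n\<close>.\<close>

lemma common_limit_from_local_bound:
  fixes e f \<epsilon> :: "nat \<Rightarrow> real"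
  assumes \<epsilon>: "\<epsilon> \<longlonglongrightarrow> 0"
    and b: "\<And>l L n. c * l \<le> L \<Longrightarrow> 0 < n \<Longrightarrow> \<bar>e n - f L\<bar> \<le> \<epsilon> l + C L / real n"
  shows "\<exists>m. e \<longlonglongrightarrow> m \<and> f \<longlonglongrightarrow> m"
proof -
  have lim0: "(\<lambda>n. a / real n) \<longlonglongrightarrow> 0" for a :: real
    by (rule lim_const_over_n)
  have ff: "\<bar>f L - f L'\<bar> \<le> 2 * \<epsilon> l" if "c * l \<le> L" "c * l \<le> L'" for l L L'
  proof (rule tendsto_lowerbound)
    show "(\<lambda>n. 2 * \<epsilon> l + (C L + C L') / real n) \<longlonglongrightarrow> 2 * \<epsilon> l"
      using tendsto_add[OF tendsto_const[of "2 * \<epsilon> l"] lim0[of "C L + C L'"]] by simp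
    show "\<forall>\<^sub>F n in sequentially. \<bar>f L - f L'\<bar> \<le> 2 * \<epsilon> l + (C L + C L') / real n"
      using eventually_gt_at_top[of 0]
    proof eventually_elim
      case (elim n)
      show ?case using b[OF that(1) elim] b[OF that(2) elim] by (simp add: add_divide_distrib)
    qed
  qed simp
  have small: "\<exists>l. \<epsilon> l < r" if "0 < r" for r
    using eventually_happens'[OF sequentially_bot order_tendstoD(2)[OF \<epsilon> that]] .
  have "Cauchy f"
  proof (rule metric_CauchyI)
    fix r :: real assume "0 < r"
    then obtain l where "\<epsilon> l < r / 2" using small[of "r / 2"] by auto
    then have "dist (f m) (f n) < r" if "c * l \<le> m" "c * l \<le> n" for m n
      using ff[OF that] by (simp add: dist_real_def)
    then show "\<exists>M. \<forall>m\<ge>M. \<forall>n\<ge>M. dist (f m) (f n) < r" by blast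
  qed
  then obtain m where m: "f \<longlonglongrightarrow> m" by (auto simp: Cauchy_convergent_iff convergent_def)
  have "e \<longlonglongrightarrow> m"
  proof (rule LIMSEQ_I)
    fix r :: real assume r: "0 < r"
    then obtain l where l: "\<epsilon> l < r / 3" using small[of "r / 3"] by auto
    have "\<forall>\<^sub>F L in sequentially. \<bar>f L - m\<bar> < r / 3 \<and> c * l \<le> L"
      using tendstoD[OF m, of "r / 3"] r eventually_ge_at_top[of "c * l"]
      by (simp add: dist_real_def eventually_conj_iff)
    then obtain L where L: "\<bar>f L - m\<bar> < r / 3" "c * l \<le> L"
      using eventually_happens'[OF sequentially_bot] by blast
    have "\<forall>\<^sub>F n in sequentially. C L / real n < r / 3"
      using order_tendstoD(2)[OF lim0[of "C L"], of "r / 3"] r by simp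
    then have "\<forall>\<^sub>F n in sequentially. norm (e n - m) < r"
      using eventually_gt_at_top[of 0]
    proof eventually_elim
      case (elim n)
      then show ?case using b[OF L(2) elim(2)] l L(1) unfolding real_norm_def by linarith
    qed
    then show "\<exists>no. \<forall>n\<ge>no. norm (e n - m) < r" by (simp add: eventually_sequentially)
  qed
  then show ?thesis using m by blast
qed

lemma local_error_tendsto_0:
  assumes p: "0 < p" "p < 1"
  shows "local_error p i \<longlonglongrightarrow> 0"
proof -
  define r where "r = sqrt p"
  have r: "norm r < 1" using p by (simp add: r_def)
  define c where "c = 4 / ((1 - p) * (1 - r))"
  have "(\<lambda>l. c * r * (8 * real i * (real l * r ^ l) + 2 * r ^ l)) \<longlonglongrightarrow> c * r * (8 * real i * 0 + 2 * 0)"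
    using r by (intro tendsto_intros powser_times_n_limit_0 LIMSEQ_power_zero)
  moreover have "local_error p i = (\<lambda>l. c * r * (8 * real i * (real l * r ^ l) + 2 * r ^ l))"
    by (simp add: local_error_def far_bound_def c_def r_def fun_eq_iff algebra_simps add_divide_distrib)
  ultimately show ?thesis by simp
qed

lemma exp_cycle_count_tendsto:
  assumes q: "1 < q" and i: "0 < i"
  shows "convergent (\<lambda>n. exp_cycle_count q (2 * i) n / real n)"
    and "local_cycle_prob (1 / q) i \<longlonglongrightarrow> 2 * real i * mu q i"
proof -
  have "\<exists>m. (\<lambda>n. real (2 * i) * exp_cycle_count q (2 * i) n / real n) \<longlonglongrightarrow> m
      \<and> local_cycle_prob (1 / q) i \<longlonglongrightarrow> m"
  proof (rule common_limit_from_local_bound[where c = "2 * i + 1"])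
    show "local_error (1 / q) i \<longlonglongrightarrow> 0" using q by (intro local_error_tendsto_0) auto
  qed (rule exp_cycle_count_local[OF q i])
  then obtain m where m: "(\<lambda>n. real (2 * i) * exp_cycle_count q (2 * i) n / real n) \<longlonglongrightarrow> m"
    "local_cycle_prob (1 / q) i \<longlonglongrightarrow> m" by blast
  have "(\<lambda>n. real (2 * i) * exp_cycle_count q (2 * i) n / real n / real (2 * i)) \<longlonglongrightarrow> m / real (2 * i)"
    by (intro tendsto_divide m(1) tendsto_const) (use i in auto)
  then have lim: "(\<lambda>n. exp_cycle_count q (2 * i) n / real n) \<longlonglongrightarrow> m / real (2 * i)"
    using i by (simp add: field_simps)
  then show "convergent (\<lambda>n. exp_cycle_count q (2 * i) n / real n)" by (auto simp: convergent_def)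
  have "mu q i = m / real (2 * i)" unfolding mu_def by (rule limI[OF lim])
  then show "local_cycle_prob (1 / q) i \<longlonglongrightarrow> 2 * real i * mu q i" using m(2) i by simp
qed

section \<open>The bi-infinite Mallows measure\<close>

lemma mallows_Z_D:
  assumes "mallows_Z M r S"
  shows "prob_space M" "S \<in> measurable M perm_space" "\<And>\<omega>. \<omega> \<in> space M \<Longrightarrow> bij (S \<omega>)"
    "\<And>a b p. p permutes {a..b} \<Longrightarrow>
        measure M {\<omega> \<in> space M. pattern (S \<omega>) {a..b} = p} = mallows_prob r {a..b} p"
    "AE \<omega> in M. \<forall>i. eventually (\<lambda>n. pattern (S \<omega>) {- int n..int n} i = S \<omega> i) sequentially"
  using assms by (auto simp: mallows_Z_def)

lemma measurable_eval:
  "S \<in> measurable M perm_space \<Longrightarrow> (\<lambda>\<omega>. S \<omega> x) \<in> measurable M (count_space UNIV)"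
  by (rule measurable_compose[OF _ measurable_component_singleton]) auto

text \<open>Finitely many comparisons of coordinates give a set in \<open>sets perm_space\<close>,
  to which independence of \<open>S\<close> and \<open>S'\<close> applies. For bijections it is the
  event of having pattern \<open>p\<close>.\<close>

definition order_event :: "int \<Rightarrow> int \<Rightarrow> (int \<Rightarrow> int) \<Rightarrow> (int \<Rightarrow> int) set" where
  "order_event a b p = {s \<in> space perm_space. \<forall>x\<in>{a..b}. \<forall>y\<in>{a..b}. s x < s y \<longleftrightarrow> p x < p y}"

lemma order_event_sets: "order_event a b p \<in> sets perm_space"
proof -
  have "Measurable.pred perm_space (\<lambda>s. s x < s y \<longleftrightarrow> p x < p y)" for x y :: int
  proof -
    have [measurable]: "(\<lambda>s. s x) \<in> measurable perm_space (count_space UNIV)" for x :: int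
      by (rule measurable_component_singleton) simp
    show ?thesis by measurable
  qed
  then have "Measurable.pred perm_space (\<lambda>s. \<forall>x\<in>{a..b}. \<forall>y\<in>{a..b}. s x < s y \<longleftrightarrow> p x < p y)"
    by (intro pred_intros_finite) auto
  then show ?thesis unfolding order_event_def pred_def by simp
qed

lemma pattern_eq_iff_order_event:
  assumes "bij s" "p permutes {a..b}"
  shows "pattern s {a..b} = p \<longleftrightarrow> s \<in> order_event a b p"
proof
  have inj: "inj_on s {a..b}" using assms(1) by (meson bij_is_inj inj_on_subset subset_UNIV)
  show "pattern s {a..b} = p \<Longrightarrow> s \<in> order_event a b p"
    using pattern_less_iff[OF inj] by (auto simp: order_event_def space_PiM)
  show "s \<in> order_event a b p \<Longrightarrow> pattern s {a..b} = p"
    unfolding order_event_def by (intro pattern_eqI[OF inj assms(2)]) auto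
qed

lemma mallows_Z_vimage:
  assumes Z: "mallows_Z M r S" and p: "p permutes {a..b}"
  shows "S -` order_event a b p \<inter> space M = {\<omega> \<in> space M. pattern (S \<omega>) {a..b} = p}"
  using pattern_eq_iff_order_event[OF mallows_Z_D(3)[OF Z] p] by auto

lemma mallows_Z_pattern_sets:
  assumes Z: "mallows_Z M r S" and p: "p permutes {a..b}"
  shows "{\<omega> \<in> space M. pattern (S \<omega>) {a..b} = p} \<in> sets M"
  using measurable_sets[OF mallows_Z_D(2)[OF Z] order_event_sets[of a b p]] mallows_Z_vimage[OF Z p]
  by simp

lemma mallows_Z_pattern_permutes:
  assumes Z: "mallows_Z M r S" and "\<omega> \<in> space M"
  shows "pattern (S \<omega>) {a..b} permutes {a..b}"
  by (meson Z assms(2) bij_is_inj inj_on_subset mallows_Z_D(3) pattern_permutes subset_UNIV)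

text \<open>Only finitely many pairs of patterns occur, so the event is a finite disjoint union
  whose pieces have product probability by independence.\<close>

lemma mallows_Z_two_patterns:
  assumes Z: "mallows_Z M r S" and Z': "mallows_Z M r S'"
    and ind: "prob_space.indep_var M perm_space S perm_space S'"
  shows "measure M {\<omega> \<in> space M. Q (pattern (S \<omega>) {a..b}) (pattern (S' \<omega>) {a..b})}
     = mexp r {a..b} (\<lambda>s. mexp r {a..b} (\<lambda>t. of_bool (Q s t)))"
    and "{\<omega> \<in> space M. Q (pattern (S \<omega>) {a..b}) (pattern (S' \<omega>) {a..b})} \<in> sets M"
proof -
  interpret prob_space M using mallows_Z_D(1)[OF Z] .
  let ?P = "{s. s permutes {a..b}}"
  define E where "E = (\<lambda>(s, t). {\<omega> \<in> space M. pattern (S \<omega>) {a..b} = s \<and> pattern (S' \<omega>) {a..b} = t})"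
  define T where "T = {(s, t). s \<in> ?P \<and> t \<in> ?P \<and> Q s t}"
  have finP: "finite ?P" by (simp add: finite_permutations)
  have T: "T = Set.filter (\<lambda>(s, t). Q s t) (?P \<times> ?P)" by (auto simp: T_def)
  have finT: "finite T" unfolding T using finP by simp
  have Eint: "E (s, t) = {\<omega> \<in> space M. pattern (S \<omega>) {a..b} = s} \<inter> {\<omega> \<in> space M. pattern (S' \<omega>) {a..b} = t}" for s t
    by (auto simp: E_def)
  have Eset: "E z \<in> sets M" if "z \<in> T" for z
    using that mallows_Z_pattern_sets[OF Z] mallows_Z_pattern_sets[OF Z'] by (auto simp: Eint T_def)
  have Eprob: "prob (E (s, t)) = mallows_prob r {a..b} s * mallows_prob r {a..b} t"
    if s: "s permutes {a..b}" and t: "t permutes {a..b}" for s t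
  proof -
    have "E (s, t) = (\<lambda>x. (S x, S' x)) -` (order_event a b s \<times> order_event a b t) \<inter> space M"
      unfolding Eint mallows_Z_vimage[OF Z s, symmetric] mallows_Z_vimage[OF Z' t, symmetric] by auto
    then show ?thesis
      using indep_varD[OF ind order_event_sets order_event_sets, of a b s a b t]
      by (simp only: mallows_Z_vimage[OF Z s] mallows_Z_vimage[OF Z' t] mallows_Z_D(4)[OF Z s] mallows_Z_D(4)[OF Z' t])
  qed
  have eq: "{\<omega> \<in> space M. Q (pattern (S \<omega>) {a..b}) (pattern (S' \<omega>) {a..b})} = (\<Union>z\<in>T. E z)"
    using mallows_Z_pattern_permutes[OF Z] mallows_Z_pattern_permutes[OF Z'] by (auto simp: E_def T_def)
  show "{\<omega> \<in> space M. Q (pattern (S \<omega>) {a..b}) (pattern (S' \<omega>) {a..b})} \<in> sets M"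
    unfolding eq using finT Eset by (intro sets.finite_UN) auto
  have "prob (\<Union>z\<in>T. E z) = (\<Sum>z\<in>T. prob (E z))"
    by (rule finite_measure_finite_Union[OF finT])
      (use Eset in \<open>auto simp: disjoint_family_on_def E_def\<close>)
  also have "\<dots> = (\<Sum>(s, t)\<in>T. mallows_prob r {a..b} s * mallows_prob r {a..b} t)"
    by (intro sum.cong refl) (auto simp: T_def Eprob)
  also have "\<dots> = (\<Sum>(s, t)\<in>?P \<times> ?P. mallows_prob r {a..b} s * (mallows_prob r {a..b} t * of_bool (Q s t)))"
    by (rule sum.mono_neutral_cong_left) (use finP in \<open>auto simp: T_def\<close>)
  also have "\<dots> = mexp r {a..b} (\<lambda>s. mexp r {a..b} (\<lambda>t. of_bool (Q s t)))"
    by (simp add: mexp_def sum.cartesian_product[symmetric] sum_distrib_left)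
  finally show "measure M {\<omega> \<in> space M. Q (pattern (S \<omega>) {a..b}) (pattern (S' \<omega>) {a..b})}
     = mexp r {a..b} (\<lambda>s. mexp r {a..b} (\<lambda>t. of_bool (Q s t)))"
    unfolding eq .
qed

lemma mallows_Z_one_pattern:
  assumes Z: "mallows_Z M r S"
  shows "measure M {\<omega> \<in> space M. Q (pattern (S \<omega>) {a..b})} = mexp r {a..b} (\<lambda>s. of_bool (Q s))"
    and "{\<omega> \<in> space M. Q (pattern (S \<omega>) {a..b})} \<in> sets M"
proof -
  interpret prob_space M using mallows_Z_D(1)[OF Z] .
  define T where "T = {s. s permutes {a..b} \<and> Q s}"
  define E where "E p = {\<omega> \<in> space M. pattern (S \<omega>) {a..b} = p}" for p
  have fin: "finite {s. s permutes {a..b}}" by (simp add: finite_permutations)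
  then have finT: "finite T" by (rule finite_subset[rotated]) (auto simp: T_def)
  have Eset: "E p \<in> sets M" if "p \<in> T" for p
    using that mallows_Z_pattern_sets[OF Z] by (auto simp: E_def T_def)
  have eq: "{\<omega> \<in> space M. Q (pattern (S \<omega>) {a..b})} = (\<Union>p\<in>T. E p)"
    using mallows_Z_pattern_permutes[OF Z] by (auto simp: E_def T_def)
  show "{\<omega> \<in> space M. Q (pattern (S \<omega>) {a..b})} \<in> sets M"
    unfolding eq using finT Eset by (intro sets.finite_UN) auto
  have "prob (\<Union>p\<in>T. E p) = (\<Sum>p\<in>T. prob (E p))"
    by (rule finite_measure_finite_Union[OF finT])
      (use Eset in \<open>auto simp: disjoint_family_on_def E_def\<close>)
  also have "\<dots> = (\<Sum>p\<in>T. mallows_prob r {a..b} p)"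
    by (intro sum.cong refl) (auto simp: T_def E_def mallows_Z_D(4)[OF Z])
  also have "\<dots> = mexp r {a..b} (\<lambda>s. of_bool (Q s))"
    unfolding mexp_def by (rule sum.mono_neutral_cong_left) (use fin in \<open>auto simp: T_def\<close>)
  finally show "measure M {\<omega> \<in> space M. Q (pattern (S \<omega>) {a..b})} = mexp r {a..b} (\<lambda>s. of_bool (Q s))"
    unfolding eq .
qed

text \<open>Dominated convergence for indicators. It carries the almost sure stabilisation of the
  window patterns over to probabilities.\<close>

lemma (in prob_space) prob_tendsto_of_AE_eventually:
  assumes E: "E \<in> events" and En: "\<And>n. En n \<in> events"
    and ev: "AE \<omega> in M. eventually (\<lambda>n. \<omega> \<in> En n \<longleftrightarrow> \<omega> \<in> E) sequentially"
  shows "(\<lambda>n. prob (En n)) \<longlonglongrightarrow> prob E"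
proof -
  have "(\<lambda>n. \<integral>\<omega>. indicat_real (En n) \<omega> \<partial>M) \<longlonglongrightarrow> (\<integral>\<omega>. indicat_real E \<omega> \<partial>M)"
  proof (rule integral_dominated_convergence[where w = "\<lambda>_. 1"])
    show "AE \<omega> in M. (\<lambda>n. indicat_real (En n) \<omega>) \<longlonglongrightarrow> indicat_real E \<omega>"
      using ev
    proof eventually_elim
      case (elim \<omega>)
      then have "eventually (\<lambda>n. indicat_real (En n) \<omega> = indicat_real E \<omega>) sequentially"
        by eventually_elim (auto simp: indicator_def)
      then show ?case by (rule tendsto_eventually)
    qed
  qed (use E En in \<open>auto simp: indicator_def\<close>)
  then show ?thesis using E En by simp
qed

section \<open>Cycle events and one-point probabilities of the bi-infinite law\<close>

lemma funpow_Suc_comp: "((t \<circ> s) ^^ Suc k) x = t (s (((t \<circ> s) ^^ k) x))"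
  by simp

lemma measurable_funpow_comp:
  assumes S: "S \<in> measurable M perm_space" and S': "S' \<in> measurable M perm_space"
  shows "(\<lambda>\<omega>. ((S' \<omega> \<circ> S \<omega>) ^^ k) x) \<in> measurable M (count_space UNIV)"
proof (induction k)
  case (Suc k)
  \<comment> \<open>The argument of \<open>S \<omega>\<close> is itself random; since the integers
    are countable one can split by its value.\<close>
  have 1: "(\<lambda>\<omega>. S \<omega> (((S' \<omega> \<circ> S \<omega>) ^^ k) x)) \<in> measurable M (count_space UNIV)"
    by (rule measurable_compose_countable[OF measurable_eval[OF S] Suc])
  have "(\<lambda>\<omega>. S' \<omega> (S \<omega> (((S' \<omega> \<circ> S \<omega>) ^^ k) x))) \<in> measurable M (count_space UNIV)"
    by (rule measurable_compose_countable[OF measurable_eval[OF S'] 1])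
  then show ?case by (simp only: funpow_Suc_comp)
qed simp

lemma mallows_Z_inj_comp:
  assumes "mallows_Z M r S" "mallows_Z M r S'" "\<omega> \<in> space M"
  shows "inj (S' \<omega> \<circ> S \<omega>)"
  using assms by (intro inj_compose bij_is_inj mallows_Z_D(3))

lemma cycle_event_sets:
  assumes Z: "mallows_Z M r S" and Z': "mallows_Z M r S'" and i: "0 < i"
  shows "{\<omega> \<in> space M. card (fwd_orbit (S' \<omega> \<circ> S \<omega>) 0) = i} \<in> sets M"
proof -
  let ?f = "\<lambda>k \<omega>. ((S' \<omega> \<circ> S \<omega>) ^^ k) 0"
  have [measurable]: "?f k \<in> measurable M (count_space UNIV)" for k
    by (rule measurable_funpow_comp[OF mallows_Z_D(2)[OF Z] mallows_Z_D(2)[OF Z']])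
  have "{\<omega> \<in> space M. card (fwd_orbit (S' \<omega> \<circ> S \<omega>) 0) = i}
      = {\<omega> \<in> space M. ?f i \<omega> = 0 \<and> (\<forall>j. 0 < j \<and> j < i \<longrightarrow> ?f j \<omega> \<noteq> 0)}"
    using card_fwd_orbit_iff[OF mallows_Z_inj_comp[OF Z Z'] i] by blast
  also have "\<dots> \<in> sets M" by measurable
  finally show ?thesis .
qed

lemma eventually_funpow_pattern:
  assumes "\<forall>x. eventually (\<lambda>n. pattern s {- int n..int n} x = s x) sequentially"
    and "\<forall>x. eventually (\<lambda>n. pattern t {- int n..int n} x = t x) sequentially"
  shows "eventually (\<lambda>n. ((pattern t {- int n..int n} \<circ> pattern s {- int n..int n}) ^^ k) x
     = ((t \<circ> s) ^^ k) x) sequentially"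
proof (induction k)
  case (Suc k)
  \<comment> \<open>\<open>u\<close> does not depend on \<open>n\<close>, so eventual agreement at
    the two points \<open>u\<close> and \<open>s u\<close> suffices and no uniformity in the point
    is needed.\<close>
  define u where "u = ((t \<circ> s) ^^ k) x"
  from Suc assms(1)[rule_format, of u] assms(2)[rule_format, of "s u"]
  show ?case unfolding u_def[symmetric] by eventually_elim (simp only: funpow_Suc_comp u_def)
qed simp

lemma mallows_Z_cycle_prob_tendsto:
  assumes Z: "mallows_Z M r S" and Z': "mallows_Z M r S'"
    and ind: "prob_space.indep_var M perm_space S perm_space S'" and i: "0 < i"
  shows "local_cycle_prob r i \<longlonglongrightarrow> measure M {\<omega> \<in> space M. card (fwd_orbit (S' \<omega> \<circ> S \<omega>) 0) = i}"
proof -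
  interpret prob_space M using mallows_Z_D(1)[OF Z] .
  let ?I = "\<lambda>n. {- int n..int n}"
  let ?E = "\<lambda>n. {\<omega> \<in> space M. card (fwd_orbit (pattern (S' \<omega>) (?I n) \<circ> pattern (S \<omega>) (?I n)) 0) = i}"
  have "(\<lambda>n. prob (?E n)) \<longlonglongrightarrow> prob {\<omega> \<in> space M. card (fwd_orbit (S' \<omega> \<circ> S \<omega>) 0) = i}"
  proof (rule prob_tendsto_of_AE_eventually)
    show "{\<omega> \<in> space M. card (fwd_orbit (S' \<omega> \<circ> S \<omega>) 0) = i} \<in> events"
      by (rule cycle_event_sets[OF Z Z' i])
    show "?E n \<in> events" for n
      using mallows_Z_two_patterns(2)[OF Z Z' ind, of "\<lambda>s t. card (fwd_orbit (t \<circ> s) 0) = i"] .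
    show "AE \<omega> in M. \<forall>\<^sub>F n in sequentially. \<omega> \<in> ?E n \<longleftrightarrow> \<omega> \<in> {\<omega> \<in> space M. card (fwd_orbit (S' \<omega> \<circ> S \<omega>) 0) = i}"
      using mallows_Z_D(5)[OF Z] mallows_Z_D(5)[OF Z'] AE_space
    proof eventually_elim
      case (elim \<omega>)
      have "\<forall>\<^sub>F n in sequentially. \<forall>k\<in>{..i}.
          ((pattern (S' \<omega>) (?I n) \<circ> pattern (S \<omega>) (?I n)) ^^ k) 0 = ((S' \<omega> \<circ> S \<omega>) ^^ k) 0"
        using eventually_funpow_pattern[OF elim(1,2)] by (intro eventually_ball_finite) auto
      then show ?case
      proof eventually_elim
        case (elim n)
        have "inj (pattern (S' \<omega>) (?I n) \<circ> pattern (S \<omega>) (?I n))" "inj (S' \<omega> \<circ> S \<omega>)"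
          using permutes_inj[OF mallows_Z_pattern_permutes[OF Z \<open>\<omega> \<in> space M\<close>]]
            permutes_inj[OF mallows_Z_pattern_permutes[OF Z' \<open>\<omega> \<in> space M\<close>]]
            mallows_Z_inj_comp[OF Z Z' \<open>\<omega> \<in> space M\<close>]
          by (simp_all only: inj_compose)
        then show ?case using elim i by (simp add: card_fwd_orbit_iff)
      qed
    qed
  qed
  moreover have "prob (?E n) = local_cycle_prob r i n" for n
    unfolding local_cycle_prob_def
    using mallows_Z_two_patterns(1)[OF Z Z' ind, of "\<lambda>s t. card (fwd_orbit (t \<circ> s) 0) = i"] .
  ultimately show ?thesis by simp
qed

lemma eval_event_sets:
  assumes Z: "mallows_Z M r S"
  shows "{\<omega> \<in> space M. S \<omega> x = y} \<in> sets M"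
  using measurable_sets[OF measurable_eval[OF mallows_Z_D(2)[OF Z], of x], of "{y}"]
  by (simp add: vimage_def Int_def conj_commute)

lemma mallows_Z_eval_tendsto:
  assumes Z: "mallows_Z M r S"
  shows "(\<lambda>n. mexp r {- int n..int n} (\<lambda>s. of_bool (s x = y))) \<longlonglongrightarrow> measure M {\<omega> \<in> space M. S \<omega> x = y}"
proof -
  interpret prob_space M using mallows_Z_D(1)[OF Z] .
  let ?I = "\<lambda>n. {- int n..int n}"
  have "(\<lambda>n. prob {\<omega> \<in> space M. pattern (S \<omega>) (?I n) x = y}) \<longlonglongrightarrow> prob {\<omega> \<in> space M. S \<omega> x = y}"
  proof (rule prob_tendsto_of_AE_eventually[OF eval_event_sets[OF Z]])
    show "{\<omega> \<in> space M. pattern (S \<omega>) (?I n) x = y} \<in> events" for n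
      using mallows_Z_one_pattern(2)[OF Z, of "\<lambda>s. s x = y"] .
    show "AE \<omega> in M. \<forall>\<^sub>F n in sequentially. \<omega> \<in> {\<omega> \<in> space M. pattern (S \<omega>) (?I n) x = y}
        \<longleftrightarrow> \<omega> \<in> {\<omega> \<in> space M. S \<omega> x = y}"
      using mallows_Z_D(5)[OF Z]
    proof eventually_elim
      case (elim \<omega>)
      from elim[rule_format, of x] show ?case by eventually_elim simp
    qed
  qed
  then show ?thesis using mallows_Z_one_pattern(1)[OF Z, of "\<lambda>s. s x = y"] by simp
qed

text \<open>Invariance of the finite Mallows laws under inversion passes to the limit. It turns the
  product of the probabilities of \<open>S \<omega> 0 = j\<close> and
  \<open>S' \<omega> j = 0\<close> into a square.\<close>

lemma mallows_Z_eval_inverse: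
  assumes Z: "mallows_Z M r S" and Z': "mallows_Z M r S'"
  shows "measure M {\<omega> \<in> space M. S' \<omega> y = x} = measure M {\<omega> \<in> space M. S \<omega> x = y}"
proof -
  have "mexp r {- int n..int n} (\<lambda>s. of_bool (s x = y)) = mexp r {- int n..int n} (\<lambda>s. of_bool (s y = x))" for n
  proof (subst mexp_inv, rule mexp_cong)
    fix s :: "int \<Rightarrow> int" assume "s permutes {- int n..int n}"
    then have "inv s x = y \<longleftrightarrow> s y = x" by (rule permutes_inv_eq)
    then show "(of_bool (inv s x = y) :: real) = of_bool (s y = x)" by simp
  qed
  then have "(\<lambda>n. mexp r {- int n..int n} (\<lambda>s. of_bool (s y = x))) \<longlonglongrightarrow> measure M {\<omega> \<in> space M. S \<omega> x = y}"
    using mallows_Z_eval_tendsto[OF Z, of x y] by simp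
  with mallows_Z_eval_tendsto[OF Z', of y x] show ?thesis by (rule LIMSEQ_unique)
qed

lemma mallows_Z_fixed_point_sum:
  assumes Z: "mallows_Z M r S" and Z': "mallows_Z M r S'"
    and ind: "prob_space.indep_var M perm_space S perm_space S'"
  shows "((\<lambda>j. (measure M {\<omega> \<in> space M. S \<omega> 0 = j})\<^sup>2) has_sum
     measure M {\<omega> \<in> space M. card (fwd_orbit (S' \<omega> \<circ> S \<omega>) 0) = 1}) UNIV"
proof -
  interpret prob_space M using mallows_Z_D(1)[OF Z] .
  define E where "E j = {\<omega> \<in> space M. S \<omega> 0 = j \<and> S' \<omega> j = 0}" for j
  have Eint: "E j = {\<omega> \<in> space M. S \<omega> 0 = j} \<inter> {\<omega> \<in> space M. S' \<omega> j = 0}" for j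
    by (auto simp: E_def)
  have Eset: "E j \<in> events" for j
    unfolding Eint by (intro sets.Int eval_event_sets[OF Z] eval_event_sets[OF Z'])
  have Eprob: "prob (E j) = (measure M {\<omega> \<in> space M. S \<omega> 0 = j})\<^sup>2" for j
  proof -
    have ev: "{s \<in> space perm_space. s x = y} \<in> sets perm_space" for x y :: int
      using measurable_sets[OF measurable_component_singleton[of x UNIV "\<lambda>_. count_space UNIV"], of "{y}"]
      by (simp add: vimage_def Int_def conj_commute)
    have sp: "S \<omega> \<in> space perm_space" "S' \<omega> \<in> space perm_space" for \<omega>
      by (simp_all add: space_PiM)
    have "E j = (\<lambda>\<omega>. (S \<omega>, S' \<omega>)) -` ({s \<in> space perm_space. s 0 = j} \<times> {s \<in> space perm_space. s j = 0}) \<inter> space M"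
      using sp by (auto simp: E_def)
    also have "prob \<dots> = prob (S -` {s \<in> space perm_space. s 0 = j} \<inter> space M)
        * prob (S' -` {s \<in> space perm_space. s j = 0} \<inter> space M)"
      by (rule indep_varD[OF ind ev ev])
    finally have "prob (E j) = prob (S -` {s \<in> space perm_space. s 0 = j} \<inter> space M)
        * prob (S' -` {s \<in> space perm_space. s j = 0} \<inter> space M)" .
    moreover have "S -` {s \<in> space perm_space. s 0 = j} \<inter> space M = {\<omega> \<in> space M. S \<omega> 0 = j}"
      "S' -` {s \<in> space perm_space. s j = 0} \<inter> space M = {\<omega> \<in> space M. S' \<omega> j = 0}"
      using sp by auto
    ultimately show ?thesis
      using mallows_Z_eval_inverse[OF Z Z', of j 0] by (simp add: power2_eq_square)
  qed
  have eq: "{\<omega> \<in> space M. card (fwd_orbit (S' \<omega> \<circ> S \<omega>) 0) = 1} = (\<Union>n. E (int_decode n))"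
  proof -
    have "(\<Union>n. E (int_decode n)) = (\<Union>j. E j)"
      using surj_int_decode by (metis image_image)
    also have "\<dots> = {\<omega> \<in> space M. S' \<omega> (S \<omega> 0) = 0}" by (auto simp: E_def)
    also have "\<dots> = {\<omega> \<in> space M. card (fwd_orbit (S' \<omega> \<circ> S \<omega>) 0) = 1}"
      using card_fwd_orbit_iff[OF mallows_Z_inj_comp[OF Z Z'], of _ 1 0] by auto
    finally show ?thesis by simp
  qed
  have "(\<lambda>n. prob (E (int_decode n))) sums prob (\<Union>n. E (int_decode n))"
  proof (rule finite_measure_UNION)
    show "disjoint_family (\<lambda>n. E (int_decode n))"
      unfolding disjoint_family_on_def E_def by (auto simp: int_decode_eq)
  qed (use Eset in auto)
  then have "((\<lambda>n. prob (E (int_decode n))) has_sum prob (\<Union>n. E (int_decode n))) UNIV"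
    by (rule sums_nonneg_imp_has_sum) simp
  then have "((\<lambda>j. prob (E j)) has_sum prob (\<Union>n. E (int_decode n))) UNIV"
    by (subst (asm) has_sum_reindex_bij_betw[OF bij_int_decode, of "\<lambda>j. prob (E j)"])
  then show ?thesis unfolding eq Eprob .
qed

section \<open>Common cuts\<close>

text \<open>No position crosses the gap between \<open>c\<close> and \<open>c + 1\<close>. Cuts
  common to \<open>s\<close> and \<open>t\<close> on both sides of 0 trap the orbit of 0 under
  \<open>t \<circ> s\<close>.\<close>

definition cut :: "int set \<Rightarrow> int \<Rightarrow> (int \<Rightarrow> int) \<Rightarrow> bool" where
  "cut A c s \<longleftrightarrow> (\<forall>u\<in>A. u \<le> c \<longleftrightarrow> s u \<le> c)"

text \<open>The part above \<open>c\<close> is mapped into itself injectively, hence onto by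
  finiteness, and leaves no room for a value coming from below.\<close>

lemma cut_if_upper:
  assumes s: "s permutes A" and A: "finite A" and up: "\<And>u. u \<in> A \<Longrightarrow> c < u \<Longrightarrow> c < s u"
  shows "cut A c s"
proof -
  let ?B = "{u \<in> A. c < u}"
  have "s ` ?B \<subseteq> ?B" using up s by (auto simp: permutes_in_image)
  then have im: "s ` ?B = ?B"
    using A by (intro endo_inj_surj permutes_inj_on[OF s]) auto
  have "u \<in> ?B" if "u \<in> A" "c < s u" for u
  proof -
    have "s u \<in> A" using that s by (simp add: permutes_in_image)
    then have "s u \<in> s ` ?B" using that unfolding im by simp
    then show ?thesis using s by (simp add: inj_image_mem_iff permutes_inj)
  qed
  then show ?thesis using up unfolding cut_def by (metis (mono_tags, lifting) mem_Collect_eq not_le)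
qed

text \<open>The sum over \<open>d \<ge> m\<close> of \<open>2 * far_bound p d\<close>, one term for
  each side of the gap.\<close>

definition outer_bound :: "real \<Rightarrow> nat \<Rightarrow> real" where
  "outer_bound p m = 2 / (1 - sqrt p) * far_bound p m"

text \<open>To cross the gap, the positions \<open>c - d\<close> and \<open>c + 1 + d\<close> have
  to move by more than \<open>d\<close>, which forces an inversion at a distance greater than
  \<open>d\<close>.\<close>

lemma mexp_crossing_far_from:
  assumes p: "0 < p" "p < 1"
  shows "mexp p {a..b} (\<lambda>s. of_bool (\<exists>u\<in>{a..b}. u \<notin> {c - int m + 1..c + int m} \<and> \<not> (u \<le> c \<longleftrightarrow> s u \<le> c)))
    \<le> outer_bound p m"
proof -
  let ?A = "{a..b}"
  define E where "E d s \<longleftrightarrow> (c - int d \<in> ?A \<and> far_inversion ?A s (c - int d) (int d))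
     \<or> (c + 1 + int d \<in> ?A \<and> far_inversion ?A s (c + 1 + int d) (int d))" for d s
  define N where "N = nat (\<bar>c - a\<bar> + \<bar>b - c\<bar>)"
  have one: "mexp p ?A (\<lambda>s. of_bool (u \<in> ?A \<and> far_inversion ?A s u (int d))) \<le> far_bound p d" for u d
  proof (cases "u \<in> ?A")
    case True
    then show ?thesis using mexp_far_inversion[OF p True, of d] by simp
  next
    case False
    then have "mexp p ?A (\<lambda>s. of_bool (u \<in> ?A \<and> far_inversion ?A s u (int d))) \<le> 0"
      using p by (intro mexp_le_const) (simp_all only: simp_thms of_bool_eq finite_atLeastAtMost_int order_refl)
    then show ?thesis using far_bound_nonneg[OF p, of d] by simp
  qed
  have E: "mexp p ?A (\<lambda>s. of_bool (E d s)) \<le> 2 * far_bound p d" for d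
  proof -
    have "mexp p ?A (\<lambda>s. of_bool (E d s)) \<le>
        mexp p ?A (\<lambda>s. of_bool (c - int d \<in> ?A \<and> far_inversion ?A s (c - int d) (int d))
          + of_bool (c + 1 + int d \<in> ?A \<and> far_inversion ?A s (c + 1 + int d) (int d)))"
      by (rule mexp_mono) (use p in \<open>auto simp: E_def\<close>)
    also have "\<dots> \<le> far_bound p d + far_bound p d"
      unfolding mexp_add by (intro add_mono one)
    finally show ?thesis by simp
  qed
  have "mexp p ?A (\<lambda>s. of_bool (\<exists>u\<in>?A. u \<notin> {c - int m + 1..c + int m} \<and> \<not> (u \<le> c \<longleftrightarrow> s u \<le> c)))
     \<le> (\<Sum>d=m..N. mexp p ?A (\<lambda>s. of_bool (E d s)))"
  proof (rule mexp_of_bool_le_sum)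
    fix s assume s: "s permutes ?A"
      and "\<exists>u\<in>?A. u \<notin> {c - int m + 1..c + int m} \<and> \<not> (u \<le> c \<longleftrightarrow> s u \<le> c)"
    then obtain u where u: "u \<in> ?A" "u \<notin> {c - int m + 1..c + int m}" "\<not> (u \<le> c \<longleftrightarrow> s u \<le> c)" by blast
    note nf = not_far_inversion_displacement[OF s u(1)]
    show "\<exists>d\<in>{m..N}. E d s"
    proof (cases "u \<le> c")
      case True
      have d: "u = c - int (nat (c - u))" using True by simp
      have "far_inversion ?A s u (int (nat (c - u)))"
        using nf[of "int (nat (c - u))"] u(3) True by linarith
      then have "E (nat (c - u)) s" unfolding E_def using u(1) d by metis
      moreover have "nat (c - u) \<in> {m..N}" using u True by (auto simp: N_def)
      ultimately show ?thesis by blast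
    next
      case False
      have d: "u = c + 1 + int (nat (u - c - 1))" using False by simp
      have "far_inversion ?A s u (int (nat (u - c - 1)))"
        using nf[of "int (nat (u - c - 1))"] u(3) False by linarith
      then have "E (nat (u - c - 1)) s" unfolding E_def using u(1) d by metis
      moreover have "nat (u - c - 1) \<in> {m..N}" using u False by (auto simp: N_def)
      ultimately show ?thesis by blast
    qed
  qed (use p in auto)
  also have "\<dots> \<le> (\<Sum>d=m..N. 2 * far_bound p d)" by (intro sum_mono E)
  also have "\<dots> = 2 * (4 / ((1 - p) * (1 - sqrt p))) * sqrt p * (\<Sum>d=m..N. sqrt p ^ d)"
    by (simp add: far_bound_def sum_distrib_left mult.assoc)
  also have "\<dots> \<le> 2 * (4 / ((1 - p) * (1 - sqrt p))) * sqrt p * (sqrt p ^ m / (1 - sqrt p))"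
    by (intro mult_left_mono sum_power_le) (use p in auto)
  also have "\<dots> = outer_bound p m" by (simp add: outer_bound_def far_bound_def mult_ac)
  finally show ?thesis .
qed

lemma far_bound_tendsto_0: "0 < p \<Longrightarrow> p < 1 \<Longrightarrow> far_bound p \<longlonglongrightarrow> 0"
proof -
  assume p: "0 < p" "p < 1"
  have "(\<lambda>l. 4 / ((1 - p) * (1 - sqrt p)) * sqrt p ^ (l + 1)) \<longlonglongrightarrow> 4 / ((1 - p) * (1 - sqrt p)) * 0"
    by (intro tendsto_mult tendsto_const LIMSEQ_ignore_initial_segment LIMSEQ_power_zero) (use p in simp)
  then show ?thesis by (simp add: far_bound_def[abs_def])
qed

lemma outer_bound_tendsto_0: "0 < p \<Longrightarrow> p < 1 \<Longrightarrow> outer_bound p \<longlonglongrightarrow> 0"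
  using tendsto_mult[OF tendsto_const[of "2 / (1 - sqrt p)"] far_bound_tendsto_0, of p]
  by (simp add: outer_bound_def[abs_def])

text \<open>Independence of a block pattern from whatever rearranging the block leaves unchanged, in
  product form.\<close>

lemma mexp_resample_mult:
  assumes p: "0 < p" and A: "finite A" and sub: "{a..b} \<subseteq> A"
    and G: "\<And>s t. s permutes A \<Longrightarrow> t permutes {a..b} \<Longrightarrow> G (s \<circ> t) = G s"
  shows "mexp p A (\<lambda>s. f (pattern s {a..b}) * G s) = mexp p {a..b} f * mexp p A G"
  using mexp_resample[OF p A sub, of "\<lambda>t s. f t * G s"] G
  by (simp add: mexp_cmult mexp_cmult_right)

text \<open>The identity has weight 1, the largest possible, among \<open>fact (card A)\<close>
  permutations.\<close>

lemma mallows_prob_ge_fact: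
  assumes p: "0 < p" "p < 1" and A: "finite A"
  shows "1 / fact (card A) \<le> mallows_prob p A id"
proof -
  have "(\<Sum>s\<in>{s. s permutes A}. p ^ inv_count A s) \<le> (\<Sum>s\<in>{s. s permutes A}. 1)"
    by (intro sum_mono power_le_one) (use p in auto)
  then have "(\<Sum>s\<in>{s. s permutes A}. p ^ inv_count A s) \<le> fact (card A)"
    using card_permutations[OF refl A] by simp
  moreover have "inv_count A id = 0" unfolding inv_count_def by (auto simp: card_eq_0_iff)
  ultimately show ?thesis
    using mallows_partition_pos[OF p(1) A] by (simp add: mallows_prob_def frac_le)
qed

text \<open>If the pattern on a block around \<open>c\<close> is the identity and no position outside the block
  is sent across \<open>c\<close>, then \<open>c\<close> is a cut: the two conditions are independent by resampling.\<close>

lemma cut_if_block_sorted: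
  assumes s: "s permutes {a..b}" and sub: "{c - int m + 1..c + int m} \<subseteq> {a..b}"
    and pat: "pattern s {c - int m + 1..c + int m} = id"
    and out: "\<forall>u\<in>{a..b}. u \<notin> {c - int m + 1..c + int m} \<longrightarrow> (u \<le> c \<longleftrightarrow> s u \<le> c)"
  shows "cut {a..b} c s"
proof -
  let ?A = "{a..b}" and ?J = "{c - int m + 1..c + int m}"
  show ?thesis
  proof (rule cut_if_upper[OF s])
    fix u assume u: "u \<in> ?A" "c < u"
    show "c < s u"
    proof (rule ccontr)
      \<comment> \<open>Pigeonhole: since the block is sorted, its positions up to \<open>c\<close>
        would have values below \<open>s u \<le> c\<close>. Then \<open>u\<close> and all positions
        up to \<open>c\<close> would compete for the values up to \<open>c\<close>, one too
        many.\<close>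
      assume su: "\<not> c < s u"
      then have uJ: "u \<in> ?J" using out u by force
      let ?B = "{v \<in> ?A. v \<le> c}"
      have finB: "finite ?B" by (rule finite_Collect_conjI) simp
      have sv: "s v \<le> c" if v: "v \<in> ?B" for v
      proof (cases "v \<in> ?J")
        case True
        have "v < u" using u v by simp
        then have "s v < s u"
          using pattern_less_iff[OF permutes_inj_on[OF s] True uJ] pat by simp
        then show ?thesis using su by simp
      next
        case False
        then show ?thesis using out v by force
      qed
      have "s ` insert u ?B \<subseteq> ?B"
      proof
        fix w assume "w \<in> s ` insert u ?B"
        then obtain v where v: "w = s v" "v \<in> insert u ?B" by blast
        then have "v \<in> ?A" using u by blast
        then have "w \<in> ?A" unfolding v(1) using permutes_in_image[OF s] by blast
        moreover have "w \<le> c" using v sv su by auto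
        ultimately show "w \<in> ?B" by blast
      qed
      then have "card (s ` insert u ?B) \<le> card ?B" by (rule card_mono[OF finB])
      moreover have "card (s ` insert u ?B) = card (insert u ?B)"
        by (rule card_image[OF permutes_inj_on[OF s]])
      moreover have "u \<notin> ?B" using u by simp
      ultimately show False using finB by simp
    qed
  qed simp
qed

text \<open>\<open>1 / fact (2 * m)\<close> bounds the chance of a sorted block of
  \<open>2 * m\<close> positions and \<open>1 / 2\<close> the chance that nothing outside it
  crosses. The bound is the same for every ambient interval.\<close>

lemma mexp_cut_ge:
  assumes p: "0 < p" "p < 1" and m: "outer_bound p m \<le> 1 / 2"
    and sub: "{c - int m + 1..c + int m} \<subseteq> {a..b}"
  shows "1 / (2 * fact (2 * m)) \<le> mexp p {a..b} (\<lambda>s. of_bool (cut {a..b} c s))"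
proof -
  let ?A = "{a..b}" and ?J = "{c - int m + 1..c + int m}"
  let ?Out = "\<lambda>s. \<forall>u\<in>?A. u \<notin> ?J \<longrightarrow> (u \<le> c \<longleftrightarrow> s u \<le> c)"
  have "1 = mexp p ?A (\<lambda>s. of_bool (?Out s)) + mexp p ?A (\<lambda>s. of_bool (\<not> ?Out s))"
  proof -
    have "of_bool (?Out s) + of_bool (\<not> ?Out s) = (1 :: real)" for s by (cases "?Out s") simp_all
    then show ?thesis unfolding mexp_add[symmetric] using p by (simp only: mexp_const finite_atLeastAtMost_int)
  qed
  moreover have "mexp p ?A (\<lambda>s. of_bool (\<not> ?Out s)) \<le> 1 / 2"
  proof -
    have "(\<not> ?Out s) = (\<exists>u\<in>?A. u \<notin> ?J \<and> \<not> (u \<le> c \<longleftrightarrow> s u \<le> c))" for s by blast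
    then show ?thesis using mexp_crossing_far_from[OF p, of a b c m] m by (simp only:)
  qed
  ultimately have out: "1 / 2 \<le> mexp p ?A (\<lambda>s. of_bool (?Out s))" by simp
  have "1 / fact (2 * m) \<le> mallows_prob p ?J id"
    using mallows_prob_ge_fact[OF p, of ?J] by (simp add: nat_mult_distrib)
  also have "\<dots> = mexp p ?J (\<lambda>t. of_bool (t = id))"
    unfolding mexp_def using permutes_id[of ?J]
    by (subst sum.mono_neutral_cong_right[where S = "{id}" and h = "\<lambda>_. mallows_prob p ?J id"])
      (auto simp: finite_permutations)
  finally have id: "1 / fact (2 * m) \<le> mexp p ?J (\<lambda>t. of_bool (t = id))" .
  have "1 / (2 * fact (2 * m)) = 1 / fact (2 * m) * (1 / 2 :: real)" by simp
  also have "\<dots> \<le> mexp p ?J (\<lambda>t. of_bool (t = id)) * mexp p ?A (\<lambda>s. of_bool (?Out s))"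
    using id out by (intro mult_mono) (auto intro: order_trans[rotated])
  also have "\<dots> = mexp p ?A (\<lambda>s. of_bool (pattern s ?J = id) * of_bool (?Out s))"
  proof (rule mexp_resample_mult[OF p(1) _ sub, symmetric])
    fix s t :: "int \<Rightarrow> int" assume t: "t permutes ?J"
    have "(s \<circ> t) u = s u" if "u \<notin> ?J" for u using permutes_not_in[OF t that] by simp
    then show "of_bool (?Out (s \<circ> t)) = (of_bool (?Out s) :: real)" by presburger
  qed simp
  also have "\<dots> \<le> mexp p ?A (\<lambda>s. of_bool (cut ?A c s))"
  proof (rule mexp_mono[OF p(1)])
    fix s assume s: "s permutes ?A"
    show "of_bool (pattern s ?J = id) * of_bool (?Out s) \<le> (of_bool (cut ?A c s) :: real)"
      using cut_if_block_sorted[OF s sub] by (cases "pattern s ?J = id"; cases "?Out s") simp_all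
  qed simp
  finally show ?thesis .
qed

text \<open>A substitute for \<open>cut\<close> that depends on one window only, hence is
  independent for disjoint windows. Radius \<open>2 * l\<close> leaves room \<open>l\<close> around
  every position within \<open>l\<close> of \<open>c\<close>.\<close>

definition window_cut :: "nat \<Rightarrow> int \<Rightarrow> (int \<Rightarrow> int) \<Rightarrow> bool" where
  "window_cut l c s \<longleftrightarrow> cut {c - 2 * int l..c + 2 * int l} c (pattern s {c - 2 * int l..c + 2 * int l})"

text \<open>A window cut fails to be a cut only if a position farther than about \<open>l\<close>
  crosses, or one of the \<open>2 * l + 1\<close> positions within \<open>l\<close> of the centre
  has a far inversion.\<close>

definition cut_error :: "real \<Rightarrow> nat \<Rightarrow> real" where
  "cut_error p l = outer_bound p l + real (2 * l + 1) * far_bound p l"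

lemma cut_error_tendsto_0:
  assumes p: "0 < p" "p < 1"
  shows "cut_error p \<longlonglongrightarrow> 0"
proof -
  define r where "r = sqrt p"
  have r: "norm r < 1" using p by (simp add: r_def)
  define c where "c = 4 / ((1 - p) * (1 - r))"
  have "(\<lambda>l. outer_bound p l + c * r * (2 * (real l * r ^ l) + r ^ l)) \<longlonglongrightarrow> 0 + c * r * (2 * 0 + 0)"
    using r by (intro tendsto_intros outer_bound_tendsto_0 p powser_times_n_limit_0 LIMSEQ_power_zero)
  moreover have "cut_error p = (\<lambda>l. outer_bound p l + c * r * (2 * (real l * r ^ l) + r ^ l))"
    by (simp add: cut_error_def far_bound_def c_def r_def fun_eq_iff algebra_simps add_divide_distrib)
  ultimately show ?thesis by simp
qed

lemma mexp_window_cut_not_cut: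
  assumes p: "0 < p" "p < 1" and sub: "{c - 2 * int l..c + 2 * int l} \<subseteq> {a..b}"
  shows "mexp p {a..b} (\<lambda>s. of_bool (window_cut l c s \<and> \<not> cut {a..b} c s)) \<le> cut_error p l"
proof -
  let ?A = "{a..b}" and ?W = "{c - 2 * int l..c + 2 * int l}"
  let ?Cr = "\<lambda>s. \<exists>u\<in>?A. u \<notin> {c - int l + 1..c + int l} \<and> \<not> (u \<le> c \<longleftrightarrow> s u \<le> c)"
  let ?F = "\<lambda>s. \<exists>u\<in>{c - int l..c + int l}. far_inversion ?A s u (int l)"
  have ab: "a \<le> c - 2 * int l" "c + 2 * int l \<le> b" using sub by (auto simp: atLeastatMost_subset_iff)
  have "mexp p ?A (\<lambda>s. of_bool (window_cut l c s \<and> \<not> cut ?A c s))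
      \<le> mexp p ?A (\<lambda>s. of_bool (?Cr s) + of_bool (?F s))"
  proof (rule mexp_mono[OF p(1)])
    fix s assume s: "s permutes ?A"
    have "cut ?A c s" if w: "window_cut l c s" and C: "\<not> ?Cr s" and F: "\<not> ?F s"
      unfolding cut_def
    proof
      fix u assume u: "u \<in> ?A"
      show "u \<le> c \<longleftrightarrow> s u \<le> c"
      proof (cases "u \<in> {c - int l + 1..c + int l}")
        case True
        then have 1: "c - int l \<le> u" "u \<le> c + int l" by auto
        then have "\<not> far_inversion ?A s u (int l)" using F by (metis atLeastAtMost_iff)
        then have "pattern s ?W u = s u"
          using 1 ab by (intro not_far_inversion_pattern[OF s]) auto
        moreover have "u \<in> ?W" using 1 by simp
        ultimately show ?thesis using w unfolding window_cut_def cut_def by metis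
      next
        case False
        then show ?thesis using C u by blast
      qed
    qed
    then show "of_bool (window_cut l c s \<and> \<not> cut ?A c s) \<le> (of_bool (?Cr s) + of_bool (?F s) :: real)"
      by (cases "?Cr s"; cases "?F s") auto
  qed simp
  also have "\<dots> \<le> outer_bound p l + real (2 * l + 1) * far_bound p l"
    unfolding mexp_add
  proof (intro add_mono mexp_crossing_far_from p)
    have "mexp p ?A (\<lambda>s. of_bool (?F s))
        \<le> (\<Sum>u\<in>{c - int l..c + int l}. mexp p ?A (\<lambda>s. of_bool (far_inversion ?A s u (int l))))"
      by (rule mexp_of_bool_le_sum) (use p in auto)
    also have "\<dots> \<le> (\<Sum>u\<in>{c - int l..c + int l}. far_bound p l)"
      by (intro sum_mono mexp_far_inversion p) (use ab in auto)
    also have "\<dots> = real (2 * l + 1) * far_bound p l" by (simp add: nat_add_distrib nat_mult_distrib)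
    finally show "mexp p ?A (\<lambda>s. of_bool (?F s)) \<le> real (2 * l + 1) * far_bound p l" .
  qed
  finally show ?thesis by (simp add: cut_error_def)
qed

text \<open>The separation makes the windows disjoint. Resampling both permutations on the window of
  \<open>d\<close> splits off a factor \<open>1 - P\<^sup>2\<close>, where \<open>P\<close> is the
  chance of a cut there for one of them.\<close>

lemma mexp_no_common_window_cut:
  assumes p: "0 < p" "p < 1" and m: "outer_bound p m \<le> 1 / 2" "m \<le> l"
    and D: "finite D" "\<And>d. d \<in> D \<Longrightarrow> {d - 2 * int l..d + 2 * int l} \<subseteq> A" "finite A"
    and sep: "\<And>d d'. d \<in> D \<Longrightarrow> d' \<in> D \<Longrightarrow> d \<noteq> d' \<Longrightarrow> 4 * int l < \<bar>d - d'\<bar>"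
  shows "mexp p A (\<lambda>s. mexp p A (\<lambda>t. of_bool (\<forall>d\<in>D. \<not> (window_cut l d s \<and> window_cut l d t))))
     \<le> (1 - (1 / (2 * fact (2 * m)))\<^sup>2) ^ card D"
  using D(1) D(2) sep
proof (induction D rule: finite_induct)
  case empty
  show ?case using p D(3) by (simp add: mexp_const)
next
  case (insert d D)
  let ?\<delta> = "1 / (2 * fact (2 * m)) :: real"
  let ?W = "{d - 2 * int l..d + 2 * int l}"
  define G where "G s t = (of_bool (\<forall>d\<in>D. \<not> (window_cut l d s \<and> window_cut l d t)) :: real)" for s t
  define f where "f s = (of_bool (cut ?W d s) :: real)" for s
  define P where "P = mexp p ?W f"
  have W: "?W \<subseteq> A" using insert.prems(1) by simp
  have inv: "window_cut l d' (s \<circ> t) \<longleftrightarrow> window_cut l d' s" if "t permutes ?W" "d' \<in> D" for s t d'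
  proof -
    have "4 * int l < \<bar>d - d'\<bar>" using insert.prems(2)[of d d'] insert.hyps(2) that by auto
    then have "?W \<inter> {d' - 2 * int l..d' + 2 * int l} = {}" by auto
    then show ?thesis unfolding window_cut_def by (simp add: pattern_comp_disjoint[OF that(1)])
  qed
  have G1: "G (s \<circ> t) u = G s u" and G2: "G u (s \<circ> t) = G u s" if "t permutes ?W" for s t u
    using inv[OF that] by (auto simp: G_def)
  have w: "of_bool (window_cut l d s) = f (pattern s ?W)" for s
    by (simp add: window_cut_def f_def)
  have "mexp p A (\<lambda>s. mexp p A (\<lambda>t. of_bool (\<forall>d\<in>insert d D. \<not> (window_cut l d s \<and> window_cut l d t))))
     = mexp p A (\<lambda>s. mexp p A (\<lambda>t. G s t - f (pattern s ?W) * (f (pattern t ?W) * G s t)))"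
    unfolding w[symmetric] by (intro mexp_cong) (auto simp: G_def)
  also have "\<dots> = mexp p A (\<lambda>s. mexp p A (G s)) - P * (P * mexp p A (\<lambda>s. mexp p A (G s)))"
  proof -
    have "mexp p A (\<lambda>t. f (pattern t ?W) * G s t) = P * mexp p A (G s)" for s
      unfolding P_def by (rule mexp_resample_mult[OF p(1) D(3) W]) (rule G2)
    moreover have "mexp p A (\<lambda>s. f (pattern s ?W) * mexp p A (G s)) = P * mexp p A (\<lambda>s. mexp p A (G s))"
      unfolding P_def by (rule mexp_resample_mult[OF p(1) D(3) W], rule mexp_cong, rule G1)
    ultimately show ?thesis
      by (simp add: mexp_diff mexp_cmult mult.left_commute)
  qed
  also have "\<dots> = (1 - P\<^sup>2) * mexp p A (\<lambda>s. mexp p A (G s))"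
    by (simp add: power2_eq_square algebra_simps)
  also have "\<dots> \<le> (1 - ?\<delta>\<^sup>2) * (1 - ?\<delta>\<^sup>2) ^ card D"
  proof (rule mult_mono)
    have "?\<delta> \<le> P" unfolding P_def f_def
      by (rule mexp_cut_ge[OF p m(1)]) (use m(2) in auto)
    then show "1 - P\<^sup>2 \<le> 1 - ?\<delta>\<^sup>2" by (simp add: power_mono)
    show "mexp p A (\<lambda>s. mexp p A (G s)) \<le> (1 - ?\<delta>\<^sup>2) ^ card D"
      unfolding G_def by (rule insert.IH) (use insert.prems in auto)
    have "1 \<le> 2 * (fact (2 * m) :: real)" using fact_ge_1[of "2 * m", where 'a = real] by linarith
    then have "?\<delta> \<le> 1" by (simp only: divide_le_eq_1) simp
    then show "0 \<le> 1 - ?\<delta>\<^sup>2" by (simp add: power_le_one)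
    show "0 \<le> mexp p A (\<lambda>s. mexp p A (G s))"
      using p D(3) by (intro mexp_ge_const) (auto simp: G_def)
  qed
  finally show ?case using insert.hyps by simp
qed

lemma mexp_no_common_cut:
  assumes p: "0 < p" "p < 1" and m: "outer_bound p m \<le> 1 / 2" "m \<le> l"
    and D: "finite D" "\<And>d. d \<in> D \<Longrightarrow> {d - 2 * int l..d + 2 * int l} \<subseteq> {a..b}"
    and sep: "\<And>d d'. d \<in> D \<Longrightarrow> d' \<in> D \<Longrightarrow> d \<noteq> d' \<Longrightarrow> 4 * int l < \<bar>d - d'\<bar>"
  shows "mexp p {a..b} (\<lambda>s. mexp p {a..b} (\<lambda>t. of_bool (\<forall>d\<in>D. \<not> (cut {a..b} d s \<and> cut {a..b} d t))))
     \<le> (1 - (1 / (2 * fact (2 * m)))\<^sup>2) ^ card D + 2 * real (card D) * cut_error p l"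
proof -
  let ?A = "{a..b}"
  let ?E = "\<lambda>s t. \<forall>d\<in>D. \<not> (window_cut l d s \<and> window_cut l d t)"
  let ?B = "\<lambda>s. \<exists>d\<in>D. window_cut l d s \<and> \<not> cut ?A d s"
  have B: "mexp p ?A (\<lambda>s. of_bool (?B s)) \<le> real (card D) * cut_error p l"
  proof -
    have "mexp p ?A (\<lambda>s. of_bool (?B s))
        \<le> (\<Sum>d\<in>D. mexp p ?A (\<lambda>s. of_bool (window_cut l d s \<and> \<not> cut ?A d s)))"
      by (rule mexp_of_bool_le_sum) (use p D in auto)
    also have "\<dots> \<le> (\<Sum>d\<in>D. cut_error p l)"
      by (intro sum_mono mexp_window_cut_not_cut p D(2))
    finally show ?thesis by simp
  qed
  have "mexp p ?A (\<lambda>s. mexp p ?A (\<lambda>t. of_bool (\<forall>d\<in>D. \<not> (cut ?A d s \<and> cut ?A d t))))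
     \<le> mexp p ?A (\<lambda>s. mexp p ?A (\<lambda>t. of_bool (?E s t) + of_bool (?B s) + of_bool (?B t)))"
  proof (intro mexp_mono p(1) finite_atLeastAtMost_int)
    fix s t
    show "(of_bool (\<forall>d\<in>D. \<not> (cut ?A d s \<and> cut ?A d t)) :: real)
        \<le> of_bool (?E s t) + of_bool (?B s) + of_bool (?B t)"
      by (cases "?E s t"; cases "?B s"; cases "?B t") auto
  qed
  also have "\<dots> = mexp p ?A (\<lambda>s. mexp p ?A (\<lambda>t. of_bool (?E s t)))
      + mexp p ?A (\<lambda>s. of_bool (?B s)) + mexp p ?A (\<lambda>s. of_bool (?B s))"
    using p by (simp add: mexp_add mexp_const)
  also have "\<dots> \<le> (1 - (1 / (2 * fact (2 * m)))\<^sup>2) ^ card D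
      + real (card D) * cut_error p l + real (card D) * cut_error p l"
    by (intro add_mono B mexp_no_common_window_cut p m D sep) auto
  finally show ?thesis by simp
qed

section \<open>Tightness of the cycle length\<close>

lemma local_cycle_prob_partial_sum:
  "(\<Sum>i=1..K. local_cycle_prob p i L) = mexp p {- int L..int L} (\<lambda>s. mexp p {- int L..int L}
     (\<lambda>t. of_bool (card (fwd_orbit (t \<circ> s) 0) \<in> {1..K})))"
proof -
  have "(\<Sum>i=1..K. of_bool (n = i)) = (of_bool (n \<in> {1..K}) :: real)" for n
    by (simp add: of_bool_def)
  then show ?thesis by (simp add: local_cycle_prob_def mexp_sum[symmetric])
qed

text \<open>Both permutations preserve the part of the window in \<open>{c<..d}\<close>, which
  contains 0 and has at most \<open>2 * K\<close> elements.\<close>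

lemma card_fwd_orbit_between_cuts:
  assumes s: "s permutes {- int L..int L}" and t: "t permutes {- int L..int L}"
    and c: "cut {- int L..int L} c s" "cut {- int L..int L} c t"
      "cut {- int L..int L} d s" "cut {- int L..int L} d t"
    and 0: "- int K \<le> c" "c < 0" "0 \<le> d" "d < int K"
  shows "card (fwd_orbit (t \<circ> s) 0) \<in> {1..2 * K}"
proof -
  let ?A = "{- int L..int L}"
  let ?B = "?A \<inter> {c<..d}"
  have im: "s ` ?B \<subseteq> ?B" if "s permutes ?A" "cut ?A c s" "cut ?A d s" for s
  proof
    fix w assume "w \<in> s ` ?B"
    then obtain u where u: "w = s u" "u \<in> ?A" "c < u" "u \<le> d" by auto
    have "s u \<in> ?A" using permutes_in_image[OF that(1)] u(2) by blast
    moreover have "c < s u" "s u \<le> d" using that(2,3) u unfolding cut_def by (meson not_le)+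
    ultimately show "w \<in> ?B" using u(1) by simp
  qed
  have "(t \<circ> s) ` ?B \<subseteq> ?B" using im[OF s c(1,3)] im[OF t c(2,4)]
    unfolding image_comp[symmetric] by blast
  then have sub: "fwd_orbit (t \<circ> s) 0 \<subseteq> ?B" by (rule fwd_orbit_subset) (use 0 in auto)
  have fin: "finite ?B" by simp
  have "card (fwd_orbit (t \<circ> s) 0) \<le> card ?B" by (rule card_mono[OF fin sub])
  also have "\<dots> \<le> card {c<..d}" by (rule card_mono) auto
  also have "\<dots> \<le> 2 * K" using 0 by simp
  finally have le: "card (fwd_orbit (t \<circ> s) 0) \<le> 2 * K" .
  have "card (fwd_orbit (t \<circ> s) 0) \<noteq> 0"
    using self_in_fwd_orbit[of 0 "t \<circ> s"] finite_subset[OF sub fin] by auto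
  then show ?thesis using le by simp
qed

text \<open>Uniformity in \<open>L\<close> keeps mass from escaping to long cycles. The order of
  choices matters: \<open>m\<close> fixes the chance of a cut, \<open>k\<close> the number of
  windows, then \<open>l\<close> makes window cuts reliable for all \<open>k\<close> of them, and
  \<open>K\<close> contains them all.\<close>

lemma local_cycle_prob_tight:
  assumes p: "0 < p" "p < 1" and e: "0 < e"
  shows "\<exists>K L0. \<forall>L\<ge>L0. 1 - e \<le> (\<Sum>i=1..K. local_cycle_prob p i L)"
proof -
  obtain m where m: "outer_bound p m < 1 / 2"
    using eventually_happens'[OF sequentially_bot order_tendstoD(2)[OF outer_bound_tendsto_0[OF p], of "1 / 2"]] by auto
  define \<delta> where "\<delta> = 1 / (2 * fact (2 * m) :: real)"
  have "0 < \<delta>" by (simp add: \<delta>_def)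
  moreover have "\<delta> \<le> 1 / 2" using fact_ge_1[of "2 * m", where 'a = real] by (simp add: \<delta>_def divide_le_eq)
  ultimately have "norm (1 - \<delta>\<^sup>2) < 1" by (simp add: abs_less_iff power_le_one less_le_trans[OF _ power_le_one])
  then have "(\<lambda>k. (1 - \<delta>\<^sup>2) ^ k) \<longlonglongrightarrow> 0" by (rule LIMSEQ_power_zero)
  then obtain k where k: "(1 - \<delta>\<^sup>2) ^ k < e / 4"
    using eventually_happens'[OF sequentially_bot order_tendstoD(2), of _ 0 "e / 4"] e by auto
  have "(\<lambda>l. 2 * real k * cut_error p l) \<longlonglongrightarrow> 2 * real k * 0"
    by (intro tendsto_intros cut_error_tendsto_0 p)
  then have "\<forall>\<^sub>F l in sequentially. 2 * real k * cut_error p l < e / 4 \<and> m \<le> l"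
    using e by (intro eventually_conj order_tendstoD(2)[of _ 0] eventually_ge_at_top) auto
  then obtain l where l: "2 * real k * cut_error p l < e / 4" "m \<le> l"
    using eventually_happens'[OF sequentially_bot] by blast
  \<comment> \<open>Spacing \<open>4 * l + 1\<close> makes windows of radius \<open>2 * l\<close>
    disjoint; the offset \<open>2 * l\<close> starts them at 0.\<close>
  define c where "c j = int j * (4 * int l + 1) + 2 * int l" for j
  define D where "D = c ` {..<k}"
  \<comment> \<open>A cut at \<open>d\<close> is the gap between \<open>d\<close> and
    \<open>d + 1\<close>; reflection about 0 sends it to the gap at \<open>- d - 1\<close>, which
    lies left of 0.\<close>
  define D' where "D' = (\<lambda>d. - d - 1) ` D"
  define K where "K = (k + 1) * (4 * l + 1)"
  have c: "0 \<le> c j" "2 * int l \<le> c j" "c j + 2 * int l + 1 \<le> int K" if "j < k" for j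
  proof -
    have "int (j + 1) * (4 * int l + 1) \<le> int k * (4 * int l + 1)"
      using that by (intro mult_right_mono) auto
    then show "0 \<le> c j" "2 * int l \<le> c j" "c j + 2 * int l + 1 \<le> int K"
      by (simp_all add: c_def K_def algebra_simps)
  qed
  have csep: "4 * int l < \<bar>c i - c j\<bar>" if "i \<noteq> j" for i j
  proof -
    have "c i - c j = (int i - int j) * (4 * int l + 1)" by (simp add: c_def algebra_simps)
    then have "\<bar>c i - c j\<bar> = \<bar>int i - int j\<bar> * (4 * int l + 1)" by (simp add: abs_mult)
    moreover have "1 * (4 * int l + 1) \<le> \<bar>int i - int j\<bar> * (4 * int l + 1)"
      using that by (intro mult_right_mono) auto
    ultimately have "4 * int l + 1 \<le> \<bar>c i - c j\<bar>" by (simp only: mult_1)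
    then show ?thesis by (simp only: add1_zle_eq)
  qed
  have "inj_on c {..<k}"
    by (rule inj_onI) (use csep in fastforce)
  then have cD: "card D = k" by (simp add: D_def card_image)
  have cD': "card D' = k" unfolding D'_def cD[symmetric] by (rule card_image) (simp add: inj_on_def)
  have main: "1 - e \<le> (\<Sum>i=1..2 * K. local_cycle_prob p i L)" if L: "K \<le> L" for L
  proof -
    let ?A = "{- int L..int L}"
    let ?N = "\<lambda>D s t. \<forall>d\<in>D. \<not> (cut ?A d s \<and> cut ?A d t)"
    let ?O = "\<lambda>s t. card (fwd_orbit (t \<circ> s) 0) \<in> {1..2 * K}"
    have bound: "mexp p ?A (\<lambda>s. mexp p ?A (\<lambda>t. of_bool (?N D s t))) \<le> e / 2"
      if "finite D" "card D = k" "\<And>d. d \<in> D \<Longrightarrow> {d - 2 * int l..d + 2 * int l} \<subseteq> ?A"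
        "\<And>d d'. d \<in> D \<Longrightarrow> d' \<in> D \<Longrightarrow> d \<noteq> d' \<Longrightarrow> 4 * int l < \<bar>d - d'\<bar>" for D
    proof -
      have "mexp p ?A (\<lambda>s. mexp p ?A (\<lambda>t. of_bool (?N D s t)))
         \<le> (1 - \<delta>\<^sup>2) ^ card D + 2 * real (card D) * cut_error p l"
        unfolding \<delta>_def by (rule mexp_no_common_cut[OF p less_imp_le[OF m] l(2) that(1,3,4)])
      then show ?thesis using k l(1) that(2) by simp
    qed
    have b1: "mexp p ?A (\<lambda>s. mexp p ?A (\<lambda>t. of_bool (?N D s t))) \<le> e / 2"
    proof (rule bound)
      show "4 * int l < \<bar>d - d'\<bar>" if dd: "d \<in> D" "d' \<in> D" "d \<noteq> d'" for d d'
      proof -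
        obtain i j where ij: "d = c i" "d' = c j" using dd by (auto simp: D_def)
        then have "i \<noteq> j" using dd by auto
        then show ?thesis using csep[of i j] ij by simp
      qed
      show "{d - 2 * int l..d + 2 * int l} \<subseteq> ?A" if "d \<in> D" for d
        using that c L by (fastforce simp: D_def)
    qed (simp_all add: cD, simp add: D_def)
    have b2: "mexp p ?A (\<lambda>s. mexp p ?A (\<lambda>t. of_bool (?N D' s t))) \<le> e / 2"
    proof (rule bound)
      show "4 * int l < \<bar>d - d'\<bar>" if dd: "d \<in> D'" "d' \<in> D'" "d \<noteq> d'" for d d'
      proof -
        obtain i j where ij: "d = - c i - 1" "d' = - c j - 1" using dd by (auto simp: D'_def D_def)
        then have "i \<noteq> j" using dd by auto
        then show ?thesis using csep[of j i] ij by simp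
      qed
      show "{d - 2 * int l..d + 2 * int l} \<subseteq> ?A" if d: "d \<in> D'" for d
      proof -
        obtain j where j: "j < k" "d = - c j - 1" using d by (auto simp: D'_def D_def)
        then show ?thesis using c[OF j(1)] L by auto
      qed
    qed (simp_all add: cD', simp add: D'_def D_def)
    have "1 = mexp p ?A (\<lambda>s. mexp p ?A (\<lambda>t. 1))" using p by (simp add: mexp_const)
    also have "\<dots> \<le> mexp p ?A (\<lambda>s. mexp p ?A (\<lambda>t. of_bool (?O s t) + of_bool (?N D s t) + of_bool (?N D' s t)))"
    proof (intro mexp_mono p(1) finite_atLeastAtMost_int)
      fix s t assume s: "s permutes ?A" and t: "t permutes ?A"
      show "(1 :: real) \<le> of_bool (?O s t) + of_bool (?N D s t) + of_bool (?N D' s t)"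
      proof (cases "?N D s t \<or> ?N D' s t")
        case False
        then obtain d d' where d: "d \<in> D" "cut ?A d s" "cut ?A d t"
          and d': "d' \<in> D'" "cut ?A d' s" "cut ?A d' t" by blast
        obtain i j where ij: "i < k" "j < k" "d = c i" "d' = - c j - 1"
          using d(1) d'(1) by (auto simp: D'_def D_def)
        have "?O s t"
          by (rule card_fwd_orbit_between_cuts[OF s t d'(2,3) d(2,3)])
            (use c[OF ij(1)] c[OF ij(2)] ij(3,4) in auto)
        then show ?thesis by simp
      qed auto
    qed
    also have "\<dots> = (\<Sum>i=1..2 * K. local_cycle_prob p i L)
        + mexp p ?A (\<lambda>s. mexp p ?A (\<lambda>t. of_bool (?N D s t))) + mexp p ?A (\<lambda>s. mexp p ?A (\<lambda>t. of_bool (?N D' s t)))"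
      by (simp only: local_cycle_prob_partial_sum mexp_add)
    finally show ?thesis using b1 b2 by linarith
  qed
  then show ?thesis by blast
qed

section \<open>Total mass of the limiting densities\<close>

lemma mu_nonneg: "1 < q \<Longrightarrow> 0 \<le> mu q (Suc i)"
proof -
  assume q: "1 < q"
  have "0 \<le> 2 * real (Suc i) * mu q (Suc i)"
    by (rule tendsto_lowerbound[OF exp_cycle_count_tendsto(2)[OF q]])
      (use q in \<open>auto intro!: always_eventually local_cycle_prob_01\<close>)
  then show ?thesis by (simp add: zero_le_mult_iff)
qed

text \<open>Finite partial sums pass to the limit in \<open>L\<close>, where they stay at most 1;
  tightness bounds them from below, which justifies exchanging the limit with the infinite
  sum.\<close>

lemma sums_mu:
  assumes q: "1 < q"
  shows "(\<lambda>k. 2 * real (Suc k) * mu q (Suc k)) sums 1"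
proof -
  define p where "p = 1 / q"
  have p: "0 < p" "p < 1" using q by (auto simp: p_def)
  define f where "f k = 2 * real (Suc k) * mu q (Suc k)" for k
  have lim: "(\<lambda>L. \<Sum>i=1..n. local_cycle_prob p i L) \<longlonglongrightarrow> (\<Sum>k<n. f k)" for n
  proof -
    have "(\<lambda>L. \<Sum>i=1..n. local_cycle_prob p i L) \<longlonglongrightarrow> (\<Sum>i=1..n. 2 * real i * mu q i)"
      unfolding p_def by (intro tendsto_sum exp_cycle_count_tendsto q) auto
    also have "(\<Sum>i=1..n. 2 * real i * mu q i) = (\<Sum>k<n. f k)"
      unfolding f_def by (simp add: sum.atLeast1_atMost_eq)
    finally show ?thesis .
  qed
  have f0: "0 \<le> f k" for k unfolding f_def using mu_nonneg[OF q, of k] by simp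
  have le1: "(\<Sum>k<n. f k) \<le> 1" for n
  proof (rule tendsto_upperbound[OF lim always_eventually])
    show "\<forall>L. (\<Sum>i=1..n. local_cycle_prob p i L) \<le> 1"
      unfolding local_cycle_prob_partial_sum using p by (auto intro!: mexp_le_const)
  qed simp
  have "(\<lambda>n. \<Sum>k<n. f k) \<longlonglongrightarrow> 1"
  proof (rule LIMSEQ_I)
    fix r :: real assume r: "0 < r"
    obtain K L0 where K: "\<And>L. L0 \<le> L \<Longrightarrow> 1 - r / 2 \<le> (\<Sum>i=1..K. local_cycle_prob p i L)"
      using local_cycle_prob_tight[OF p, of "r / 2"] r by auto
    have "1 - r / 2 \<le> (\<Sum>k<K. f k)"
      by (rule tendsto_lowerbound[OF lim eventually_sequentiallyI[of L0]]) (use K in auto)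
    moreover have "(\<Sum>k<K. f k) \<le> (\<Sum>k<n. f k)" if "K \<le> n" for n
      by (rule sum_mono2) (use that f0 in auto)
    ultimately have "norm ((\<Sum>k<n. f k) - 1) < r" if "K \<le> n" for n
      using le1[of n] that r unfolding real_norm_def by (smt (verit) field_sum_of_halves)
    then show "\<exists>no. \<forall>n\<ge>no. norm ((\<Sum>k<n. f k) - 1) < r" by blast
  qed
  then show ?thesis unfolding sums_def f_def .
qed

section \<open>The limits in q\<close>

text \<open>The transposition rearranges only \<open>L + 1\<close> consecutive positions, and
  \<open>(L + 1)\<^sup>2\<close> is a crude bound for the inversions among them. For fixed
  \<open>L\<close> the factor tends to 1 as \<open>q\<close> decreases to 1.\<close>

lemma mexp_comp_swap_le:
  assumes q: "1 \<le> q" and sub: "{x..x + int L} \<subseteq> A" "finite A" and z: "x < z" "z \<le> x + int L"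
    and g: "\<And>s. s permutes A \<Longrightarrow> 0 \<le> g s"
  shows "mexp q A (\<lambda>s. g (s \<circ> Transposition.transpose x z)) \<le> q ^ ((L + 1)\<^sup>2) * mexp q A g"
proof -
  let ?T = "Transposition.transpose x z"
  have TI: "?T permutes {x..x + int L}" using z by (intro permutes_swap_id) auto
  have T: "?T permutes A" by (rule permutes_subset[OF TI sub(1)])
  have TT: "?T \<circ> ?T = id" by simp
  have w: "mallows_prob q A s \<le> q ^ ((L + 1)\<^sup>2) * mallows_prob q A (s \<circ> ?T)" for s
  proof -
    have "inv_count A s \<le> inv_count A (s \<circ> ?T) + inv_count {x..x + int L} s"
      using inv_count_comp_interval[OF sub(2,1) TI, of s] by simp
    also have "inv_count {x..x + int L} s \<le> (L + 1)\<^sup>2"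
      using inv_count_le[of "{x..x + int L}" s] by (simp add: nat_add_distrib)
    finally have "inv_count A s \<le> inv_count A (s \<circ> ?T) + (L + 1)\<^sup>2" by (simp only: add_left_mono)
    then have "q ^ inv_count A s \<le> q ^ (inv_count A (s \<circ> ?T) + (L + 1)\<^sup>2)"
      using q by (rule power_increasing)
    then show ?thesis
      using mallows_partition_pos[of q A] q sub(2)
      by (simp add: mallows_prob_def power_add mult.commute divide_right_mono del: power2_sum)
  qed
  have "mexp q A (\<lambda>s. g (s \<circ> ?T)) \<le>
      (\<Sum>s\<in>{s. s permutes A}. q ^ ((L + 1)\<^sup>2) * mallows_prob q A (s \<circ> ?T) * g (s \<circ> ?T))"
    unfolding mexp_def
    by (intro sum_mono mult_right_mono w g) (use permutes_compose[OF T] in auto)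
  also have "\<dots> = (\<Sum>s\<in>{s. s permutes A}. q ^ ((L + 1)\<^sup>2) * mallows_prob q A s * g s)"
    by (rule sum.reindex_bij_witness[where i = "\<lambda>s. s \<circ> ?T" and j = "\<lambda>s. s \<circ> ?T"])
      (use permutes_compose[OF T] in \<open>auto simp: comp_assoc TT\<close>)
  also have "\<dots> = q ^ ((L + 1)\<^sup>2) * mexp q A g"
    by (simp add: mexp_def sum_distrib_left mult.assoc)
  finally show ?thesis .
qed

text \<open>After the swap, \<open>z\<close> is sent to \<open>s x\<close> and from there follows
  the old cycle of \<open>x\<close> until it reaches \<open>x\<close>. Thus \<open>x\<close> can be
  recovered from \<open>z\<close> and the new permutation.\<close>

lemma funpow_merged_cycle:
  assumes s: "inj s" and k: "0 < k" and card: "card (fwd_orbit s x) = k" and z: "z \<notin> fwd_orbit s x"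
  shows "((s \<circ> Transposition.transpose x z) ^^ k) z = x"
proof -
  let ?h = "s \<circ> Transposition.transpose x z"
  have per: "(s ^^ k) x = x" and min: "\<And>j. 0 < j \<Longrightarrow> j < k \<Longrightarrow> (s ^^ j) x \<noteq> x"
    using card card_fwd_orbit_iff[OF s k, of x] by auto
  have nz: "(s ^^ j) x \<noteq> z" for j using z by (auto simp: fwd_orbit_def)
  have "j < k \<Longrightarrow> (?h ^^ Suc j) z = (s ^^ Suc j) x" for j
  proof (induction j)
    case (Suc j)
    have IH: "(?h ^^ Suc j) z = (s ^^ Suc j) x" by (rule Suc.IH) (use Suc.prems in simp)
    have "(?h ^^ Suc (Suc j)) z = ?h ((?h ^^ Suc j) z)" by simp
    also have "\<dots> = ?h ((s ^^ Suc j) x)" by (simp only: IH)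
    also have "\<dots> = s ((s ^^ Suc j) x)"
      using min[of "Suc j"] nz[of "Suc j"] Suc.prems by (simp add: transpose_apply_other)
    also have "\<dots> = (s ^^ Suc (Suc j)) x" by simp
    finally show ?case .
  qed simp
  from this[of "k - 1"] show ?thesis using k per by simp
qed

text \<open>Composing with a transposition of positions at distance at most \<open>L\<close> merges a \<open>k\<close>-cycle with another cycle, at the cost
  of a bounded factor; a given permutation arises in at most \<open>n\<close> ways.\<close>

lemma exp_cycle_count_le:
  assumes q: "1 \<le> q" and k: "0 < k" and L: "k < L"
  shows "real k * exp_cycle_count q k n \<le> q ^ ((L + 1)\<^sup>2) * real n / (real L - real k) + real L"
proof -
  let ?A = "{1..int n}"
  let ?N = "q ^ ((L + 1)\<^sup>2)"
  define P where "P x = mexp q ?A (\<lambda>s. of_bool (card (fwd_orbit s x) = k))" for x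
  \<comment> \<open>The last \<open>L\<close> positions are dropped so that the block from
    \<open>x\<close> to \<open>x + L\<close> stays inside; they account for the additive term
    \<open>L\<close>.\<close>
  define X where "X = {1..int n - int L}"
  have q0: "0 < q" using q by simp
  have P01: "0 \<le> P x" "P x \<le> 1" for x
    unfolding P_def using mexp_of_bool_01[OF q0] by auto
  have "(real L - real k) * (\<Sum>x\<in>X. P x)
     = mexp q ?A (\<lambda>s. \<Sum>x\<in>X. (real L - real k) * of_bool (card (fwd_orbit s x) = k))"
    by (simp only: P_def mexp_sum mexp_cmult sum_distrib_left)
  also have "\<dots> \<le> mexp q ?A (\<lambda>s. \<Sum>x\<in>X. \<Sum>z\<in>{x + 1..x + int L}.
      of_bool (card (fwd_orbit s x) = k \<and> z \<notin> fwd_orbit s x))"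
  proof (intro mexp_mono[OF q0] sum_mono)
    fix s x
    let ?Z = "{x + 1..x + int L}"
    show "(real L - real k) * of_bool (card (fwd_orbit s x) = k)
       \<le> (\<Sum>z\<in>?Z. of_bool (card (fwd_orbit s x) = k \<and> z \<notin> fwd_orbit s x))"
    proof (cases "card (fwd_orbit s x) = k")
      case True
      then have fin: "finite (fwd_orbit s x)" using k by (metis card.infinite less_irrefl)
      \<comment> \<open>The cycle occupies at most \<open>k\<close> of the \<open>L\<close>
        candidates, leaving at least \<open>L - k\<close> partners outside it.\<close>
      have "card ?Z - card (fwd_orbit s x) \<le> card (?Z - fwd_orbit s x)"
        by (rule diff_card_le_card_Diff[OF fin])
      then have "L - k \<le> card (?Z - fwd_orbit s x)" using True by simp
      then have "real L - real k \<le> real (card (?Z - fwd_orbit s x))" by linarith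
      also have "?Z - fwd_orbit s x = ?Z \<inter> {z. z \<notin> fwd_orbit s x}" by blast
      finally show ?thesis using True by (simp add: of_bool_def sum.If_cases)
    qed (simp add: sum_nonneg)
  qed simp
  also have "\<dots> = (\<Sum>x\<in>X. \<Sum>z\<in>{x + 1..x + int L}.
      mexp q ?A (\<lambda>s. of_bool (card (fwd_orbit s x) = k \<and> z \<notin> fwd_orbit s x)))"
    by (simp only: mexp_sum)
  also have "\<dots> \<le> (\<Sum>x\<in>X. \<Sum>z\<in>{x + 1..x + int L}. ?N * mexp q ?A (\<lambda>s. of_bool ((s ^^ k) z = x)))"
  proof (intro sum_mono)
    fix x z assume x: "x \<in> X" and z: "z \<in> {x + 1..x + int L}"
    let ?T = "Transposition.transpose x z"
    have "mexp q ?A (\<lambda>s. of_bool (card (fwd_orbit s x) = k \<and> z \<notin> fwd_orbit s x))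
        \<le> mexp q ?A (\<lambda>s. of_bool (((s \<circ> ?T) ^^ k) z = x))"
    proof (rule mexp_mono[OF q0])
      fix s assume "s permutes ?A"
      then show "(of_bool (card (fwd_orbit s x) = k \<and> z \<notin> fwd_orbit s x) :: real)
          \<le> of_bool (((s \<circ> ?T) ^^ k) z = x)"
        using funpow_merged_cycle[OF permutes_inj k, of s ?A x z] by (auto simp del: funpow.simps)
    qed simp
    also have "\<dots> \<le> ?N * mexp q ?A (\<lambda>s. of_bool ((s ^^ k) z = x))"
      by (rule mexp_comp_swap_le[OF q, of x L ?A z "\<lambda>s. of_bool ((s ^^ k) z = x)"])
        (use x z in \<open>auto simp: X_def\<close>)
    finally show "mexp q ?A (\<lambda>s. of_bool (card (fwd_orbit s x) = k \<and> z \<notin> fwd_orbit s x))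
        \<le> ?N * mexp q ?A (\<lambda>s. of_bool ((s ^^ k) z = x))" .
  qed
  also have "\<dots> = ?N * mexp q ?A (\<lambda>s. \<Sum>x\<in>X. \<Sum>z\<in>{x + 1..x + int L}. of_bool ((s ^^ k) z = x))"
    by (simp only: mexp_sum sum_distrib_left)
  also have "\<dots> \<le> ?N * real n"
  proof (intro mult_left_mono mexp_le_const[OF q0])
    fix s
    have "(\<Sum>x\<in>X. \<Sum>z\<in>{x + 1..x + int L}. of_bool ((s ^^ k) z = x))
       \<le> (\<Sum>x\<in>X. \<Sum>z\<in>?A. (of_bool ((s ^^ k) z = x) :: real))"
      by (intro sum_mono sum_mono2) (auto simp: X_def)
    also have "\<dots> = (\<Sum>z\<in>?A. \<Sum>x\<in>X. of_bool ((s ^^ k) z = x))" by (rule sum.swap)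
    \<comment> \<open>For given \<open>s\<close> and \<open>z\<close> only one \<open>x\<close> can
      equal \<open>(s ^^ k) z\<close>.\<close>
    also have "\<dots> \<le> (\<Sum>z\<in>?A. 1)"
      by (intro sum_mono) (simp add: X_def of_bool_def)
    finally show "(\<Sum>x\<in>X. \<Sum>z\<in>{x + 1..x + int L}. of_bool ((s ^^ k) z = x)) \<le> real n" by simp
  qed (use q in auto)
  finally have main: "(\<Sum>x\<in>X. P x) \<le> ?N * real n / (real L - real k)"
    using L by (simp add: field_simps)
  have "real k * exp_cycle_count q k n = (\<Sum>x\<in>?A. P x)"
    unfolding P_def by (rule exp_cycle_count_mult[OF k])
  also have "\<dots> \<le> (\<Sum>x\<in>X \<union> {int n - int L + 1..int n}. P x)"
    by (rule sum_mono2) (use P01 in \<open>auto simp: X_def\<close>)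
  also have "\<dots> \<le> (\<Sum>x\<in>X. P x) + (\<Sum>x\<in>{int n - int L + 1..int n}. P x)"
    by (subst sum.union_disjoint) (auto simp: X_def)
  also have "(\<Sum>x\<in>{int n - int L + 1..int n}. P x) \<le> (\<Sum>x\<in>{int n - int L + 1..int n}. 1)"
    by (intro sum_mono P01)
  finally show ?thesis using main by simp
qed

lemma mu_le:
  assumes q: "1 < q" and i: "0 < i" and L: "2 * i < L"
  shows "mu q i \<le> q ^ ((L + 1)\<^sup>2) / (real L - real (2 * i))"
proof -
  have conv: "(\<lambda>n. exp_cycle_count q (2 * i) n / real n) \<longlonglongrightarrow> mu q i"
    unfolding mu_def using exp_cycle_count_tendsto(1)[OF q i] by (simp add: convergent_LIMSEQ_iff)
  let ?B = "q ^ ((L + 1)\<^sup>2) / (real L - real (2 * i))"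
  have "real (2 * i) * mu q i \<le> ?B"
  proof (rule tendsto_le[OF sequentially_bot])
    show "(\<lambda>n. real (2 * i) * (exp_cycle_count q (2 * i) n / real n)) \<longlonglongrightarrow> real (2 * i) * mu q i"
      by (intro tendsto_intros conv)
    show "(\<lambda>n. ?B + real L / real n) \<longlonglongrightarrow> ?B"
      using tendsto_add[OF tendsto_const[of ?B] lim_const_over_n[of "real L"]] by simp
    show "\<forall>\<^sub>F n in sequentially. real (2 * i) * (exp_cycle_count q (2 * i) n / real n) \<le> ?B + real L / real n"
      using eventually_gt_at_top[of 0]
    proof eventually_elim
      case (elim n)
      have "real (2 * i) * exp_cycle_count q (2 * i) n / real n
         \<le> (q ^ ((L + 1)\<^sup>2) * real n / (real L - real (2 * i)) + real L) / real n"
        using q i L by (intro divide_right_mono exp_cycle_count_le) auto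
      also have "\<dots> = ?B + real L / real n" using elim by (simp add: add_divide_distrib)
      finally show ?case by simp
    qed
  qed
  moreover have "0 \<le> mu q i" using mu_nonneg[OF q, of "i - 1"] i by simp
  then have "1 * mu q i \<le> real (2 * i) * mu q i" using i by (intro mult_right_mono) auto
  ultimately show ?thesis by simp
qed

text \<open>Beyond the first \<open>K\<close> terms the weights in \<open>sums_mu\<close> are at
  least \<open>2 * Suc K\<close>, so the total mass 1 controls the tail.\<close>

lemma suminf_mu_le:
  assumes q: "1 < q" and b: "\<And>k. k < K \<Longrightarrow> mu q (Suc k) \<le> b" "0 \<le> b"
  shows "(\<Sum>k. \<bar>mu q (Suc k)\<bar>) \<le> real K * b + 1 / (2 * real (Suc K))"
proof -
  let ?f = "\<lambda>k. 2 * real (Suc k) * mu q (Suc k)"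
  have f: "(\<lambda>k. ?f k / (2 * real (Suc K))) sums (1 / (2 * real (Suc K)))"
    by (rule sums_divide[OF sums_mu[OF q]])
  have "(\<lambda>k. if k \<in> {..<K} then b else 0) sums (\<Sum>k<K. b)"
    by (rule sums_If_finite_set) simp
  from sums_add[OF this f]
  have g: "(\<lambda>k. (if k \<in> {..<K} then b else 0) + ?f k / (2 * real (Suc K))) sums (real K * b + 1 / (2 * real (Suc K)))"
    by simp
  have le: "\<bar>mu q (Suc k)\<bar> \<le> (if k \<in> {..<K} then b else 0) + ?f k / (2 * real (Suc K))" for k
  proof (cases "k < K")
    case True
    then show ?thesis using b(1)[OF True] mu_nonneg[OF q, of k] by (simp add: add_increasing2)
  next
    case False
    then have "2 * real (Suc K) * mu q (Suc k) \<le> ?f k"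
      using mu_nonneg[OF q, of k] by (intro mult_right_mono) auto
    then show ?thesis using False mu_nonneg[OF q, of k] by (simp add: field_simps)
  qed
  have "summable (\<lambda>k. \<bar>mu q (Suc k)\<bar>)"
    by (rule summable_comparison_test'[OF sums_summable[OF g], of 0]) (use le in simp)
  from suminf_le[OF le this sums_summable[OF g]] show ?thesis
    using sums_unique[OF g] by simp
qed

lemma suminf_mu_tendsto_at_right_1: "((\<lambda>q. \<Sum>k. \<bar>mu q (Suc k)\<bar>) \<longlongrightarrow> 0) (at_right 1)"
proof (rule tendstoI)
  fix e :: real assume e: "0 < e"
  \<comment> \<open>\<open>K\<close> makes the tail smaller than \<open>e / 2\<close>, then
    \<open>M\<close> does the same for \<open>K\<close> terms of size \<open>2 / M\<close>. Only
    after \<open>L\<close> is fixed is \<open>q\<close> taken so close to 1 that its power stays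
    below 2.\<close>
  obtain K :: nat where K: "2 / e < real K" using reals_Archimedean2 by blast
  have K0: "0 < K" using K e by (metis divide_pos_pos of_nat_0_less_iff order_less_trans zero_less_numeral)
  obtain M :: nat where M: "4 * real K / e < real M" using reals_Archimedean2 by blast
  have M0: "0 < M" using M e K0 by (metis divide_pos_pos mult_pos_pos of_nat_0_less_iff order_less_trans zero_less_numeral)
  define L where "L = 2 * K + M"
  define b where "b = 2 / real M"
  have "((\<lambda>q::real. q ^ ((L + 1)\<^sup>2)) \<longlongrightarrow> 1 ^ ((L + 1)\<^sup>2)) (at_right 1)"
    by (intro tendsto_intros)
  then have "\<forall>\<^sub>F q::real in at_right 1. q ^ ((L + 1)\<^sup>2) < 2"
    by (intro order_tendstoD(2)[where y = 1]) (auto simp del: power2_sum)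
  moreover have "\<forall>\<^sub>F q::real in at_right 1. 1 < q" by (rule eventually_at_right_less)
  ultimately show "\<forall>\<^sub>F q in at_right 1. dist (\<Sum>k. \<bar>mu q (Suc k)\<bar>) 0 < e"
  proof eventually_elim
    case (elim q)
    have "mu q (Suc k) \<le> b" if k: "k < K" for k
    proof -
      have "mu q (Suc k) \<le> q ^ ((L + 1)\<^sup>2) / (real L - real (2 * Suc k))"
        by (rule mu_le) (use elim k M0 in \<open>auto simp: L_def\<close>)
      also have "\<dots> \<le> 2 / real M"
        using elim k M0 by (intro frac_le) (auto simp: L_def simp del: power2_sum)
      finally show ?thesis by (simp add: b_def)
    qed
    then have "(\<Sum>k. \<bar>mu q (Suc k)\<bar>) \<le> real K * b + 1 / (2 * real (Suc K))"
      by (intro suminf_mu_le elim) (auto simp: b_def)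
    also have "\<dots> < e / 2 + e / 2"
    proof (rule add_strict_mono)
      show "real K * b < e / 2" using M M0 e by (simp add: b_def field_simps)
      have "2 < real K * e" using K e by (simp add: field_simps)
      then have "1 < 2 * real (Suc K) * (e / 2)" using e by (simp add: algebra_simps)
      then show "1 / (2 * real (Suc K)) < e / 2" by (simp add: field_simps)
    qed
    finally have "(\<Sum>k. \<bar>mu q (Suc k)\<bar>) < e" by simp
    moreover have "0 \<le> (\<Sum>k. \<bar>mu q (Suc k)\<bar>)"
    proof (rule suminf_nonneg)
      have "summable (\<lambda>k. 2 * real (Suc k) * mu q (Suc k))" using sums_mu[OF elim(2)] by (rule sums_summable)
      moreover have "norm \<bar>mu q (Suc k)\<bar> \<le> 2 * real (Suc k) * mu q (Suc k)" for k
      proof -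
        have "1 * mu q (Suc k) \<le> 2 * real (Suc k) * mu q (Suc k)"
          using mu_nonneg[OF elim(2), of k] by (intro mult_right_mono) auto
        then show ?thesis using mu_nonneg[OF elim(2), of k] by simp
      qed
      ultimately show "summable (\<lambda>k. \<bar>mu q (Suc k)\<bar>)"
        by (rule summable_comparison_test'[where N = 0])
    qed simp
    ultimately show ?case by (simp add: dist_real_def)
  qed
qed

text \<open>If neither permutation has an inversion involving 0, both fix 0, and so does the
  composition.\<close>

lemma two_mu_1_ge:
  assumes q: "1 < q"
  shows "1 - 2 * far_bound (1 / q) 0 \<le> 2 * mu q 1"
proof -
  define p where "p = 1 / q"
  have p: "0 < p" "p < 1" using q by (auto simp: p_def)
  have "1 - 2 * far_bound p 0 \<le> local_cycle_prob p 1 L" for L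
  proof -
    let ?A = "{- int L..int L}"
    let ?F = "\<lambda>s. far_inversion ?A s 0 0"
    have F: "mexp p ?A (\<lambda>s. of_bool (?F s)) \<le> far_bound p 0"
      using mexp_far_inversion[OF p, of 0 "- int L" "int L" 0] by simp
    have "1 = mexp p ?A (\<lambda>s. mexp p ?A (\<lambda>t. 1))" using p by (simp add: mexp_const)
    also have "\<dots> \<le> mexp p ?A (\<lambda>s. mexp p ?A (\<lambda>t.
        of_bool (card (fwd_orbit (t \<circ> s) 0) = 1) + of_bool (?F s) + of_bool (?F t)))"
    proof (intro mexp_mono p(1) finite_atLeastAtMost_int)
      fix s t assume s: "s permutes ?A" and t: "t permutes ?A"
      show "(1 :: real) \<le> of_bool (card (fwd_orbit (t \<circ> s) 0) = 1) + of_bool (?F s) + of_bool (?F t)"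
      proof (cases "?F s \<or> ?F t")
        case False
        then have "s 0 = 0" "t 0 = 0"
          using not_far_inversion_displacement[OF s, of 0 0] not_far_inversion_displacement[OF t, of 0 0] by auto
        moreover have "inj (t \<circ> s)" using s t by (intro inj_compose permutes_inj)
        ultimately have "card (fwd_orbit (t \<circ> s) 0) = 1" by (intro fwd_orbit_card_cases) auto
        then show ?thesis by simp
      qed auto
    qed
    also have "\<dots> = local_cycle_prob p 1 L + mexp p ?A (\<lambda>s. of_bool (?F s)) + mexp p ?A (\<lambda>s. of_bool (?F s))"
      using p by (simp add: mexp_add mexp_const local_cycle_prob_def)
    finally show ?thesis using F by linarith
  qed
  then have "1 - 2 * far_bound p 0 \<le> 2 * real 1 * mu q 1"
    unfolding p_def
    by (intro tendsto_lowerbound[OF exp_cycle_count_tendsto(2)[OF q, of 1]] always_eventually) auto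
  then show ?thesis by (simp add: p_def)
qed

lemma suminf_mu_tendsto_at_top:
  "((\<lambda>q. \<Sum>k. \<bar>mu q (Suc k) - (if k = 0 then 1 / 2 else 0)\<bar>) \<longlongrightarrow> 0) at_top"
proof (rule tendsto_sandwich[where f = "\<lambda>_. 0" and h = "\<lambda>q. 2 * far_bound (1 / q) 0"])
  let ?S = "\<lambda>q. \<Sum>k. \<bar>mu q (Suc k) - (if k = 0 then 1 / 2 else 0)\<bar>"
  show "((\<lambda>q. 2 * far_bound (1 / q) 0) \<longlongrightarrow> 0) at_top"
    unfolding far_bound_def by real_asymp
  have bounds: "0 \<le> ?S q \<and> ?S q \<le> 2 * far_bound (1 / q) 0" if q: "1 < q" for q
  proof -
    let ?f = "\<lambda>k. 2 * real (Suc k) * mu q (Suc k)"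
    \<comment> \<open>A majorant with computable sum: \<open>?g 0\<close> equals
      \<open>1 / 2 - mu q 1\<close>, later terms dominate \<open>mu q (Suc k)\<close> through half
      of their weight, and the total is \<open>1 - 2 * mu q 1\<close>.\<close>
    let ?g = "\<lambda>k. (if k \<in> {0} then 1 / 2 - 2 * mu q 1 else 0) + ?f k / 2"
    have f0: "0 \<le> ?f k" for k using mu_nonneg[OF q, of k] by simp
    have "(\<lambda>k. if k \<in> {0} then 1 / 2 - 2 * mu q 1 else 0) sums (\<Sum>k\<in>{0::nat}. 1 / 2 - 2 * mu q 1)"
      by (rule sums_If_finite_set) simp
    from sums_add[OF this sums_divide[OF sums_mu[OF q], of 2]]
    have g: "?g sums (1 - 2 * mu q 1)" by simp
    have "sum ?f {0} \<le> suminf ?f"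
      by (rule sum_le_suminf[OF sums_summable[OF sums_mu[OF q]]]) (use f0 in auto)
    then have "2 * mu q 1 \<le> 1" using sums_unique[OF sums_mu[OF q]] by simp
    then have le: "\<bar>mu q (Suc k) - (if k = 0 then 1 / 2 else 0)\<bar> \<le> ?g k" for k
      using mu_nonneg[OF q, of k] by (cases k) (auto simp: algebra_simps)
    have sm: "summable (\<lambda>k. \<bar>mu q (Suc k) - (if k = 0 then 1 / 2 else 0)\<bar>)"
      by (rule summable_comparison_test'[OF sums_summable[OF g], of 0]) (use le in simp)
    have "?S q \<le> suminf ?g" by (rule suminf_le[OF le sm sums_summable[OF g]])
    also have "\<dots> = 1 - 2 * mu q 1" using sums_unique[OF g] by simp
    also have "\<dots> \<le> 2 * far_bound (1 / q) 0" using two_mu_1_ge[OF q] by simp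
    finally have "?S q \<le> 2 * far_bound (1 / q) 0" .
    moreover have "0 \<le> ?S q" by (rule suminf_nonneg[OF sm]) simp
    ultimately show ?thesis by blast
  qed
  show "\<forall>\<^sub>F q in at_top. 0 \<le> ?S q" "\<forall>\<^sub>F q in at_top. ?S q \<le> 2 * far_bound (1 / q) 0"
    using eventually_gt_at_top[of 1] by (eventually_elim, use bounds in blast)+
qed simp

theorem theorem1p5:
  shows "(\<forall>q::real. q > 1 \<longrightarrow> (\<forall>i::nat. i \<ge> 1 \<longrightarrow>
           convergent (\<lambda>n. exp_cycle_count q (2 * i) n / real n))) \<and>
  (\<forall>q::real. \<forall>(M::'a measure) S S'. q > 1 \<and> mallows_Z M (1 / q) S \<and> mallows_Z M (1 / q) S'
          \<and> prob_space.indep_var M perm_space S perm_space S' \<longrightarrow>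
          (\<forall>i::nat. i \<ge> 1 \<longrightarrow>
             mu q i = 1 / (2 * real i) *
               measure M {\<omega> \<in> space M. card (fwd_orbit (S' \<omega> \<circ> S \<omega>) 0) = i})
          \<and> ((\<lambda>j::int. (measure M {\<omega> \<in> space M. S \<omega> 0 = j})\<^sup>2) has_sum (2 * mu q 1)) UNIV) \<and>
  (\<forall>q::real. q > 1 \<longrightarrow> (\<lambda>k. 2 * real (Suc k) * mu q (Suc k)) sums 1) \<and>
  (((\<lambda>q. \<Sum>k. \<bar>mu q (Suc k)\<bar>) \<longlongrightarrow> 0) (at_right 1) \<and>
  ((\<lambda>q. \<Sum>k. \<bar>mu q (Suc k) - (if k = 0 then 1 / 2 else 0)\<bar>) \<longlongrightarrow> 0) at_top)"
proof (intro conjI allI impI)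
  fix q :: real and i :: nat assume "1 < q" "1 \<le> i"
  then show "convergent (\<lambda>n. exp_cycle_count q (2 * i) n / real n)"
    by (intro exp_cycle_count_tendsto) auto
next
  fix q :: real and M :: "'a measure" and S S'
  assume *: "1 < q \<and> mallows_Z M (1 / q) S \<and> mallows_Z M (1 / q) S'
    \<and> prob_space.indep_var M perm_space S perm_space S'"
  then have q: "1 < q" and Z: "mallows_Z M (1 / q) S" and Z': "mallows_Z M (1 / q) S'"
    and ind: "prob_space.indep_var M perm_space S perm_space S'" by blast+
  \<comment> \<open>Both sides are limits of \<open>local_cycle_prob (1 / q) i\<close>.\<close>
  have key: "2 * real i * mu q i = measure M {\<omega> \<in> space M. card (fwd_orbit (S' \<omega> \<circ> S \<omega>) 0) = i}"
    if "0 < i" for i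
    using exp_cycle_count_tendsto(2)[OF q that] mallows_Z_cycle_prob_tendsto[OF Z Z' ind that]
    by (rule LIMSEQ_unique)
  {
    fix i :: nat assume "1 \<le> i"
    then show "mu q i = 1 / (2 * real i) *
        measure M {\<omega> \<in> space M. card (fwd_orbit (S' \<omega> \<circ> S \<omega>) 0) = i}"
      using key[of i, symmetric] by simp
  }
  show "((\<lambda>j::int. (measure M {\<omega> \<in> space M. S \<omega> 0 = j})\<^sup>2) has_sum (2 * mu q 1)) UNIV"
    using mallows_Z_fixed_point_sum[OF Z Z' ind] key[of 1] by simp
qed (use sums_mu suminf_mu_tendsto_at_right_1 suminf_mu_tendsto_at_top in auto)

end
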